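(* Let $\mathfrak{F}$ be a circuit function class, $\mathfrak{F}_s=\mathfrak{F}[\mathrm{sign}]$, $\mathcal{A}$ a set of functions $\mathbb{R}\to\mathbb{R}$, and let $\mathcal{C}=(C_n)_{n\in\mathbb{N}}$ be a $\mathrm{rec}[\mathfrak{F}_s]\text{-}\mathfrak{F}[\mathcal{A}]$-circuit family. Then there exist a $\mathrm{rec}[t\mathfrak{F}_s]\text{-}(t\mathfrak{F}_s[\mathcal{A}],\mathrm{id})$-GNN $\mathit{rec}\text{-}\mathcal{N}=(\mathcal{N},f^{GNN}_{halt})$ and a symbolic logspace graph encoding $\mathfrak{G}$ such that for all $n\in\mathbb{N}$ and $\bar x\in\mathbb{R}^n$ the feature values of $f_{\mathit{rec}\text{-}\mathcal{N}}(\mathfrak{G}(C_n,\bar x))$ include $f_{C_n}(\bar x)$.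
   Context: Circuits: an arithmetic circuit is a finite DAG with ordered input gates, real constant gates, $+$/$\times$ gates and ordered output gates computing $\mathbb{R}^n\to\mathbb{R}^m$; an extended circuit additionally has ordered auxiliary memory gates behaving like inputs. Circuits may use extra unary gates computing functions from a set $\mathcal{A}$. A circuit function class is $\mathfrak{F}=\mathrm{FAC}^i_{\mathbb{R}}[\mathcal{B}]$: functions computed by circuit families $(C_n)_n$ ($n$ inputs) of size $n^{O(1)}$ and depth $O((\log n)^i)$ with extra gates from $\mathcal{B}$; $\mathfrak{F}[\mathcal{A}]$ adds gates from $\mathcal{A}$; $\mathfrak{F}_s=\mathfrak{F}[\mathrm{sign}]$, $\mathrm{sign}(x)=1$ if $x>0$, else $0$. A recurrent circuit $(C,\bar a,E_{rec},f_{halt},V_{halt})$ consists of an extended circuit $C$, initial auxiliary values $\bar a$, one recurrent incoming edge to each memory (input or auxiliary) gate, halting gates $V_{halt}$ and a halting function $f_{halt}:\mathbb{N}_{>0}\times\mathbb{R}^{|V_{halt}|}\to\{0,1\}$; it iterates $C$, after iteration $i$ outputting the output-gate values if $f_{halt}(i,\text{values of }V_{halt})=1$, otherwise loading each memory gate with its recurrent predecessor's value and iterating again; $f_{C_n}$ is the function so computed. A $\mathrm{rec}[\mathfrak{F}_{halt}]\text{-}\mathfrak{F}_C$-circuit family is a recurrent circuit family whose underlying extended circuit family is an $\mathfrak{F}_C$-family and whose halting functions are among those computed by some $\mathfrak{F}_{halt}$-circuit family. Tail-symmetric: $f(v_1,\dots,v_n)=f(v_1,\pi(v_2,\dots,v_n))$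 for all permutations $\pi$; $t\mathfrak{F}$ = tail-symmetric functions of $\mathfrak{F}$. Labelled graphs $(V,E,g_V)$: ordered vertices, undirected edges, $g_V:V\to\mathbb{R}$. A $\mathrm{rec}[t\mathfrak{F}_{halt}]\text{-}(t\mathfrak{F}',\mathcal{A}')$-GNN is a pair $(\mathcal{N},f^{GNN}_{halt})$ with $\mathcal{N}:\mathbb{N}\to\mathcal{S}\times\mathcal{A}'$ periodic, $\mathcal{S}\subseteq t\mathfrak{F}'$ (functions computed by tail-symmetric circuit families), $\mathcal{A}'$ a set of activation functions, and $f^{GNN}_{halt}:\mathbb{N}_{>0}\times\mathbb{R}^*\to\{0,1\}$ tail-symmetric in $t\mathfrak{F}_{halt}$. With $\mathcal{N}(i)=(\mathcal{C}^{(i)},\sigma^{(i)})$ it sets $h^{(0)}=g_V$, $h^{(i)}(w)=\sigma^{(i)}\big(f_{\mathcal{C}^{(i)}}(h^{(i-1)}(w),\{\!\{h^{(i-1)}(u):u\in N(w)\}\!\})\big)$, and outputs $(V,E,h^{(\ell)})$ for the smallest $\ell$ with $f^{GNN}_{halt}(\ell,\{\!\{h^{(\ell)}(v)\}\!\})=1$. $\mathrm{id}$ is the identity activation. Graph encodings: a symbolically labelled graph is a graph with ordered vertices whose labels are symbols $\mathit{in}_i$, $\mathit{aux}_i$, $\mathit{const}_i$ or natural numbers $\le|V|$. A symbolic logspace graph encoding is a map $\mathfrak{G}$ from recurrent circuits to symbolically labelled graphs such that $\mathfrak{G}(C)=\mathit{dec}(f(\langle C\rangle))$ for some function $f$ computed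 by a logspace transducer, where $\langle C\rangle$ is a fixed binary encoding of $C$ (including its halting circuit) in which input, auxiliary memory and constant gates are encoded by their indices, and $\mathit{dec}$ is the inverse of a fixed binary encoding of symbolically labelled graphs. The associated graph encoding $\mathfrak{G}(C,\bar x)$ is the labelled graph obtained by replacing each label $\mathit{in}_i$ by $x_i$, each $\mathit{aux}_i$ and $\mathit{const}_i$ by the corresponding initial/constant value in $C$, and each natural number label by itself. *)

theory Defs
  imports "HOL-Library.Multiset" "HOL-Library.Landau_Symbols"
begin

section \<open>Arithmetic circuits\<close>

text \<open>
  A gate is a kind together with the list of its predecessors. Gates are referred to by their
  position in the gate list. Constants and extra unary functions are kept in tables of the
  circuit, and \<open>Const i\<close>, \<open>Fun i\<close> refer to entries of these tables; so the gate list itself is a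
  finite combinatorial object that can be encoded as a word.
\<close>

datatype kind = Input nat | Aux nat | Const nat | Plus | Times | Fun nat | Output nat

type_synonym gate = "kind \<times> nat list"

record circuit =
  n_in :: nat
  n_aux :: nat
  n_out :: nat
  const_tab :: "real list"
  fun_tab :: "(real \<Rightarrow> real) list"
  gates :: "gate list"

definition csize :: "circuit \<Rightarrow> nat" where
  "csize C = length (gates C)"

definition kind_of :: "circuit \<Rightarrow> nat \<Rightarrow> kind" where
  "kind_of C g = fst (gates C ! g)"

definition preds :: "circuit \<Rightarrow> nat \<Rightarrow> nat list" where
  "preds C g = snd (gates C ! g)"

definition wires :: "circuit \<Rightarrow> (nat \<times> nat) set" where
  "wires C = {(p, g). g < csize C \<and> p \<in> set (preds C g)}"

text \<open>\<open>R ^^ k\<close> relates the end points of the paths with \<open>k\<close> edges: this is the length of a longest path.\<close>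

definition depth :: "circuit \<Rightarrow> nat" where
  "depth C = Max {k. wires C ^^ k \<noteq> {}}"

fun fan_in_ok :: "kind \<Rightarrow> nat \<Rightarrow> bool" where
  "fan_in_ok (Input _) d = (d = 0)"
| "fan_in_ok (Aux _) d = (d = 0)"
| "fan_in_ok (Const _) d = (d = 0)"
| "fan_in_ok Plus d = (d > 0)"
| "fan_in_ok Times d = (d > 0)"
| "fan_in_ok (Fun _) d = (d = 1)"
| "fan_in_ok (Output _) d = (d = 1)"

text \<open>The gates of kind \<open>K\<close> carry the indices \<open>0, \<dots>, m - 1\<close>, each exactly once.\<close>

definition numbered :: "circuit \<Rightarrow> (nat \<Rightarrow> kind) \<Rightarrow> nat \<Rightarrow> bool" where
  "numbered C K m \<longleftrightarrow>
     (\<forall>i < m. \<exists>!g. g < csize C \<and> kind_of C g = K i) \<and>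
     (\<forall>g < csize C. \<forall>i. kind_of C g = K i \<longrightarrow> i < m)"

definition wf_circuit :: "circuit \<Rightarrow> bool" where
  "wf_circuit C \<longleftrightarrow>
     (\<forall>g < csize C. fan_in_ok (kind_of C g) (length (preds C g)) \<and>
        distinct (preds C g) \<and> set (preds C g) \<subseteq> {..< csize C}) \<and>
     acyclic (wires C) \<and>
     numbered C Input (n_in C) \<and> numbered C Aux (n_aux C) \<and>
     numbered C Const (length (const_tab C)) \<and> numbered C Output (n_out C) \<and>
     (\<forall>g < csize C. \<forall>i. kind_of C g = Fun i \<longrightarrow> i < length (fun_tab C))"

fun gate_op :: "circuit \<Rightarrow> real list \<Rightarrow> real list \<Rightarrow> kind \<Rightarrow> real list \<Rightarrow> real" where
  "gate_op C xs as (Input i) vs = xs ! i"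
| "gate_op C xs as (Aux i) vs = as ! i"
| "gate_op C xs as (Const i) vs = const_tab C ! i"
| "gate_op C xs as Plus vs = sum_list vs"
| "gate_op C xs as Times vs = prod_list vs"
| "gate_op C xs as (Fun i) vs = (fun_tab C ! i) (hd vs)"
| "gate_op C xs as (Output i) vs = hd vs"

text \<open>
  Evaluation along the wires, cut off after a number of steps. In an acyclic circuit no path visits
  more than \<open>csize C\<close> gates, so with \<open>csize C\<close> steps the cut-off is never reached; the lemma
  \<open>gate_val_unfold\<close> below shows that \<open>gate_val\<close> obeys the gate equations.
\<close>

primrec gate_val_steps :: "circuit \<Rightarrow> real list \<Rightarrow> real list \<Rightarrow> nat \<Rightarrow> nat \<Rightarrow> real" where
  "gate_val_steps C xs as 0 = (\<lambda>g. 0)"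
| "gate_val_steps C xs as (Suc k) =
     (\<lambda>g. gate_op C xs as (kind_of C g) (map (gate_val_steps C xs as k) (preds C g)))"

definition gate_val :: "circuit \<Rightarrow> real list \<Rightarrow> real list \<Rightarrow> nat \<Rightarrow> real" where
  "gate_val C xs as = gate_val_steps C xs as (csize C)"

definition output_gate :: "circuit \<Rightarrow> nat \<Rightarrow> nat" where
  "output_gate C j = (THE g. g < csize C \<and> kind_of C g = Output j)"

definition outputs :: "circuit \<Rightarrow> real list \<Rightarrow> real list \<Rightarrow> real list" where
  "outputs C xs as = map (\<lambda>j. gate_val C xs as (output_gate C j)) [0..<n_out C]"

definition circuit_fun :: "circuit \<Rightarrow> real list \<Rightarrow> real list" where
  "circuit_fun C xs = outputs C xs []"

lemma preds_less:
  assumes "wf_circuit C" "g < csize C" "p \<in> set (preds C g)"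
  shows "p < csize C"
  using assms unfolding wf_circuit_def by blast

text \<open>More steps than there are ancestors suffice to evaluate a gate.\<close>

definition ancestors :: "circuit \<Rightarrow> nat \<Rightarrow> nat set" where
  "ancestors C g = {h. (h, g) \<in> (wires C)\<^sup>+}"

lemma ancestors_subset:
  assumes "wf_circuit C" "g < csize C"
  shows "ancestors C g \<subseteq> {..< csize C} - {g}"
proof
  fix h assume "h \<in> ancestors C g"
  then have hg: "(h, g) \<in> (wires C)\<^sup>+" by (simp add: ancestors_def)
  have "acyclic (wires C)" using assms(1) by (simp add: wf_circuit_def)
  then have "h \<noteq> g" using hg by (auto simp: acyclic_def)
  moreover have "h < csize C"
  proof -
    obtain z where "(h, z) \<in> wires C" using hg by (meson tranclD)
    then show ?thesis using preds_less[OF assms(1)] by (auto simp: wires_def)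
  qed
  ultimately show "h \<in> {..< csize C} - {g}" by simp
qed

lemma finite_ancestors:
  assumes "wf_circuit C" "g < csize C"
  shows "finite (ancestors C g)"
  using ancestors_subset[OF assms] by (rule finite_subset) simp

lemma card_ancestors_pred:
  assumes "wf_circuit C" "g < csize C" "p \<in> set (preds C g)"
  shows "card (ancestors C p) < card (ancestors C g)"
proof (rule psubset_card_mono)
  show "finite (ancestors C g)" using assms by (simp add: finite_ancestors)
  have pg: "(p, g) \<in> wires C" using assms by (simp add: wires_def)
  have p: "p < csize C" using preds_less[OF assms] .
  have "ancestors C p \<subseteq> ancestors C g"
    using pg by (auto simp: ancestors_def intro: trancl_into_trancl)
  moreover have "p \<in> ancestors C g" using pg by (auto simp: ancestors_def)
  moreover have "p \<notin> ancestors C p" using ancestors_subset[OF assms(1) p] by blast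
  ultimately show "ancestors C p \<subset> ancestors C g" by blast
qed

lemma gate_val_steps_stable:
  assumes "wf_circuit C"
  shows "g < csize C \<Longrightarrow> card (ancestors C g) < k \<Longrightarrow> card (ancestors C g) < l \<Longrightarrow>
    gate_val_steps C xs as k g = gate_val_steps C xs as l g"
proof (induction k arbitrary: g l)
  case (Suc k)
  then obtain l' where l: "l = Suc l'" by (cases l) auto
  have "gate_val_steps C xs as k p = gate_val_steps C xs as l' p" if "p \<in> set (preds C g)" for p
    using that Suc.IH[of p l'] Suc.prems l preds_less[OF assms Suc.prems(1) that]
      card_ancestors_pred[OF assms Suc.prems(1) that] by linarith
  then show ?case using l by (simp cong: map_cong)
qed simp

lemma gate_val_unfold:
  assumes "wf_circuit C" "g < csize C"
  shows "gate_val C xs as g = gate_op C xs as (kind_of C g) (map (gate_val C xs as) (preds C g))"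
proof -
  have less: "card (ancestors C h) < csize C" if "h < csize C" for h
  proof -
    have "card (ancestors C h) \<le> card ({..< csize C} - {h})"
      by (rule card_mono) (use ancestors_subset[OF assms(1) that] in auto)
    also have "\<dots> < csize C" using that by simp
    finally show ?thesis .
  qed
  have "gate_val C xs as g = gate_val_steps C xs as (Suc (csize C)) g"
    unfolding gate_val_def by (rule gate_val_steps_stable) (use assms less[of g] in auto)
  then show ?thesis by (simp add: gate_val_def)
qed


section \<open>Circuit function classes\<close>

text \<open>\<open>FAC i B\<close>: depth \<open>O((log n)\<^sup>i)\<close>, extra gates from \<open>B\<close>.\<close>

datatype circuit_class = FAC nat "(real \<Rightarrow> real) set"

fun add_gates :: "circuit_class \<Rightarrow> (real \<Rightarrow> real) set \<Rightarrow> circuit_class" where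
  "add_gates (FAC i B) A = FAC i (B \<union> A)"

definition sign :: "real \<Rightarrow> real" where
  "sign x = (if x > 0 then 1 else 0)"

abbreviation with_sign :: "circuit_class \<Rightarrow> circuit_class" where
  "with_sign F \<equiv> add_gates F {sign}"

fun ext_families :: "circuit_class \<Rightarrow> (nat \<Rightarrow> circuit) set" where
  "ext_families (FAC i B) = {C.
     (\<forall>n. wf_circuit (C n) \<and> n_in (C n) = n \<and> set (fun_tab (C n)) \<subseteq> B) \<and>
     (\<exists>k::nat. (\<lambda>n. real (csize (C n))) \<in> O(\<lambda>n. real n ^ k)) \<and>
     (\<lambda>n. real (depth (C n))) \<in> O(\<lambda>n. ln (real n) ^ i)}"

definition families :: "circuit_class \<Rightarrow> (nat \<Rightarrow> circuit) set" where
  "families F = {C \<in> ext_families F. \<forall>n. n_aux (C n) = 0}"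

definition computable :: "circuit_class \<Rightarrow> (real list \<Rightarrow> real list) set" where
  "computable F = {f. \<exists>C \<in> families F. \<forall>xs. f xs = circuit_fun (C (length xs)) xs}"

definition tail_symmetric :: "(real list \<Rightarrow> 'a) \<Rightarrow> bool" where
  "tail_symmetric f \<longleftrightarrow> (\<forall>x ys zs. mset ys = mset zs \<longrightarrow> f (x # ys) = f (x # zs))"

text \<open>The tail-symmetric functions of a class that have a single real value.\<close>

definition tail_functions :: "circuit_class \<Rightarrow> (real list \<Rightarrow> real) set" where
  "tail_functions F = {f. tail_symmetric f \<and> (\<lambda>xs. [f xs]) \<in> computable F}"


section \<open>Recurrent circuits\<close>

text \<open>
  \<open>rec_in ! i\<close> and \<open>rec_aux ! i\<close> are the sources of the recurrent edges into the \<open>i\<close>-th input gate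
  and the \<open>i\<close>-th auxiliary memory gate. The halting function is given by a circuit, whose first
  input is the number of the iteration.
\<close>

record rec_circuit =
  base :: circuit
  init :: "real list"
  rec_in :: "nat list"
  rec_aux :: "nat list"
  halt_gates :: "nat list"
  halt_circuit :: circuit

definition halt_fun :: "rec_circuit \<Rightarrow> nat \<Rightarrow> real list \<Rightarrow> real" where
  "halt_fun R i vs = hd (circuit_fun (halt_circuit R) (real i # vs))"

definition wf_rec :: "rec_circuit \<Rightarrow> bool" where
  "wf_rec R \<longleftrightarrow>
     wf_circuit (base R) \<and>
     length (init R) = n_aux (base R) \<and>
     length (rec_in R) = n_in (base R) \<and> set (rec_in R) \<subseteq> {..< csize (base R)} \<and>
     length (rec_aux R) = n_aux (base R) \<and> set (rec_aux R) \<subseteq> {..< csize (base R)} \<and>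
     distinct (halt_gates R) \<and> set (halt_gates R) \<subseteq> {..< csize (base R)} \<and>
     wf_circuit (halt_circuit R) \<and> n_in (halt_circuit R) = Suc (length (halt_gates R)) \<and>
     n_aux (halt_circuit R) = 0 \<and> n_out (halt_circuit R) = 1 \<and>
     (\<forall>i > 0. \<forall>vs. length vs = length (halt_gates R) \<longrightarrow> halt_fun R i vs \<in> {0, 1})"

text \<open>The contents of the input and auxiliary memory gates after \<open>t\<close> iterations.\<close>

primrec rec_state :: "rec_circuit \<Rightarrow> real list \<Rightarrow> nat \<Rightarrow> real list \<times> real list" where
  "rec_state R xs 0 = (xs, init R)"
| "rec_state R xs (Suc t) =
     (let v = case_prod (gate_val (base R)) (rec_state R xs t)
      in (map v (rec_in R), map v (rec_aux R)))"

definition halts_after :: "rec_circuit \<Rightarrow> real list \<Rightarrow> nat \<Rightarrow> bool" where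
  "halts_after R xs i \<longleftrightarrow> i > 0 \<and>
     halt_fun R i (map (case_prod (gate_val (base R)) (rec_state R xs (i - 1))) (halt_gates R)) = 1"

definition rec_fun :: "rec_circuit \<Rightarrow> real list \<Rightarrow> real list option" where
  "rec_fun R xs =
     (if \<exists>i. halts_after R xs i
      then Some (case_prod (outputs (base R)) (rec_state R xs ((LEAST i. halts_after R xs i) - 1)))
      else None)"

definition rec_families :: "circuit_class \<Rightarrow> circuit_class \<Rightarrow> (nat \<Rightarrow> rec_circuit) set" where
  "rec_families Fhalt Fc = {R.
     (\<forall>n. wf_rec (R n)) \<and> (\<lambda>n. base (R n)) \<in> ext_families Fc \<and>
     (\<exists>D \<in> families Fhalt. \<forall>n. halt_circuit (R n) = D (Suc (length (halt_gates (R n)))))}"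


section \<open>Labelled graphs and graph neural networks\<close>

text \<open>The vertices of a graph are \<open>0, \<dots>, length (labels G) - 1\<close>, in this order.\<close>

record 'l lgraph =
  labels :: "'l list"
  edges :: "nat set set"

definition n_vertices :: "'l lgraph \<Rightarrow> nat" where
  "n_vertices G = length (labels G)"

definition wf_lgraph :: "'l lgraph \<Rightarrow> bool" where
  "wf_lgraph G \<longleftrightarrow> (\<forall>e \<in> edges G. \<exists>u v. u < v \<and> v < n_vertices G \<and> e = {u, v})"

definition neighbours :: "'l lgraph \<Rightarrow> nat \<Rightarrow> nat list" where
  "neighbours G w = filter (\<lambda>u. {u, w} \<in> edges G) [0..<n_vertices G]"

text \<open>
  A layer is a pair of an aggregate-combine function and an activation function. Both the former
  and the halting function are tail-symmetric in \<open>gnns\<close> below, so passing the tail as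
  a list in vertex order amounts to passing the multiset of its values. \<open>layer N i\<close> is used in
  round \<open>i\<close>, the rounds being counted from 1.
\<close>

record gnn =
  layer :: "nat \<Rightarrow> (real list \<Rightarrow> real) \<times> (real \<Rightarrow> real)"
  gnn_halt :: "real list \<Rightarrow> real"

definition gnns ::
    "(real list \<Rightarrow> real) set \<Rightarrow> (real list \<Rightarrow> real) set \<Rightarrow> (real \<Rightarrow> real) set \<Rightarrow> gnn set" where
  "gnns Fhalt F' A' = {N.
     (\<exists>p > 0. \<forall>i. layer N (i + p) = layer N i) \<and>
     (\<forall>i. layer N i \<in> F' \<times> A') \<and>
     gnn_halt N \<in> Fhalt \<and>
     (\<forall>l :: nat. l > 0 \<longrightarrow> (\<forall>xs. gnn_halt N (real l # xs) \<in> {0, 1}))}"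

primrec features :: "gnn \<Rightarrow> real lgraph \<Rightarrow> nat \<Rightarrow> real list" where
  "features N G 0 = labels G"
| "features N G (Suc i) =
     (let h = features N G i; (f, \<sigma>) = layer N (Suc i)
      in map (\<lambda>w. \<sigma> (f (h ! w # map ((!) h) (neighbours G w)))) [0..<n_vertices G])"

definition gnn_halts_after :: "gnn \<Rightarrow> real lgraph \<Rightarrow> nat \<Rightarrow> bool" where
  "gnn_halts_after N G l \<longleftrightarrow> l > 0 \<and> gnn_halt N (real l # features N G l) = 1"

definition gnn_fun :: "gnn \<Rightarrow> real lgraph \<Rightarrow> real lgraph option" where
  "gnn_fun N G =
     (if \<exists>l. gnn_halts_after N G l
      then Some (G\<lparr>labels := features N G (LEAST l. gnn_halts_after N G l)\<rparr>)
      else None)"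


section \<open>Logspace transducers\<close>

text \<open>
  Deterministic Turing machines with a two-way read-only input tape between end markers, \<open>tapes\<close>
  many one-way infinite work tapes, and a write-only output tape. States are \<open>0, \<dots>, states - 1\<close>,
  with initial state 0 and halting state 1; work symbols are \<open>0, \<dots>, symbols - 1\<close>, with blank 0.
\<close>

datatype in_symbol = Left_End | Bit bool | Right_End

datatype move = Go_Left | Stay | Go_Right

record transducer =
  tapes :: nat
  symbols :: nat
  states :: nat
  trans :: "nat \<Rightarrow> in_symbol \<Rightarrow> nat list \<Rightarrow> nat \<times> move \<times> (nat \<times> move) list \<times> bool option"

definition wf_transducer :: "transducer \<Rightarrow> bool" where
  "wf_transducer M \<longleftrightarrow> states M \<ge> 2 \<and> symbols M \<ge> 1 \<and>
     (\<forall>q s ws. q < states M \<longrightarrow> length ws = tapes M \<longrightarrow> set ws \<subseteq> {..< symbols M} \<longrightarrow>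
        (case trans M q s ws of (q', m, as, b) \<Rightarrow>
           q' < states M \<and> length as = tapes M \<and> fst ` set as \<subseteq> {..< symbols M}))"

record config =
  state :: nat
  in_head :: nat
  work :: "((nat \<Rightarrow> nat) \<times> nat) list"
  written :: "bool list"

definition in_symbol_at :: "bool list \<Rightarrow> nat \<Rightarrow> in_symbol" where
  "in_symbol_at x i =
     (if i = 0 then Left_End else if i \<le> length x then Bit (x ! (i - 1)) else Right_End)"

fun move_head :: "move \<Rightarrow> nat \<Rightarrow> nat" where
  "move_head Go_Left i = i - 1"
| "move_head Stay i = i"
| "move_head Go_Right i = i + 1"

definition start :: "transducer \<Rightarrow> config" where
  "start M = \<lparr>state = 0, in_head = 0, work = replicate (tapes M) (\<lambda>_. 0, 0), written = []\<rparr>"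

definition step :: "transducer \<Rightarrow> bool list \<Rightarrow> config \<Rightarrow> config" where
  "step M x c =
     (if state c = 1 then c
      else case trans M (state c) (in_symbol_at x (in_head c)) (map (\<lambda>(t, h). t h) (work c)) of
        (q, m, as, b) \<Rightarrow>
          \<lparr>state = q,
           in_head = min (length x + 1) (move_head m (in_head c)),
           work = map2 (\<lambda>(t, h) (a, d). (t(h := a), move_head d h)) (work c) as,
           written = written c @ (case b of None \<Rightarrow> [] | Some y \<Rightarrow> [y])\<rparr>)"

definition run :: "transducer \<Rightarrow> bool list \<Rightarrow> nat \<Rightarrow> config" where
  "run M x t = (step M x ^^ t) (start M)"

text \<open>The head positions of a run bound the work space, since a cell has to be visited to be used.\<close>

definition logspace_computable :: "(bool list \<Rightarrow> bool list) \<Rightarrow> bool" where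
  "logspace_computable f \<longleftrightarrow> (\<exists>M. wf_transducer M \<and>
     (\<forall>x. \<exists>t. state (run M x t) = 1 \<and> written (run M x t) = f x) \<and>
     (\<exists>c. \<forall>x t. \<forall>(tp, h) \<in> set (work (run M x t)). real h \<le> c * log 2 (real (length x) + 2)))"


section \<open>Graph encodings of recurrent circuits\<close>

datatype slabel = In_sym nat | Aux_sym nat | Const_sym nat | Num nat

definition wf_sgraph :: "slabel lgraph \<Rightarrow> bool" where
  "wf_sgraph G \<longleftrightarrow> wf_lgraph G \<and> (\<forall>k. Num k \<in> set (labels G) \<longrightarrow> k \<le> n_vertices G)"

text \<open>
  Words are over the two-letter alphabet \<^typ>\<open>bool\<close>; a number \<open>k\<close> is written as the self-delimiting
  word \<open>1\<^sup>k0\<close>. The numbers that occur are indices and lengths, which are bounded by the size of the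
  encoded object, so this is polynomially related to writing them in base 2.
\<close>

definition enc_nat :: "nat \<Rightarrow> bool list" where
  "enc_nat k = replicate k True @ [False]"

definition enc_list :: "('a \<Rightarrow> bool list) \<Rightarrow> 'a list \<Rightarrow> bool list" where
  "enc_list e xs = enc_nat (length xs) @ concat (map e xs)"

fun enc_kind :: "kind \<Rightarrow> bool list" where
  "enc_kind (Input i) = enc_nat 0 @ enc_nat i"
| "enc_kind (Aux i) = enc_nat 1 @ enc_nat i"
| "enc_kind (Const i) = enc_nat 2 @ enc_nat i"
| "enc_kind Plus = enc_nat 3"
| "enc_kind Times = enc_nat 4"
| "enc_kind (Fun i) = enc_nat 5 @ enc_nat i"
| "enc_kind (Output i) = enc_nat 6 @ enc_nat i"

definition enc_gate :: "gate \<Rightarrow> bool list" where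
  "enc_gate g = enc_kind (fst g) @ enc_list enc_nat (snd g)"

definition enc_circuit :: "circuit \<Rightarrow> bool list" where
  "enc_circuit C = enc_nat (n_in C) @ enc_nat (n_aux C) @ enc_nat (n_out C) @
     enc_list enc_gate (gates C)"

definition enc_rec :: "rec_circuit \<Rightarrow> bool list" where
  "enc_rec R = enc_circuit (base R) @ enc_list enc_nat (rec_in R) @ enc_list enc_nat (rec_aux R) @
     enc_list enc_nat (halt_gates R) @ enc_circuit (halt_circuit R)"

fun enc_slabel :: "slabel \<Rightarrow> bool list" where
  "enc_slabel (In_sym i) = enc_nat 0 @ enc_nat i"
| "enc_slabel (Aux_sym i) = enc_nat 1 @ enc_nat i"
| "enc_slabel (Const_sym i) = enc_nat 2 @ enc_nat i"
| "enc_slabel (Num k) = enc_nat 3 @ enc_nat k"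

text \<open>The labels, followed by the lower triangle of the adjacency matrix.\<close>

definition enc_sgraph :: "slabel lgraph \<Rightarrow> bool list" where
  "enc_sgraph G = enc_list enc_slabel (labels G) @
     concat (map (\<lambda>v. map (\<lambda>u. {u, v} \<in> edges G) [0..<v]) [0..<n_vertices G])"

text \<open>
  The constants of a recurrent circuit are those of its underlying circuit, followed by those of
  its halting circuit.
\<close>

definition rec_consts :: "rec_circuit \<Rightarrow> real list" where
  "rec_consts R = const_tab (base R) @ const_tab (halt_circuit R)"

fun slabel_ok :: "rec_circuit \<Rightarrow> slabel \<Rightarrow> bool" where
  "slabel_ok R (In_sym i) = (i < n_in (base R))"
| "slabel_ok R (Aux_sym i) = (i < n_aux (base R))"
| "slabel_ok R (Const_sym i) = (i < length (rec_consts R))"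
| "slabel_ok R (Num k) = True"

fun slabel_val :: "rec_circuit \<Rightarrow> real list \<Rightarrow> slabel \<Rightarrow> real" where
  "slabel_val R xs (In_sym i) = xs ! i"
| "slabel_val R xs (Aux_sym i) = init R ! i"
| "slabel_val R xs (Const_sym i) = rec_consts R ! i"
| "slabel_val R xs (Num k) = real k"

text \<open>
  By \<open>inj_on_enc_sgraph\<close> below, the equation \<open>f (enc_rec R) = enc_sgraph (\<GG> R)\<close> says that
  \<open>f (enc_rec R)\<close> encodes a graph and that \<open>\<GG> R\<close> is the graph decoded from it.
\<close>

definition symbolic_logspace_encoding :: "(rec_circuit \<Rightarrow> slabel lgraph) \<Rightarrow> bool" where
  "symbolic_logspace_encoding \<GG> \<longleftrightarrow> (\<exists>f. logspace_computable f \<and>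
     (\<forall>R. wf_rec R \<longrightarrow>
        wf_sgraph (\<GG> R) \<and> (\<forall>l \<in> set (labels (\<GG> R)). slabel_ok R l) \<and>
        f (enc_rec R) = enc_sgraph (\<GG> R)))"

definition graph_encoding ::
    "(rec_circuit \<Rightarrow> slabel lgraph) \<Rightarrow> rec_circuit \<Rightarrow> real list \<Rightarrow> real lgraph" where
  "graph_encoding \<GG> R xs =
     \<lparr>labels = map (slabel_val R xs) (labels (\<GG> R)), edges = edges (\<GG> R)\<rparr>"

definition prefix_code :: "('a \<Rightarrow> bool list) \<Rightarrow> bool" where
  "prefix_code e \<longleftrightarrow> (\<forall>x y r s. e x @ r = e y @ s \<longrightarrow> x = y \<and> r = s)"

lemma prefix_codeD: "prefix_code e \<Longrightarrow> e x @ r = e y @ s \<longleftrightarrow> x = y \<and> r = s"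
  unfolding prefix_code_def by blast

lemma prefix_code_nat: "prefix_code enc_nat"
proof -
  have "x = y \<and> r = s" if "enc_nat x @ r = enc_nat y @ s" for x y r s
    using that
  proof (induction x arbitrary: y)
    case 0
    then show ?case by (cases y) (auto simp: enc_nat_def)
  next
    case (Suc x)
    then show ?case by (cases y) (auto simp: enc_nat_def)
  qed
  then show ?thesis unfolding prefix_code_def by blast
qed

lemmas enc_nat_eq = prefix_codeD[OF prefix_code_nat]

lemma enc_concat_eq:
  assumes "prefix_code e" "length xs = length ys" "concat (map e xs) @ r = concat (map e ys) @ s"
  shows "xs = ys \<and> r = s"
  using assms(2,3) by (induction xs ys rule: list_induct2) (simp_all add: prefix_codeD[OF assms(1)])

lemma prefix_code_list:
  assumes "prefix_code e" shows "prefix_code (enc_list e)"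
  unfolding prefix_code_def
proof (intro allI impI)
  fix xs ys r s assume "enc_list e xs @ r = enc_list e ys @ s"
  then have "length xs = length ys" "concat (map e xs) @ r = concat (map e ys) @ s"
    by (simp_all add: enc_list_def enc_nat_eq)
  then show "xs = ys \<and> r = s" by (rule enc_concat_eq[OF assms])
qed

lemma prefix_code_slabel: "prefix_code enc_slabel"
  unfolding prefix_code_def
proof (intro allI impI)
  fix x y r s assume "enc_slabel x @ r = enc_slabel y @ s"
  then show "x = y \<and> r = s" by (cases x; cases y) (simp_all add: enc_nat_eq)
qed

lemma prefix_code_gate: "prefix_code enc_gate"
  unfolding prefix_code_def
proof (intro allI impI)
  fix x y :: gate and r s assume *: "enc_gate x @ r = enc_gate y @ s"
  have "fst x = fst y \<and> enc_list enc_nat (snd x) @ r = enc_list enc_nat (snd y) @ s"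
    using * by (cases "fst x"; cases "fst y") (simp_all add: enc_gate_def enc_nat_eq)
  then show "x = y \<and> r = s"
    by (simp add: prefix_codeD[OF prefix_code_list[OF prefix_code_nat]] prod_eq_iff)
qed

text \<open>The encoding of a recurrent circuit determines everything except the real and function data.\<close>

lemma enc_rec_inject:
  assumes "enc_rec R = enc_rec R'"
  shows "gates (base R) = gates (base R') \<and> n_in (base R) = n_in (base R') \<and>
    n_aux (base R) = n_aux (base R') \<and> n_out (base R) = n_out (base R') \<and>
    rec_in R = rec_in R' \<and> rec_aux R = rec_aux R' \<and> halt_gates R = halt_gates R' \<and>
    gates (halt_circuit R) = gates (halt_circuit R')"
proof -
  have "enc_rec R @ [] = enc_rec R' @ []" using assms by simp
  then show ?thesis
    by (simp only: enc_rec_def enc_circuit_def append_assoc enc_nat_eq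
        prefix_codeD[OF prefix_code_list[OF prefix_code_nat]]
        prefix_codeD[OF prefix_code_list[OF prefix_code_gate]])
qed

lemma concat_map_eq_length:
  assumes "concat (map f xs) = concat (map g xs)" "\<And>x. length (f x) = length (g x)" "x \<in> set xs"
  shows "f x = g x"
  using assms(1,3) by (induction xs) (auto simp: assms(2) append_eq_append_conv)

lemma inj_on_enc_sgraph: "inj_on enc_sgraph {G. wf_sgraph G}"
proof (rule inj_onI)
  fix G H :: "slabel lgraph"
  assume "G \<in> {G. wf_sgraph G}" "H \<in> {G. wf_sgraph G}"
  then have wf: "wf_lgraph G" "wf_lgraph H" by (simp_all add: wf_sgraph_def)
  assume "enc_sgraph G = enc_sgraph H"
  then have lab: "labels G = labels H" and
    adj: "concat (map (\<lambda>v. map (\<lambda>u. {u, v} \<in> edges G) [0..<v]) [0..<n_vertices G]) =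
      concat (map (\<lambda>v. map (\<lambda>u. {u, v} \<in> edges H) [0..<v]) [0..<n_vertices G])"
    by (auto simp: enc_sgraph_def n_vertices_def
        prefix_codeD[OF prefix_code_list[OF prefix_code_slabel]])
  have "{u, v} \<in> edges G \<longleftrightarrow> {u, v} \<in> edges H" if "u < v" "v < n_vertices G" for u v
    using concat_map_eq_length[OF adj, of v] that by simp
  moreover have "n_vertices H = n_vertices G" using lab by (simp add: n_vertices_def)
  ultimately have "edges G = edges H"
    using wf unfolding wf_lgraph_def by (metis (no_types, lifting) subsetI subset_antisym)
  then show "G = H" using lab by simp
qed

end

(*
  Circuit families are nonuniform, so a single aggregation function may contain the circuits of the
  whole recurrent family. The graph of C_n therefore only has to carry the input and addresses:
  it has K = |<C_n>| slots, slot i being a data vertex labelled in_i (or n, if i >= n) together with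
  a pendant vertex labelled i; the data vertices form a clique.

  A vertex sees an unordered multiset, but indices become visible in the order of the values. If
  M > |s_j| for all j, the numbers s_j - (3j + 2) M are strictly decreasing in j, so ranking the
  values recovers j, and two slots known to hold the same value recover M and hence every s_j.
  Two rounds turn the initial labels into such a packed state: the first replaces the i-th data
  vertex by Q + i^2, where Q exceeds every datum in size, while its pendant vertex saves the datum;
  the second reads off i and M. From then on every data vertex knows the whole memory of the
  recurrent circuit and its own index, and each round performs one iteration of C_n. In the
  round in which C_n halts, the outputs are written out unpacked and all other data vertices are
  set to 1, so that the GNN halts as soon as more than a quarter of all values are equal to 1.

  The number n, which selects the circuits to be simulated, is itself a datum (the last slot).
*)

theory Submission
  imports Defs
begin

section \<open>Building circuits gate by gate\<close>

text \<open>One function serves as the layer for all \<open>n\<close>, all vertices and all rounds,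
  and its circuits are measured by the length of their own input. A data vertex sees
  \<open>K + 1\<close> values, and \<open>K\<close> bounds every size attached to
  \<open>C n\<close>, so embedding the circuits costs only a polynomial in the length of the view.
  As the circuits sit in the layer, the transducer never parses a gate: it needs only the length of
  its input and the leading block of ones, which is \<open>n\<close> in unary. Initial labels may
  coincide, so ranks cannot tell the pendant from the data. The first round therefore adds the
  squares of the whole view: the pendant label enters as \<open>i * i\<close> without being located,
  and the data become distinct. The spacing: if all \<open>s j\<close> are smaller than
  \<open>M\<close> in absolute value, two of them differ by less than \<open>2 * M\<close>, so steps
  of \<open>3 * M\<close> fix their order. The summand 2 in \<open>3 * j + 2\<close> puts slot 0
  below \<open>- M\<close>, and pendants are kept at or above \<open>- M\<close>; hence in every
  packed view the pendant ranks first and the data follow in slot order.\<close>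

lemma numbered_append_other:
  assumes "gates C' = gates C @ [(k, ps)]" "\<And>i. k \<noteq> K i"
  shows "numbered C' K n \<longleftrightarrow> numbered C K n"
proof -
  have "g < csize C' \<and> kind_of C' g = K i \<longleftrightarrow> g < csize C \<and> kind_of C g = K i" for g i
    using assms by (auto simp: csize_def kind_of_def nth_append less_Suc_eq)
  note eq = this
  have "numbered X K n \<longleftrightarrow> (\<forall>i < n. \<exists>!g. g < csize X \<and> kind_of X g = K i) \<and>
      (\<forall>i g. g < csize X \<and> kind_of X g = K i \<longrightarrow> i < n)" for X
    unfolding numbered_def by blast
  then show ?thesis by (simp only: eq)
qed

lemma numbered_append_same:
  assumes "gates C' = gates C @ [(K n, ps)]" "inj K" "numbered C K n"
  shows "numbered C' K (Suc n)"
proof -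
  have eq: "g < csize C' \<and> kind_of C' g = K i \<longleftrightarrow>
      (g < csize C \<and> kind_of C g = K i) \<or> (g = csize C \<and> i = n)" for g i
    using assms(1) injD[OF assms(2)]
    by (auto simp: csize_def kind_of_def nth_append less_Suc_eq)
  have "\<exists>!g. g < csize C' \<and> kind_of C' g = K i" if "i < Suc n" for i
  proof (cases "i = n")
    case True
    then have "\<not> (g < csize C \<and> kind_of C g = K i)" for g
      using assms(3) unfolding numbered_def by blast
    then show ?thesis unfolding eq using True by auto
  next
    case False
    then have "\<exists>!g. g < csize C \<and> kind_of C g = K i"
      using assms(3) that unfolding numbered_def by simp
    then show ?thesis unfolding eq using False by simp
  qed
  moreover have "i < Suc n" if "g < csize C'" "kind_of C' g = K i" for g i
    using that eq[of g i] assms(3) unfolding numbered_def by (metis less_Suc_eq)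
  ultimately show ?thesis unfolding numbered_def by blast
qed

lemma acyclic_topo:
  assumes "\<forall>g < csize C. \<forall>p \<in> set (preds C g). (p::nat) < g"
  shows "acyclic (wires C)"
proof -
  have "wires C \<subseteq> less_than" using assms by (auto simp: wires_def)
  then show ?thesis
    by (metis acyclic_subset wf_acyclic wf_less_than)
qed

text \<open>The gate list is topologically sorted, which makes acyclicity immediate, and
  \<open>lev\<close> grows strictly along wires: it certifies depth at most \<open>D\<close> without
  looking at paths.\<close>

definition levelled ::
    "(real \<Rightarrow> real) set \<Rightarrow> nat \<Rightarrow> nat \<Rightarrow> nat \<Rightarrow> circuit \<Rightarrow> (nat \<Rightarrow> nat) \<Rightarrow> bool" where
  "levelled B m D r C lev \<longleftrightarrow> wf_circuit C \<and> n_in C = m \<and> n_aux C = 0 \<and> n_out C = r \<and>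
     set (fun_tab C) \<subseteq> B \<and>
     (\<forall>g < csize C. lev g \<le> D \<and> (\<forall>p \<in> set (preds C g). p < g \<and> lev p < lev g))"

text \<open>No old gate refers to the new one and both tables grow only at their ends, so every
  index in an old gate keeps its meaning and every old value survives.\<close>

lemma levelled_append:
  assumes C: "levelled B m D r C lev"
    and C': "gates C' = gates C @ [(k, ps)]" "n_in C' = m" "n_aux C' = 0"
      "const_tab C' = const_tab C @ cs" "fun_tab C' = fun_tab C @ fs"
    and k: "k \<in> {Plus, Times} \<and> cs = [] \<and> fs = [] \<and> n_out C' = r \<or>
      k = Const (length (const_tab C)) \<and> length cs = 1 \<and> fs = [] \<and> n_out C' = r \<or>
      k = Fun (length (fun_tab C)) \<and> cs = [] \<and> length fs = 1 \<and> set fs \<subseteq> B \<and> n_out C' = r \<or>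
      k = Output r \<and> cs = [] \<and> fs = [] \<and> n_out C' = Suc r"
    and ps: "fan_in_ok k (length ps)" "distinct ps" "\<forall>p \<in> set ps. p < csize C \<and> lev p < l" "l \<le> D"
  shows "levelled B m D (n_out C') C' (lev(csize C := l))"
    "csize C' = Suc (csize C)"
    "g < csize C \<Longrightarrow> gate_val C' xs as g = gate_val C xs as g"
    "gate_val C' xs as (csize C) = gate_op C' xs as k (map (gate_val C xs as) ps)"
proof -
  show sz: "csize C' = Suc (csize C)" using C' by (simp add: csize_def)
  have wf: "wf_circuit C" and nC: "n_in C = m" "n_aux C = 0" "n_out C = r" "set (fun_tab C) \<subseteq> B"
    and lev: "\<forall>g < csize C. lev g \<le> D \<and> (\<forall>p \<in> set (preds C g). p < g \<and> lev p < lev g)"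
    using C by (auto simp: levelled_def)
  have old: "kind_of C' g = kind_of C g" "preds C' g = preds C g" if "g < csize C" for g
    using that C' by (auto simp: kind_of_def preds_def csize_def nth_append)
  have new: "kind_of C' (csize C) = k" "preds C' (csize C) = ps"
    using C' by (auto simp: kind_of_def preds_def csize_def nth_append)
  have lt: "\<forall>g < csize C'. \<forall>p \<in> set (preds C' g). p < g"
    using lev ps new old sz by (auto simp: less_Suc_eq)
  have num: "numbered C' Input m" "numbered C' Aux 0" "numbered C' Output (n_out C')"
    "numbered C' Const (length (const_tab C'))"
  proof -
    have n0: "numbered C Input m" "numbered C Aux 0" "numbered C Output r"
      "numbered C Const (length (const_tab C))"
      using wf nC by (auto simp: wf_circuit_def)
    note other = numbered_append_other[OF C'(1)]
    show "numbered C' Input m" "numbered C' Aux 0"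
      using n0 k by (subst other; auto)+
    show "numbered C' Output (n_out C')"
    proof (cases "k = Output r")
      case True
      then show ?thesis using k n0 numbered_append_same[of C' C Output r ps] C'(1)
        by (auto simp: inj_def)
    next
      case False
      then show ?thesis using k n0 by (subst other) auto
    qed
    show "numbered C' Const (length (const_tab C'))"
    proof (cases "k = Const (length (const_tab C))")
      case True
      then have "length cs = 1" using k by auto
      then show ?thesis
        using True k n0 numbered_append_same[of C' C Const "length (const_tab C)" ps] C'(1,4)
        by (auto simp: inj_def)
    next
      case False
      then have "cs = []" using k by auto
      with False show ?thesis using k n0 C'(4) by (subst other) auto
    qed
  qed
  have ok: "fan_in_ok (kind_of C' g) (length (preds C' g)) \<and>
      distinct (preds C' g) \<and> set (preds C' g) \<subseteq> {..< csize C'}" if "g < csize C'" for g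
  proof (cases "g = csize C")
    case True
    then show ?thesis using new ps sz by (auto simp: less_Suc_eq)
  next
    case False
    then have "g < csize C" using that sz by simp
    then show ?thesis using wf old[of g] sz
      unfolding wf_circuit_def by (metis lessThan_subset_iff order_trans le_SucI order_refl)
  qed
  have fun_ok: "i < length (fun_tab C')" if "g < csize C'" "kind_of C' g = Fun i" for g i
  proof (cases "g = csize C")
    case True
    then show ?thesis using that new k C'(5) by auto
  next
    case False
    then have "g < csize C" using that sz by simp
    then show ?thesis using that old wf C'(5) by (fastforce simp: wf_circuit_def)
  qed
  have wf': "wf_circuit C'"
    unfolding wf_circuit_def using num ok fun_ok acyclic_topo[OF lt] C'(2,3) by auto
  show "levelled B m D (n_out C') C' (lev(csize C := l))"
    unfolding levelled_def
  proof (intro conjI allI impI)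
    show "set (fun_tab C') \<subseteq> B" using nC C'(5) k by auto
  next
    fix g assume g: "g < csize C'"
    show "(lev(csize C := l)) g \<le> D" using g lev ps sz by (auto simp: less_Suc_eq)
    show "\<forall>p \<in> set (preds C' g). p < g \<and> (lev(csize C := l)) p < (lev(csize C := l)) g"
    proof (cases "g = csize C")
      case True
      then show ?thesis using ps new by auto
    next
      case False
      then have "g < csize C" using g sz by simp
      moreover from this have "p \<noteq> csize C" if "p \<in> set (preds C g)" for p
        using lev that by fastforce
      ultimately show ?thesis using old lev by auto
    qed
  qed (use wf' C' in auto)
  have op: "gate_op C' xs as (kind_of C g) vs = gate_op C xs as (kind_of C g) vs"
    if "g < csize C" for g vs
  proof (cases "kind_of C g")
    case (Const i)
    then have "i < length (const_tab C)"
      using wf that unfolding wf_circuit_def numbered_def by blast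
    then show ?thesis using Const C'(4) by (simp add: nth_append)
  next
    case (Fun i)
    then have "i < length (fun_tab C)" using wf that unfolding wf_circuit_def by blast
    then show ?thesis using Fun C'(5) by (simp add: nth_append)
  qed auto
  have val: "gate_val C' xs as g = gate_val C xs as g" if "g < csize C" for g
    using that
  proof (induction g rule: less_induct)
    case (less g)
    have "map (gate_val C' xs as) (preds C g) = map (gate_val C xs as) (preds C g)"
      using less.IH lev less.prems by (auto intro: less_trans)
    then show ?case
      using less.prems old op sz
      by (simp add: gate_val_unfold[OF wf] gate_val_unfold[OF wf'] cong: map_cong)
  qed
  show "g < csize C \<Longrightarrow> gate_val C' xs as g = gate_val C xs as g" by (rule val)
  have "map (gate_val C' xs as) ps = map (gate_val C xs as) ps" using val ps by auto
  then show "gate_val C' xs as (csize C) = gate_op C' xs as k (map (gate_val C xs as) ps)"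
    using gate_val_unfold[OF wf', of "csize C"] new sz by (simp cong: map_cong)
qed

text \<open>The circuit and its gate numbers are hidden behind existentials, so later constructions
  handle only functions with level bounds. There are no output gates yet; one is added when a single
  function has been singled out.\<close>

definition pool ::
    "(real \<Rightarrow> real) set \<Rightarrow> nat \<Rightarrow> nat \<Rightarrow> nat \<Rightarrow> ((real list \<Rightarrow> real) \<times> nat) set \<Rightarrow> bool" where
  "pool B m D s W \<longleftrightarrow> (\<exists>C lev. levelled B m D 0 C lev \<and> csize C \<le> s \<and>
     (\<forall>(w, l) \<in> W. \<exists>g < csize C. lev g \<le> l \<and> (\<forall>xs. length xs = m \<longrightarrow> gate_val C xs [] g = w xs)))"

lemma pool_mono:
  assumes "pool B m D s W" "s \<le> s'" "\<And>w l. (w, l) \<in> W' \<Longrightarrow>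
     \<exists>w' l'. (w', l') \<in> W \<and> l' \<le> l \<and> (\<forall>xs. length xs = m \<longrightarrow> w' xs = w xs)"
  shows "pool B m D s' W'"
proof -
  obtain C lev where C: "levelled B m D 0 C lev" "csize C \<le> s" and
    W: "\<And>w l. (w, l) \<in> W \<Longrightarrow> \<exists>g < csize C. lev g \<le> l \<and>
      (\<forall>xs. length xs = m \<longrightarrow> gate_val C xs [] g = w xs)"
    using assms(1) unfolding pool_def by fast
  have "\<exists>g < csize C. lev g \<le> l \<and> (\<forall>xs. length xs = m \<longrightarrow> gate_val C xs [] g = w xs)"
    if wl: "(w, l) \<in> W'" for w l
  proof -
    obtain w' l' where w: "(w', l') \<in> W" "l' \<le> l" "\<forall>xs. length xs = m \<longrightarrow> w' xs = w xs"
      using assms(3)[OF wl] by blast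
    obtain g where "g < csize C" "lev g \<le> l'" "\<forall>xs. length xs = m \<longrightarrow> gate_val C xs [] g = w' xs"
      using W w(1) by blast
    then show ?thesis using w by (intro exI[of _ g]) auto
  qed
  then show ?thesis unfolding pool_def using C assms(2)
    by (intro exI[of _ C] exI[of _ lev]) auto
qed

lemma pool_inputs: "pool B m D m ((\<lambda>i. (\<lambda>xs. xs ! i, 0)) ` {..<m})"
proof -
  define C where "C = \<lparr>n_in = m, n_aux = 0, n_out = 0, const_tab = [], fun_tab = [],
    gates = map (\<lambda>i. (Input i, [])) [0..<m]\<rparr>"
  have sz: "csize C = m" by (simp add: C_def csize_def)
  have k: "kind_of C g = Input g" "preds C g = []" if "g < m" for g
    using that by (simp_all add: C_def kind_of_def preds_def)
  have wi: "wires C = {}" using k sz by (auto simp: wires_def)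
  have wf: "wf_circuit C"
    unfolding wf_circuit_def
  proof (intro conjI)
    show "acyclic (wires C)" by (simp add: wi acyclic_def)
    show "numbered C Input (n_in C)" "numbered C Aux (n_aux C)" "numbered C Output (n_out C)"
      "numbered C Const (length (const_tab C))"
      using k sz by (auto simp: numbered_def C_def)
  qed (use k sz in auto)
  have "gate_val C xs [] g = xs ! g" if "g < m" for xs g
    using gate_val_unfold[OF wf, of g] that k sz by simp
  moreover have "levelled B m D 0 C (\<lambda>_. 0)"
    unfolding levelled_def using wf k sz by (simp add: C_def)
  ultimately have "levelled B m D 0 C (\<lambda>_. 0) \<and> csize C \<le> m \<and>
      (\<forall>i < m. i < csize C \<and> (\<forall>xs. length xs = m \<longrightarrow> gate_val C xs [] i = xs ! i))"
    using sz by simp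
  then show ?thesis unfolding pool_def by (intro exI[of _ C] exI[of _ "\<lambda>_. 0"]) fastforce
qed

lemma pool_append:
  assumes "levelled B m D 0 C lev" "csize C \<le> s"
    "\<forall>(w, l) \<in> W. \<exists>g < csize C. lev g \<le> l \<and> (\<forall>xs. length xs = m \<longrightarrow> gate_val C xs [] g = w xs)"
    "levelled B m D 0 C' (lev(csize C := l0))" "csize C' = Suc (csize C)"
    "\<And>xs g. g < csize C \<Longrightarrow> gate_val C' xs [] g = gate_val C xs [] g"
    "\<And>xs. length xs = m \<Longrightarrow> gate_val C' xs [] (csize C) = w0 xs"
  shows "pool B m D (Suc s) (insert (w0, l0) W)"
  unfolding pool_def
proof (intro exI conjI)
  show "levelled B m D 0 C' (lev(csize C := l0))" by fact
  show "csize C' \<le> Suc s" using assms by simp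
  show "\<forall>(w, l) \<in> insert (w0, l0) W. \<exists>g < csize C'. (lev(csize C := l0)) g \<le> l \<and>
      (\<forall>xs. length xs = m \<longrightarrow> gate_val C' xs [] g = w xs)"
  proof (clarsimp simp del: fun_upd_apply, intro conjI ballI)
    show "\<exists>g < csize C'. (lev(csize C := l0)) g \<le> l0 \<and>
        (\<forall>xs. length xs = m \<longrightarrow> gate_val C' xs [] g = w0 xs)"
      using assms(5,7) by (intro exI[of _ "csize C"]) auto
  next
    fix e assume "e \<in> W"
    then obtain w l where e: "e = (w, l)" "(w, l) \<in> W" by (cases e) auto
    obtain g where "g < csize C" "lev g \<le> l" "\<forall>xs. length xs = m \<longrightarrow> gate_val C xs [] g = w xs"
      using assms(3) e(2) by fast
    then show "case e of (w, l) \<Rightarrow> \<exists>g < csize C'. (lev(csize C := l0)) g \<le> l \<and>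
        (\<forall>xs. length xs = m \<longrightarrow> gate_val C' xs [] g = w xs)"
      using assms(5,6) e(1) by (auto intro!: exI[of _ g])
  qed
qed

lemma pool_const:
  assumes "pool B m D s W"
  shows "pool B m D (Suc s) (insert (\<lambda>_. c, 0) W)"
proof -
  obtain C lev where C: "levelled B m D 0 C lev" "csize C \<le> s"
    "\<forall>(w, l) \<in> W. \<exists>g < csize C. lev g \<le> l \<and> (\<forall>xs. length xs = m \<longrightarrow> gate_val C xs [] g = w xs)"
    using assms unfolding pool_def by auto
  define C' where "C' = C\<lparr>gates := gates C @ [(Const (length (const_tab C)), [])],
    const_tab := const_tab C @ [c]\<rparr>"
  have C': "gates C' = gates C @ [(Const (length (const_tab C)), [])]" "n_in C' = m" "n_aux C' = 0"
    "const_tab C' = const_tab C @ [c]" "fun_tab C' = fun_tab C @ []" "n_out C' = 0"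
    using C(1) by (auto simp: C'_def levelled_def)
  note a = levelled_append[OF C(1) C'(1-5), of 0, simplified]
  show ?thesis
    by (rule pool_append[OF C, of C' 0]) (use a C' in \<open>auto simp: nth_append\<close>)
qed

lemma pool_fun:
  assumes "pool B m D s W" "(w, l) \<in> W" "f \<in> B" "l < D"
  shows "pool B m D (Suc s) (insert (\<lambda>xs. f (w xs), Suc l) W)"
proof -
  obtain C lev where C: "levelled B m D 0 C lev" "csize C \<le> s"
    "\<forall>(w, l) \<in> W. \<exists>g < csize C. lev g \<le> l \<and> (\<forall>xs. length xs = m \<longrightarrow> gate_val C xs [] g = w xs)"
    using assms unfolding pool_def by auto
  obtain g where g: "g < csize C" "lev g \<le> l" "\<forall>xs. length xs = m \<longrightarrow> gate_val C xs [] g = w xs"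
    using C(3) assms(2) by fast
  define C' where "C' = C\<lparr>gates := gates C @ [(Fun (length (fun_tab C)), [g])],
    fun_tab := fun_tab C @ [f]\<rparr>"
  have C': "gates C' = gates C @ [(Fun (length (fun_tab C)), [g])]" "n_in C' = m" "n_aux C' = 0"
    "const_tab C' = const_tab C @ []" "fun_tab C' = fun_tab C @ [f]" "n_out C' = 0"
    using C(1) by (auto simp: C'_def levelled_def)
  note a = levelled_append[OF C(1) C'(1-5), of "Suc l", simplified]
  show ?thesis
    by (rule pool_append[OF C, of C' "Suc l"]) (use a C' g assms in \<open>auto simp: nth_append\<close>)
qed

text \<open>The list of predecessors of a gate has to be distinct, but different functions in a pool may
  share a gate; so the arguments of a gate are copied first.\<close>

lemma pool_op:
  assumes "pool B m D s W" "ws \<noteq> []" "\<forall>w \<in> set ws. (w, l) \<in> W" "l + 2 \<le> D"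
    "op = Plus \<and> F = sum_list \<or> op = Times \<and> F = prod_list"
  shows "pool B m D (s + length ws + 1) (insert (\<lambda>xs. F (map (\<lambda>w. w xs) ws), l + 2) W)"
proof -
  obtain C lev where C: "levelled B m D 0 C lev" "csize C \<le> s"
    "\<forall>(w, l) \<in> W. \<exists>g < csize C. lev g \<le> l \<and> (\<forall>xs. length xs = m \<longrightarrow> gate_val C xs [] g = w xs)"
    using assms(1) unfolding pool_def by auto
  have copies: "\<exists>C1 lev1 ps. levelled B m D 0 C1 lev1 \<and> csize C1 \<le> s + k \<and>
     (\<forall>(w, l) \<in> W. \<exists>g < csize C1. lev1 g \<le> l \<and> (\<forall>xs. length xs = m \<longrightarrow> gate_val C1 xs [] g = w xs)) \<and>
     distinct ps \<and> length ps = k \<and> (\<forall>p \<in> set ps. p < csize C1 \<and> lev1 p \<le> l + 1) \<and>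
     (\<forall>xs. length xs = m \<longrightarrow> map (gate_val C1 xs []) ps = map (\<lambda>w. w xs) (take k ws))"
    if "k \<le> length ws" for k
    using that
  proof (induction k)
    case 0
    show ?case
      by (rule exI[of _ C], rule exI[of _ lev], rule exI[of _ "[]"]) (use C in simp)
  next
    case (Suc k)
    obtain C1 lev1 ps where C1: "levelled B m D 0 C1 lev1" "csize C1 \<le> s + k"
      "\<forall>(w, l) \<in> W. \<exists>g < csize C1. lev1 g \<le> l \<and> (\<forall>xs. length xs = m \<longrightarrow> gate_val C1 xs [] g = w xs)"
      and ps: "distinct ps" "length ps = k" "\<forall>p \<in> set ps. p < csize C1 \<and> lev1 p \<le> l + 1"
      "\<forall>xs. length xs = m \<longrightarrow> map (gate_val C1 xs []) ps = map (\<lambda>w. w xs) (take k ws)"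
      using Suc.IH[OF Suc_leD[OF Suc.prems]] by blast
    have "(ws ! k, l) \<in> W" using assms(3) Suc.prems by simp
    then obtain g where g: "g < csize C1" "lev1 g \<le> l"
        "\<forall>xs. length xs = m \<longrightarrow> gate_val C1 xs [] g = (ws ! k) xs"
      using C1(3) by fast
    \<comment> \<open>\<open>Plus\<close> with a single predecessor copies a value. The copy is a
      new gate and so differs from all earlier copies, even if the sources coincide; it costs one
      level, and the operation itself another.\<close>
    define C' where "C' = C1\<lparr>gates := gates C1 @ [(Plus, [g])]\<rparr>"
    have C': "gates C' = gates C1 @ [(Plus, [g])]" "n_in C' = m" "n_aux C' = 0"
      "const_tab C' = const_tab C1 @ []" "fun_tab C' = fun_tab C1 @ []" "n_out C' = 0"
      using C1(1) by (auto simp: C'_def levelled_def)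
    note a = levelled_append[OF C1(1) C'(1-5), of "l + 1", simplified]
    have l': "levelled B m D 0 C' (lev1(csize C1 := l + 1))" and sz: "csize C' = Suc (csize C1)"
      and v: "\<And>xs g. g < csize C1 \<Longrightarrow> gate_val C' xs [] g = gate_val C1 xs [] g"
      and n: "\<And>xs. length xs = m \<Longrightarrow> gate_val C' xs [] (csize C1) = (ws ! k) xs"
      using a C' g assms(4) by auto
    have W: "\<forall>(w, l') \<in> W. \<exists>g < csize C'. (lev1(csize C1 := l + 1)) g \<le> l' \<and>
        (\<forall>xs. length xs = m \<longrightarrow> gate_val C' xs [] g = w xs)"
    proof clarify
      fix w l' assume "(w, l') \<in> W"
      then obtain h where "h < csize C1" "lev1 h \<le> l'"
          "\<forall>xs. length xs = m \<longrightarrow> gate_val C1 xs [] h = w xs"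
        using C1(3) by fast
      then show "\<exists>g < csize C'. (lev1(csize C1 := l + 1)) g \<le> l' \<and>
          (\<forall>xs. length xs = m \<longrightarrow> gate_val C' xs [] g = w xs)"
        using v sz by (intro exI[of _ h]) auto
    qed
    have nin: "csize C1 \<notin> set ps" using ps by auto
    have val: "map (gate_val C' xs []) (ps @ [csize C1]) = map (\<lambda>w. w xs) (take (Suc k) ws)"
      if "length xs = m" for xs
    proof -
      have "map (gate_val C' xs []) ps = map (gate_val C1 xs []) ps" using v ps(3) by auto
      then show ?thesis using ps(4) that n[OF that] Suc.prems by (simp add: take_Suc_conv_app_nth)
    qed
    show ?case
    proof (rule exI[of _ C'], rule exI[of _ "lev1(csize C1 := l + 1)"],
        rule exI[of _ "ps @ [csize C1]"], intro conjI)
      show "\<forall>p \<in> set (ps @ [csize C1]). p < csize C' \<and> (lev1(csize C1 := l + 1)) p \<le> l + 1"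
        using ps(3) sz by auto
      show "\<forall>xs. length xs = m \<longrightarrow>
          map (gate_val C' xs []) (ps @ [csize C1]) = map (\<lambda>w. w xs) (take (Suc k) ws)"
        using val by blast
      show "levelled B m D 0 C' (lev1(csize C1 := l + 1))" by (rule l')
    qed (use sz W ps C1(2) nin in auto)
  qed
  then obtain C1 lev1 ps where C1: "levelled B m D 0 C1 lev1" "csize C1 \<le> s + length ws"
      "\<forall>(w, l) \<in> W. \<exists>g < csize C1. lev1 g \<le> l \<and> (\<forall>xs. length xs = m \<longrightarrow> gate_val C1 xs [] g = w xs)"
    and ps: "distinct ps" "length ps = length ws" "\<forall>p \<in> set ps. p < csize C1 \<and> lev1 p \<le> l + 1"
      "\<forall>xs. length xs = m \<longrightarrow> map (gate_val C1 xs []) ps = map (\<lambda>w. w xs) ws"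
    using copies[OF order_refl] unfolding take_all[OF order_refl] by blast
  define C' where "C' = C1\<lparr>gates := gates C1 @ [(op, ps)]\<rparr>"
  have C': "gates C' = gates C1 @ [(op, ps)]" "n_in C' = m" "n_aux C' = 0"
    "const_tab C' = const_tab C1 @ []" "fun_tab C' = fun_tab C1 @ []" "n_out C' = 0"
    using C1(1) by (auto simp: C'_def levelled_def)
  have opk: "op \<in> {Plus, Times} \<and> ([]::real list) = [] \<and> ([]::(real \<Rightarrow> real) list) = [] \<and> n_out C' = 0"
    using assms(5) C' by auto
  have ok: "fan_in_ok op (length ps)" "\<forall>p \<in> set ps. p < csize C1 \<and> lev1 p < l + 2"
    using assms ps by auto
  note a = levelled_append[OF C1(1) C'(1-5) disjI1[OF opk] ok(1) ps(1) ok(2) assms(4)]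
  have "gate_val C' xs [] (csize C1) = F (map (\<lambda>w. w xs) ws)" if "length xs = m" for xs
    using a(4)[of xs "[]"] ps(4) that assms(5) by auto
  then have "pool B m D (Suc (s + length ws)) (insert (\<lambda>xs. F (map (\<lambda>w. w xs) ws), l + 2) W)"
    using a(1) C'(6) by (intro pool_append[OF C1, of C' "l + 2"] a(2,3)) simp_all
  then show ?thesis by simp
qed

lemma index_less:
  assumes "wf_circuit C" "g < csize C"
  shows "kind_of C g = Input i \<Longrightarrow> i < n_in C" "kind_of C g = Aux i \<Longrightarrow> i < n_aux C"
    "kind_of C g = Fun i \<Longrightarrow> i < length (fun_tab C)"
  using assms by (auto simp: wf_circuit_def numbered_def)

lemma pool_replace:
  assumes "pool B m D s V" "(w', l') \<in> V" "\<And>xs. w' xs = w xs" "l' \<le> l" "s \<le> s'" "V' \<subseteq> V"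
  shows "pool B m D s' (insert (w, l) V')"
proof (rule pool_mono[OF assms(1,5)])
  fix v k assume "(v, k) \<in> insert (w, l) V'"
  then show "\<exists>w' l'. (w', l') \<in> V \<and> l' \<le> k \<and> (\<forall>xs. length xs = m \<longrightarrow> w' xs = v xs)"
    using assms(2-4,6) by blast
qed

lemma pool_subset:
  assumes "pool B m D s W" "s \<le> s'" "W' \<subseteq> W"
  shows "pool B m D s' W'"
  by (rule pool_mono[OF assms(1,2)]) (use assms(3) in blast)

text \<open>A wire is a recipe for appending gates to an arbitrary circuit; in this form several functions
  are put side by side without merging circuits.\<close>

definition wire ::
    "(real \<Rightarrow> real) set \<Rightarrow> nat \<Rightarrow> nat \<Rightarrow> nat \<Rightarrow> (real list \<Rightarrow> real) \<Rightarrow> bool" where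
  "wire B m s d w \<longleftrightarrow> (\<forall>D s0 W. d \<le> D \<longrightarrow> (\<lambda>i. (\<lambda>xs. xs ! i, 0)) ` {..<m} \<subseteq> W \<longrightarrow>
     pool B m D s0 W \<longrightarrow> pool B m D (s0 + s) (insert (w, d) W))"

lemma wireI:
  assumes "\<And>D s0 W. d \<le> D \<Longrightarrow> (\<lambda>i. (\<lambda>xs. xs ! i, 0)) ` {..<m} \<subseteq> W \<Longrightarrow>
     pool B m D s0 W \<Longrightarrow> pool B m D (s0 + s) (insert (w, d) W)"
  shows "wire B m s d w"
  using assms by (simp add: wire_def)

lemma wireD:
  assumes "wire B m s d w" "pool B m D s0 W" "d \<le> D"
    "(\<lambda>i. (\<lambda>xs. xs ! i, 0)) ` {..<m} \<subseteq> W"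
  shows "pool B m D (s0 + s) (insert (w, d) W)"
  using assms by (simp add: wire_def)

lemma wire_mono:
  assumes "wire B m s d w" "s \<le> s'" "d \<le> d'" "\<And>xs. length xs = m \<Longrightarrow> w xs = w' xs"
  shows "wire B m s' d' w'"
proof (rule wireI)
  fix D s0 W assume "d' \<le> D" "(\<lambda>i. (\<lambda>xs. xs ! i, 0)) ` {..<m} \<subseteq> W" "pool B m D s0 W"
  then have "pool B m D (s0 + s) (insert (w, d) W)" using wireD[OF assms(1)] assms(3) by auto
  then show "pool B m D (s0 + s') (insert (w', d') W)"
    by (rule pool_mono) (use assms(2-4) in auto)
qed

lemma wire_input: "i < m \<Longrightarrow> wire B m 0 0 (\<lambda>xs. xs ! i)"
proof (rule wireI)
  fix D s0 and W :: "((real list \<Rightarrow> real) \<times> nat) set"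
  assume i: "i < m" and W: "(\<lambda>i. (\<lambda>xs. xs ! i, 0)) ` {..<m} \<subseteq> W" "pool B m D s0 W"
  have "(\<lambda>xs. xs ! i, 0) \<in> W" using i by (intro subsetD[OF W(1)] image_eqI[of _ _ i]) auto
  then show "pool B m D (s0 + 0) (insert (\<lambda>xs. xs ! i, 0) W)" using W(2)
    by (simp add: insert_absorb)
qed

lemma wire_const: "wire B m 1 0 (\<lambda>_. c)"
  by (rule wireI) (simp add: pool_const)

lemma wires_pool:
  assumes "pool B m D s0 W" "d \<le> D" "(\<lambda>i. (\<lambda>xs. xs ! i, 0)) ` {..<m} \<subseteq> W"
    and "\<And>i. i < k \<Longrightarrow> wire B m s d (w i)"
  shows "pool B m D (s0 + k * s) ((\<lambda>i. (w i, d)) ` {..<k} \<union> W)"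
  using assms(4)
proof (induction k)
  case 0
  then show ?case using assms(1) by simp
next
  case (Suc k)
  have "pool B m D ((s0 + k * s) + s) (insert (w k, d) ((\<lambda>i. (w i, d)) ` {..<k} \<union> W))"
    by (rule wireD) (use Suc assms(2,3) in auto)
  then show ?case by (simp add: lessThan_Suc algebra_simps)
qed

lemma wire_op:
  assumes "\<And>i. i < k \<Longrightarrow> wire B m s d (w i)" "k > 0"
    "op = Plus \<and> F = sum_list \<or> op = Times \<and> F = prod_list"
  shows "wire B m (k * s + k + 1) (d + 2) (\<lambda>xs. F (map (\<lambda>i. w i xs) [0..<k]))"
proof (rule wireI)
  fix D s0 W assume D: "d + 2 \<le> D" and W: "(\<lambda>i. (\<lambda>xs. xs ! i, 0)) ` {..<m} \<subseteq> W" and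
    p: "pool B m D s0 W"
  have "pool B m D (s0 + k * s) ((\<lambda>i. (w i, d)) ` {..<k} \<union> W)"
    using wires_pool[OF p _ W assms(1)] D by simp
  then have "pool B m D (s0 + k * s + length (map w [0..<k]) + 1)
     (insert (\<lambda>xs. F (map (\<lambda>w. w xs) (map w [0..<k])), d + 2) ((\<lambda>i. (w i, d)) ` {..<k} \<union> W))"
    by (rule pool_op) (use assms D in auto)
  then have "pool B m D (s0 + k * s + k + 1)
     (insert (\<lambda>xs. F (map (\<lambda>i. w i xs) [0..<k]), d + 2) ((\<lambda>i. (w i, d)) ` {..<k} \<union> W))"
    by (simp add: comp_def)
  then show "pool B m D (s0 + (k * s + k + 1))
     (insert (\<lambda>xs. F (map (\<lambda>i. w i xs) [0..<k]), d + 2) W)"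
    by (rule pool_subset) auto
qed

lemma wire_sum:
  assumes "\<And>i. i < k \<Longrightarrow> wire B m s d (w i)"
  shows "wire B m (k * s + k + 1) (d + 2) (\<lambda>xs. \<Sum>i<k. w i xs)"
proof (cases "k = 0")
  case True
  \<comment> \<open>A \<open>Plus\<close> gate needs a predecessor, so the empty sum is a constant
    gate.\<close>
  then show ?thesis by (intro wire_mono[OF wire_const[of B m 0]]) auto
next
  case False
  have "(\<lambda>xs. sum_list (map (\<lambda>i. w i xs) [0..<k])) = (\<lambda>xs. \<Sum>i<k. w i xs)"
    by (simp add: interv_sum_list_conv_sum_set_nat atLeast0LessThan)
  then show ?thesis using wire_op[of k B m s d w Plus sum_list, OF assms] False by simp
qed

lemma wire_mult:
  assumes "wire B m s d v" "wire B m s d w"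
  shows "wire B m (2 * s + 3) (d + 2) (\<lambda>xs. v xs * w xs)"
proof -
  have "wire B m (2 * s + 2 + 1) (d + 2)
      (\<lambda>xs. prod_list (map (\<lambda>i. (if i = 0 then v else w) xs) [0..<2]))"
    by (rule wire_op[of 2 B m s d "\<lambda>i. if i = 0 then v else w" Times prod_list])
      (use assms in simp_all)
  then show ?thesis by (rule wire_mono) (simp_all add: upt_rec)
qed

lemma wire_fun:
  assumes "wire B m s d w" "f \<in> B"
  shows "wire B m (s + 1) (d + 1) (\<lambda>xs. f (w xs))"
proof (rule wireI)
  fix D s0 W assume *: "d + 1 \<le> D" "(\<lambda>i. (\<lambda>xs. xs ! i, 0)) ` {..<m} \<subseteq> W" "pool B m D s0 W"
  have "pool B m D (s0 + s) (insert (w, d) W)" using wireD[OF assms(1) *(3) _ *(2)] *(1) by simp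
  then have "pool B m D (Suc (s0 + s)) (insert (\<lambda>xs. f (w xs), Suc d) (insert (w, d) W))"
    by (rule pool_fun) (use assms * in auto)
  then show "pool B m D (s0 + (s + 1)) (insert (\<lambda>xs. f (w xs), d + 1) W)"
    by (rule pool_subset) auto
qed

section \<open>Heights of gates, depth, and embedding a given circuit\<close>

definition height :: "circuit \<Rightarrow> nat \<Rightarrow> nat" where
  "height C g = Max {k. \<exists>p. (p, g) \<in> wires C ^^ k}"

text \<open>Each step of a path gains an ancestor, so \<open>k\<close> is at most the number of
  ancestors of the end point. Length 0 is split off because the end point of such a path need not be
  a gate.\<close>

lemma path_bound:
  assumes "wf_circuit C" "(p, g) \<in> wires C ^^ k"
  shows "k \<le> csize C"
proof (cases "k = 0")
  case False
  have "g < csize C" using False assms(2) by (cases k) (auto simp: wires_def)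
  have "k \<le> card (ancestors C g)" using assms(2) \<open>g < csize C\<close>
  proof (induction k arbitrary: g)
    case (Suc k)
    then obtain q where q: "(p, q) \<in> wires C ^^ k" "(q, g) \<in> wires C" by auto
    then have "q \<in> set (preds C g)" by (auto simp: wires_def)
    then show ?case
      using Suc.IH[OF q(1)] preds_less[OF assms(1) Suc.prems(2)]
        card_ancestors_pred[OF assms(1) Suc.prems(2)] by fastforce
  qed simp
  also have "\<dots> \<le> card {..< csize C}"
    using ancestors_subset[OF assms(1) \<open>g < csize C\<close>] by (intro card_mono) auto
  finally show ?thesis by simp
qed simp

lemma finite_paths: "wf_circuit C \<Longrightarrow> finite {k. \<exists>p. (p, g) \<in> wires C ^^ k}"
  by (rule finite_subset[of _ "{..csize C}"]) (auto dest: path_bound)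

lemma finite_depth_set:
  assumes "wf_circuit C"
  shows "finite {k. wires C ^^ k \<noteq> {}}" "{k. wires C ^^ k \<noteq> {}} \<noteq> {}"
proof -
  show "finite {k. wires C ^^ k \<noteq> {}}"
    by (rule finite_subset[of _ "{..csize C}"]) (auto dest: path_bound[OF assms])
  have "(0, 0) \<in> wires C ^^ 0" by simp
  then show "{k. wires C ^^ k \<noteq> {}} \<noteq> {}" by blast
qed

lemma height_le_depth: "wf_circuit C \<Longrightarrow> height C g \<le> depth C"
proof -
  assume wf: "wf_circuit C"
  have "(g, g) \<in> wires C ^^ 0" by simp
  then have "{k. \<exists>p. (p, g) \<in> wires C ^^ k} \<noteq> {}" by blast
  then show ?thesis unfolding height_def depth_def
    by (intro Max_mono finite_depth_set wf) auto
qed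

lemma height_pred:
  assumes "wf_circuit C" "g < csize C" "p \<in> set (preds C g)"
  shows "height C p < height C g"
proof -
  have "(p, p) \<in> wires C ^^ 0" by simp
  then have "{k. \<exists>q. (q, p) \<in> wires C ^^ k} \<noteq> {}" by blast
  then have "height C p \<in> {k. \<exists>q. (q, p) \<in> wires C ^^ k}"
    unfolding height_def by (intro Max_in finite_paths assms)
  then obtain q where "(q, p) \<in> wires C ^^ height C p" by blast
  moreover have "(p, g) \<in> wires C" using assms by (simp add: wires_def)
  ultimately have "(q, g) \<in> wires C ^^ Suc (height C p)" by auto
  then have "Suc (height C p) \<le> height C g"
    unfolding height_def[of C g] by (intro Max_ge finite_paths assms) blast
  then show ?thesis by simp
qed

lemma depth_le:
  assumes "wf_circuit C" "\<And>g. g < csize C \<Longrightarrow> lev g \<le> D"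
    "\<And>g p. g < csize C \<Longrightarrow> p \<in> set (preds C g) \<Longrightarrow> lev p < lev g"
  shows "depth C \<le> D"
proof -
  have *: "k \<le> lev g" if "(p, g) \<in> wires C ^^ k" "g < csize C" for p g k
    using that
  proof (induction k arbitrary: g)
    case (Suc k)
    then obtain q where q: "(p, q) \<in> wires C ^^ k" "(q, g) \<in> wires C" by auto
    then have "q \<in> set (preds C g)" by (auto simp: wires_def)
    then show ?case
      using Suc.IH[OF q(1)] preds_less[OF assms(1) Suc.prems(2)] assms(3)[OF Suc.prems(2)]
      by fastforce
  qed simp
  have "k \<le> D" if "wires C ^^ k \<noteq> {}" for k
  proof (cases k)
    case (Suc k')
    obtain p g where pg: "(p, g) \<in> wires C ^^ k" using \<open>wires C ^^ k \<noteq> {}\<close>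
      by auto
    then have "g < csize C" using Suc by (auto simp: wires_def)
    then show ?thesis using *[OF pg] assms(2) order_trans by blast
  qed simp
  then show ?thesis unfolding depth_def using finite_depth_set[OF assms(1)] by simp
qed

text \<open>The gates of \<open>C\<close> are added in the order of their heights.\<close>

lemma wire_embed:
  assumes C: "wf_circuit C" "set (fun_tab C) \<subseteq> B" "g < csize C"
    and ins: "\<And>i. i < n_in C \<Longrightarrow> wire B m s d (u i)" "\<And>i. i < n_aux C \<Longrightarrow> wire B m s d (v i)"
  shows "wire B m ((n_in C + n_aux C) * s + csize C * (csize C + 1)) (d + 2 * depth C)
    (\<lambda>xs. gate_val C (map (\<lambda>i. u i xs) [0..<n_in C]) (map (\<lambda>i. v i xs) [0..<n_aux C]) g)"
proof (rule wireI)
  fix D s0 W assume D: "d + 2 * depth C \<le> D" and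
    W: "(\<lambda>i. (\<lambda>xs. xs ! i, 0)) ` {..<m} \<subseteq> W" and p: "pool B m D s0 W"
  let ?w = "\<lambda>g xs. gate_val C (map (\<lambda>i. u i xs) [0..<n_in C]) (map (\<lambda>i. v i xs) [0..<n_aux C]) g"
  define W1 where "W1 = (\<lambda>i. (v i, d)) ` {..<n_aux C} \<union> ((\<lambda>i. (u i, d)) ` {..<n_in C} \<union> W)"
  define s1 where "s1 = s0 + n_in C * s + n_aux C * s"
  have p1: "pool B m D s1 W1"
    unfolding W1_def s1_def
    by (rule wires_pool, rule wires_pool[OF p _ W ins(1)]) (use D W ins in auto)
  let ?G = "\<lambda>k. {g. g < csize C \<and> height C g < k}"
  let ?e = "\<lambda>g. (?w g, d + 2 * height C g)"
  \<comment> \<open>A gate costs itself and at most \<open>csize C\<close> copies of arguments; two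
    levels per unit of height leave room for the copies.\<close>
  have add: "pool B m D (s' + (csize C + 1)) (insert (?e g) V)"
    if g: "g < csize C" and V: "W1 \<subseteq> V" "?e ` set (preds C g) \<subseteq> V" "pool B m D s' V" for g V s'
  proof -
    have ok: "fan_in_ok (kind_of C g) (length (preds C g))" and dis: "distinct (preds C g)" and
      sub: "set (preds C g) \<subseteq> {..< csize C}"
      using C(1) g by (auto simp: wf_circuit_def)
    have len: "length (preds C g) \<le> csize C"
      using card_mono[OF _ sub] distinct_card[OF dis] by simp
    have hg: "2 * height C g \<le> 2 * depth C" using height_le_depth[OF C(1)] by simp
    have V': "W \<subseteq> V" "\<And>i. i < n_in C \<Longrightarrow> (u i, d) \<in> V" "\<And>i. i < n_aux C \<Longrightarrow> (v i, d) \<in> V"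
      using V(1) by (auto simp: W1_def)
    note unf = gate_val_unfold[OF C(1) g]
    \<comment> \<open>Output gates of the embedded circuit only repeat their predecessor, whose
      function is already in the pool and is reused.\<close>
    have one: ?thesis if one1: "\<exists>p. preds C g = [p]" and one2: "\<And>xs. ?w g xs = ?w (hd (preds C g)) xs"
    proof -
      obtain p where p: "preds C g = [p]" using one1 by auto
      have "height C p < height C g" using height_pred[OF C(1) g] p by simp
      moreover have "?e p \<in> V" using V(2) p by simp
      ultimately show ?thesis
        by (intro pool_replace[OF V(3), of "?w p" "d + 2 * height C p"]) (use p one2 in auto)
    qed
    have many: ?thesis if "op = Plus \<and> F = sum_list \<or> op = Times \<and> F = prod_list" "preds C g \<noteq> []"
      "\<And>xs. ?w g xs = F (map (\<lambda>p. ?w p xs) (preds C g))" for F op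
    proof -
      have lt: "height C p + 1 \<le> height C g" if "p \<in> set (preds C g)" for p
        using height_pred[OF C(1) g that] by simp
      obtain p0 where "p0 \<in> set (preds C g)" using \<open>preds C g \<noteq> []\<close>
        by (cases "preds C g") auto
      then have h1: "height C g \<ge> 1" using lt by fastforce
      \<comment> \<open>\<open>pool_op\<close> wants one level for all arguments; all predecessors
        have height at most \<open>height C g - 1\<close>.\<close>
      let ?l = "d + 2 * (height C g - 1)"
      have "pool B m D s' ((\<lambda>p. (?w p, ?l)) ` set (preds C g) \<union> V)"
      proof (rule pool_mono[OF V(3) order_refl])
        fix w l assume "(w, l) \<in> (\<lambda>p. (?w p, ?l)) ` set (preds C g) \<union> V"
        then show "\<exists>w' l'. (w', l') \<in> V \<and> l' \<le> l \<and> (\<forall>xs. length xs = m \<longrightarrow> w' xs = w xs)"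
        proof
          assume "(w, l) \<in> (\<lambda>p. (?w p, ?l)) ` set (preds C g)"
          then obtain p where p: "p \<in> set (preds C g)" "w = ?w p" "l = ?l" by auto
          then have "?e p \<in> V" using V(2) by auto
          moreover have "d + 2 * height C p \<le> ?l" using lt[OF p(1)] by simp
          ultimately show ?thesis using p by blast
        qed blast
      qed
      then have "pool B m D (s' + length (map ?w (preds C g)) + 1)
          (insert (\<lambda>xs. F (map (\<lambda>w. w xs) (map ?w (preds C g))), ?l + 2)
            ((\<lambda>p. (?w p, ?l)) ` set (preds C g) \<union> V))"
        by (rule pool_op) (use that h1 D hg in auto)
      moreover have "(\<lambda>xs. F (map (\<lambda>w. w xs) (map ?w (preds C g)))) = ?w g"
        using that(3) by (simp add: comp_def)
      moreover have "?l + 2 = d + 2 * height C g" using h1 by simp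
      ultimately have "pool B m D (s' + length (preds C g) + 1)
          (insert (?e g) ((\<lambda>p. (?w p, ?l)) ` set (preds C g) \<union> V))"
        by (simp only: length_map)
      then show ?thesis by (rule pool_subset) (use len in auto)
    qed
    show ?thesis
    proof (cases "kind_of C g")
      case (Input i)
      then have "i < n_in C" by (rule index_less[OF C(1) g])
      then show ?thesis
        using V'(2)[of i] Input by (intro pool_replace[OF V(3), of "u i" d]) (simp_all add: unf)
    next
      case (Aux i)
      then have "i < n_aux C" by (rule index_less[OF C(1) g])
      then show ?thesis
        using V'(3)[of i] Aux by (intro pool_replace[OF V(3), of "v i" d]) (simp_all add: unf)
    next
      case (Const i)
      then show ?thesis
        by (intro pool_replace[OF pool_const[OF V(3), of "const_tab C ! i"],
              of "\<lambda>_. const_tab C ! i" 0]) (auto simp: unf)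
    next
      case Plus
      then show ?thesis using ok by (intro many[of Plus sum_list]) (auto simp: unf)
    next
      case Times
      then show ?thesis using ok by (intro many[of Times prod_list]) (auto simp: unf)
    next
      case (Output i)
      then show ?thesis using ok by (intro one) (auto simp: unf length_Suc_conv)
    next
      case (Fun i)
      then obtain p where p: "preds C g = [p]" using ok by (auto simp: length_Suc_conv)
      have "i < length (fun_tab C)" using Fun by (rule index_less[OF C(1) g])
      then have f: "fun_tab C ! i \<in> B" using C(2) by auto
      have lt: "height C p < height C g" using height_pred[OF C(1) g] p by simp
      have "?e p \<in> V" using V(2) p by simp
      then have P: "pool B m D (Suc s')
          (insert (\<lambda>xs. (fun_tab C ! i) (?w p xs), Suc (d + 2 * height C p)) V)"
        using pool_fun[OF V(3) _ f] lt hg D by simp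
      show ?thesis
      proof (rule pool_replace[OF P insertI1])
        show "(fun_tab C ! i) (?w p xs) = ?w g xs" for xs using Fun p by (simp add: unf)
      qed (use lt in auto)
    qed
  qed
  have all: "pool B m D (s1 + card (?G k) * (csize C + 1)) (?e ` ?G k \<union> W1)" for k
  proof (induction k)
    case 0
    then show ?case using p1 by simp
  next
    case (Suc k)
    let ?H = "{g. g < csize C \<and> height C g = k}"
    \<comment> \<open>Gates of equal height are not wired to each other, so a layer can be added in
      any order.\<close>
    have ext: "pool B m D (s1 + card (?G k) * (csize C + 1) + card H * (csize C + 1))
        (?e ` H \<union> (?e ` ?G k \<union> W1))" if "finite H" "H \<subseteq> ?H" for H
      using that
    proof (induction H rule: finite_induct)
      case empty
      then show ?case using Suc by simp
    next
      case (insert g H)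
      have "?e ` set (preds C g) \<subseteq> ?e ` ?G k"
        using height_pred[OF C(1)] preds_less[OF C(1)] insert.prems by (intro image_mono) auto
      then have "pool B m D (s1 + card (?G k) * (csize C + 1) + card H * (csize C + 1) + (csize C + 1))
          (insert (?e g) (?e ` H \<union> (?e ` ?G k \<union> W1)))"
        using insert by (intro add) auto
      then show ?case using insert.hyps by (simp add: algebra_simps)
    qed
    have "?G (Suc k) = ?G k \<union> ?H" by auto
    moreover have "card (?G k \<union> ?H) = card (?G k) + card ?H" by (rule card_Un_disjoint) auto
    moreover have "?e ` ?H \<union> (?e ` ?G k \<union> W1) = ?e ` (?G k \<union> ?H) \<union> W1"
      by auto
    ultimately show ?case using ext[of ?H] by (simp add: algebra_simps)
  qed
  have G: "?G (Suc (depth C)) = {..< csize C}"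
    using height_le_depth[OF C(1)] by (auto simp: less_Suc_eq_le)
  have "pool B m D (s1 + csize C * (csize C + 1)) (?e ` {..< csize C} \<union> W1)"
    using all[of "Suc (depth C)"] unfolding G by simp
  then show "pool B m D (s0 + ((n_in C + n_aux C) * s + csize C * (csize C + 1)))
      (insert (?w g, d + 2 * depth C) W)"
  proof (rule pool_mono)
    fix w l assume "(w, l) \<in> insert (?w g, d + 2 * depth C) W"
    then consider "w = ?w g" "l = d + 2 * depth C" | "(w, l) \<in> W" by auto
    then show "\<exists>w' l'. (w', l') \<in> ?e ` {..< csize C} \<union> W1 \<and> l' \<le> l \<and>
        (\<forall>xs. length xs = m \<longrightarrow> w' xs = w xs)"
    proof cases
      case 1
      have "?e g \<in> ?e ` {..< csize C} \<union> W1" using C(3) by simp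
      moreover have "d + 2 * height C g \<le> l" using 1 height_le_depth[OF C(1)] by simp
      ultimately show ?thesis using 1 by blast
    next
      case 2
      then show ?thesis unfolding W1_def by blast
    qed
  qed (simp add: s1_def algebra_simps)
qed

lemma wire_circuit:
  assumes "wire B m s d w"
  shows "\<exists>C. wf_circuit C \<and> n_in C = m \<and> n_aux C = 0 \<and> set (fun_tab C) \<subseteq> B \<and>
    csize C \<le> m + s + 1 \<and> depth C \<le> d + 1 \<and> (\<forall>xs. length xs = m \<longrightarrow> circuit_fun C xs = [w xs])"
proof -
  \<comment> \<open>Level \<open>d + 1\<close> is reserved for the output gate.\<close>
  have "pool B m (d + 1) (m + s) (insert (w, d) ((\<lambda>i. (\<lambda>xs. xs ! i, 0)) ` {..<m}))"
    by (rule wireD[OF assms pool_inputs]) auto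
  then obtain C lev where C: "levelled B m (d + 1) 0 C lev" "csize C \<le> m + s"
    and "\<exists>g < csize C. lev g \<le> d \<and> (\<forall>xs. length xs = m \<longrightarrow> gate_val C xs [] g = w xs)"
    unfolding pool_def by auto
  then obtain g where g: "g < csize C" "lev g \<le> d" "\<forall>xs. length xs = m \<longrightarrow> gate_val C xs [] g = w xs"
    by blast
  define C' where "C' = C\<lparr>gates := gates C @ [(Output 0, [g])], n_out := 1\<rparr>"
  have C': "gates C' = gates C @ [(Output 0, [g])]" "n_in C' = m" "n_aux C' = 0"
    "const_tab C' = const_tab C @ []" "fun_tab C' = fun_tab C @ []" "n_out C' = 1"
    using C(1) by (auto simp: C'_def levelled_def)
  have a: "levelled B m (d + 1) (n_out C') C' (lev(csize C := d + 1))" "csize C' = Suc (csize C)"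
    "\<And>xs. gate_val C' xs [] (csize C) = gate_val C xs [] g"
    using levelled_append[OF C(1) C'(1-5), of "d + 1"] C'(6) g by auto
  have wf: "wf_circuit C'" using a(1) by (simp add: levelled_def)
  have "kind_of C' (csize C) = Output 0" by (simp add: C'_def kind_of_def csize_def)
  then have "output_gate C' 0 = csize C"
    unfolding output_gate_def using wf a(2) C'(6)
    by (intro the1_equality) (auto simp: wf_circuit_def numbered_def)
  then have "circuit_fun C' xs = [w xs]" if "length xs = m" for xs
    using a(3) g(3) that C'(6) by (simp add: circuit_fun_def outputs_def)
  moreover have "depth C' \<le> d + 1"
    by (rule depth_le[OF wf, of "lev(csize C := d + 1)"]) (use a(1) in \<open>auto simp: levelled_def\<close>)
  moreover have "set (fun_tab C') \<subseteq> B" using a(1) by (simp add: levelled_def)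
  ultimately show ?thesis using wf C' a(2) C(2) by (intro exI[of _ C']) auto
qed

section \<open>Aggregation functions of polynomial size\<close>

text \<open>The base is at least 2 even for \<open>m = 0\<close>, so constant factors and summands
  are absorbed by a larger exponent, and only the numbers \<open>k\<close> and \<open>d\<close> have
  to be tracked. The numerals below are generous; what counts is that they do not depend on
  \<open>m\<close>.\<close>

definition poly_wire ::
    "(real \<Rightarrow> real) set \<Rightarrow> nat \<Rightarrow> nat \<Rightarrow> nat \<Rightarrow> (real list \<Rightarrow> real) \<Rightarrow> bool" where
  "poly_wire B m k d w \<longleftrightarrow> wire B m ((m + 2) ^ k) d w"

lemma poly_wire_mono: "poly_wire B m k d w \<Longrightarrow> k \<le> k' \<Longrightarrow> d \<le> d' \<Longrightarrow> poly_wire B m k' d' w"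
  unfolding poly_wire_def by (erule wire_mono) (simp_all add: power_increasing)

lemma poly_wire_cong: "poly_wire B m k d w \<Longrightarrow> (\<And>xs. length xs = m \<Longrightarrow> w xs = w' xs) \<Longrightarrow> poly_wire B m k d w'"
  unfolding poly_wire_def by (erule wire_mono) simp_all

lemma poly_wire_input: "i < m \<Longrightarrow> poly_wire B m k d (\<lambda>xs. xs ! i)"
  unfolding poly_wire_def by (rule wire_mono[OF wire_input]) auto

lemma poly_wire_const: "poly_wire B m k d (\<lambda>_. c)"
  unfolding poly_wire_def by (rule wire_mono[OF wire_const]) auto

text \<open>One factor \<open>m + 2\<close> pays for the number of arguments and two more absorb the
  constant 4; hence the increment 3 in the rules below.\<close>

lemma power_3_bound:
  fixes m k :: nat
  shows "4 * ((m + 2) ^ k * (m + 2)) \<le> (m + 2) ^ (k + 3)"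
proof -
  have "2 * 2 \<le> (m + 2) * (m + 2)" by (intro mult_le_mono) auto
  then have "4 * ((m + 2) ^ k * (m + 2)) \<le> ((m + 2) * (m + 2)) * ((m + 2) ^ k * (m + 2))"
    by (intro mult_le_mono1) simp
  then show ?thesis by (simp add: power_add numeral_eq_Suc mult_ac)
qed

lemma poly_wire_sum:
  assumes "\<And>i. i < N \<Longrightarrow> poly_wire B m k d (w i)" "N \<le> m + 2"
  shows "poly_wire B m (k + 3) (d + 2) (\<lambda>xs. \<Sum>i<N. w i xs)"
  unfolding poly_wire_def
proof (rule wire_mono)
  show "wire B m (N * (m + 2) ^ k + N + 1) (d + 2) (\<lambda>xs. \<Sum>i<N. w i xs)"
    by (rule wire_sum) (use assms(1) in \<open>simp add: poly_wire_def\<close>)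
  have "N * (m + 2) ^ k \<le> (m + 2) ^ k * (m + 2)"
    using assms(2) by (subst mult.commute) (rule mult_le_mono2)
  moreover have "m + 2 \<le> (m + 2) ^ k * (m + 2)"
    using mult_le_mono1[of 1 "(m + 2) ^ k" "m + 2"] by simp
  ultimately show "N * (m + 2) ^ k + N + 1 \<le> (m + 2) ^ (k + 3)"
    using power_3_bound[of m k] assms(2) by linarith
qed auto

lemma poly_wire_sum_list:
  assumes "\<And>i. i < m \<Longrightarrow> poly_wire B m k d (\<lambda>xs. h xs (xs ! i))"
  shows "poly_wire B m (k + 3) (d + 2) (\<lambda>xs. \<Sum>v\<leftarrow>xs. h xs v)"
proof (rule poly_wire_cong)
  show "poly_wire B m (k + 3) (d + 2) (\<lambda>xs. \<Sum>i<m. h xs (xs ! i))"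
    by (rule poly_wire_sum) (use assms in auto)
qed (simp add: sum_list_sum_nth atLeast0LessThan)

lemma poly_wire_mult:
  assumes "poly_wire B m k d v" "poly_wire B m k d w"
  shows "poly_wire B m (k + 3) (d + 2) (\<lambda>xs. v xs * w xs)"
  unfolding poly_wire_def
proof (rule wire_mono)
  show "wire B m (2 * (m + 2) ^ k + 3) (d + 2) (\<lambda>xs. v xs * w xs)"
    by (rule wire_mult) (use assms in \<open>simp_all add: poly_wire_def\<close>)
  have "(m + 2) ^ k * 2 \<le> (m + 2) ^ k * (m + 2)" by (intro mult_le_mono2) simp
  moreover have "2 \<le> (m + 2) ^ k * 2" by simp
  ultimately show "2 * (m + 2) ^ k + 3 \<le> (m + 2) ^ (k + 3)" using power_3_bound[of m k] by linarith
qed auto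

lemma poly_wire_add:
  assumes "poly_wire B m k d v" "poly_wire B m k d w"
  shows "poly_wire B m (k + 3) (d + 2) (\<lambda>xs. v xs + w xs)"
proof (rule poly_wire_cong)
  show "poly_wire B m (k + 3) (d + 2) (\<lambda>xs. \<Sum>i<(2::nat). (if i = 0 then v xs else w xs))"
  proof (rule poly_wire_sum)
    fix i :: nat
    show "poly_wire B m k d (\<lambda>xs. if i = 0 then v xs else w xs)" using assms
      by (cases "i = 0") simp_all
  qed simp
qed (simp add: numeral_2_eq_2)

text \<open>Subtraction is not a gate: it is a product with \<open>- 1\<close> followed by a sum,
  which adds up to the increments 6 and 4.\<close>

lemma poly_wire_diff:
  assumes "poly_wire B m k d v" "poly_wire B m k d w"
  shows "poly_wire B m (k + 6) (d + 4) (\<lambda>xs. v xs - w xs)"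
proof (rule poly_wire_cong)
  have "poly_wire B m (k + 3) (d + 2) (\<lambda>xs. (- 1) * w xs)"
    by (rule poly_wire_mult[OF poly_wire_const assms(2)])
  from poly_wire_add[OF poly_wire_mono[OF assms(1)] this]
  show "poly_wire B m (k + 6) (d + 4) (\<lambda>xs. v xs + (- 1) * w xs)"
    by (rule poly_wire_mono) simp_all
qed simp

lemma poly_wire_fun:
  assumes "poly_wire B m k d w" "f \<in> B"
  shows "poly_wire B m (k + 1) (d + 1) (\<lambda>xs. f (w xs))"
  unfolding poly_wire_def
proof (rule wire_mono)
  show "wire B m ((m + 2) ^ k + 1) (d + 1) (\<lambda>xs. f (w xs))"
    by (rule wire_fun) (use assms in \<open>simp_all add: poly_wire_def\<close>)
  have "(m + 2) ^ k * 2 \<le> (m + 2) ^ k * (m + 2)" by (intro mult_le_mono2) simp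
  moreover have "1 \<le> (m + 2) ^ k" by simp
  ultimately show "(m + 2) ^ k + 1 \<le> (m + 2) ^ (k + 1)" unfolding power_add power_one_right
    by linarith
qed auto

lemma poly_wire_embed:
  assumes C: "wf_circuit C" "set (fun_tab C) \<subseteq> B" "g < csize C"
    and ins: "\<And>i. i < n_in C \<Longrightarrow> poly_wire B m k d (u i)" "\<And>i. i < n_aux C \<Longrightarrow> poly_wire B m k d (v i)"
    and bounds: "n_in C + n_aux C \<le> m" "csize C \<le> m"
  shows "poly_wire B m (k + 3) (d + 2 * depth C)
    (\<lambda>xs. gate_val C (map (\<lambda>i. u i xs) [0..<n_in C]) (map (\<lambda>i. v i xs) [0..<n_aux C]) g)"
  unfolding poly_wire_def
proof (rule wire_mono)
  show "wire B m ((n_in C + n_aux C) * (m + 2) ^ k + csize C * (csize C + 1)) (d + 2 * depth C)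
    (\<lambda>xs. gate_val C (map (\<lambda>i. u i xs) [0..<n_in C]) (map (\<lambda>i. v i xs) [0..<n_aux C]) g)"
    by (rule wire_embed) (use assms in \<open>simp_all add: poly_wire_def\<close>)
  have "(n_in C + n_aux C) * (m + 2) ^ k \<le> (m + 2) ^ k * (m + 2)"
    using bounds by (subst mult.commute, intro mult_le_mono2) simp
  moreover have "csize C * (csize C + 1) \<le> (m + 2) * (m + 2)"
    using bounds by (intro mult_le_mono) auto
  moreover have "(m + 2) * (m + 2) \<le> ((m + 2) ^ k * (m + 2)) * (m + 2)"
    using mult_le_mono1[of 1 "(m + 2) ^ k" "m + 2"] by (intro mult_le_mono1) simp
  moreover have "((m + 2) ^ k * (m + 2)) * (m + 2) + (m + 2) ^ k * (m + 2) \<le> (m + 2) ^ (k + 3)"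
  proof -
    have "(m + 2) ^ (k + 3) = ((m + 2) ^ k * (m + 2)) * ((m + 2) * (m + 2))"
      by (simp only: power_add power3_eq_cube mult.assoc)
    moreover have "((m + 2) ^ k * (m + 2)) * ((m + 2) + 1) \<le> ((m + 2) ^ k * (m + 2)) * ((m + 2) * (m + 2))"
      by (intro mult_le_mono2) simp
    ultimately show ?thesis by (simp only: distrib_left mult_1_right)
  qed
  ultimately show "(n_in C + n_aux C) * (m + 2) ^ k + csize C * (csize C + 1) \<le> (m + 2) ^ (k + 3)"
    by linarith
qed auto

section \<open>Equality tests, order statistics and packed states, all by arithmetic and
  \<open>sign\<close>\<close>

definition eq_ind :: "real \<Rightarrow> real \<Rightarrow> real" where
  "eq_ind a b = 1 - sign (a - b) - sign (b - a)"

lemma eq_ind_eq: "eq_ind a b = of_bool (a = b)"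
  by (auto simp: eq_ind_def sign_def)

lemma poly_wire_eq_ind:
  assumes "poly_wire B m k d v" "poly_wire B m k d w" "sign \<in> B"
  shows "poly_wire B m (k + 20) (d + 13) (\<lambda>xs. eq_ind (v xs) (w xs))"
proof -
  have "poly_wire B m (k + 7) (d + 5) (\<lambda>xs. sign (v xs - w xs))"
    "poly_wire B m (k + 7) (d + 5) (\<lambda>xs. sign (w xs - v xs))"
    by (rule poly_wire_mono[OF poly_wire_fun[OF poly_wire_diff[OF assms(1,2)] assms(3)]]; simp)
      (rule poly_wire_mono[OF poly_wire_fun[OF poly_wire_diff[OF assms(2,1)] assms(3)]]; simp)
  note s = this
  show ?thesis unfolding eq_ind_def
    by (rule poly_wire_mono[OF poly_wire_diff[OF poly_wire_diff[OF poly_wire_const s(1)] poly_wire_mono[OF s(2)]]]) simp_all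
qed

definition rank :: "real list \<Rightarrow> real \<Rightarrow> real" where
  "rank xs v = (\<Sum>u\<leftarrow>xs. sign (u - v))"

text \<open>For distinct entries this is the order statistic: the \<open>r\<close>-th largest entry,
  counted from 0. Being a sum over all entries, it depends only on the multiset.\<close>

definition ranked :: "real list \<Rightarrow> nat \<Rightarrow> real" where
  "ranked xs r = (\<Sum>v\<leftarrow>xs. eq_ind (rank xs v) (real r) * v)"

text \<open>The two smallest of \<open>K + 1\<close> packed values belong to slots
  \<open>K - 2\<close> and \<open>K - 1\<close>. Both hold \<open>n\<close>, so the values differ by
  exactly \<open>3 * M\<close>.\<close>

definition scale :: "real list \<Rightarrow> real" where
  "scale xs = (ranked xs (length xs - 2) - ranked xs (length xs - 1)) * (1 / 3)"

text \<open>The shift to \<open>Suc j\<close> skips the pendant value, which has rank 0.\<close>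

definition slot :: "real list \<Rightarrow> nat \<Rightarrow> real" where
  "slot xs j = ranked xs (Suc j) + real (3 * j + 2) * scale xs"

text \<open>\<open>1 + (\<Sum>j<K. s j * s j)\<close> plays the part of \<open>M\<close>: it exceeds
  every absolute value, since \<open>|x| < 1 + x * x\<close>, and needs no maximum.\<close>

definition packed :: "nat \<Rightarrow> (nat \<Rightarrow> real) \<Rightarrow> nat \<Rightarrow> real" where
  "packed K s i = s i - real (3 * i + 2) * (1 + (\<Sum>j<K. s j * s j))"

lemma poly_wire_rank:
  assumes "poly_wire B m k d w" "sign \<in> B"
  shows "poly_wire B m (k + 10) (d + 7) (\<lambda>xs. rank xs (w xs))"
proof -
  have "poly_wire B m (k + 7) (d + 5) (\<lambda>xs. sign (xs ! i - w xs))" if "i < m" for i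
    by (rule poly_wire_mono[OF poly_wire_fun[OF poly_wire_diff[OF poly_wire_input[OF that] assms(1)] assms(2)]]) simp_all
  from poly_wire_sum_list[of m B "k + 7" "d + 5" "\<lambda>xs u. sign (u - w xs)", OF this]
  show ?thesis unfolding rank_def by (rule poly_wire_mono) simp_all
qed

lemma poly_wire_ranked:
  assumes "sign \<in> B"
  shows "poly_wire B m 40 30 (\<lambda>xs. ranked xs r)"
proof -
  have "poly_wire B m 33 22 (\<lambda>xs. eq_ind (rank xs (xs ! i)) (real r) * xs ! i)" if "i < m" for i
  proof -
    have "poly_wire B m 10 7 (\<lambda>xs. rank xs (xs ! i))"
      using poly_wire_rank[OF poly_wire_input[OF that, of B 0 0] assms]
      by simp
    from poly_wire_mult[OF poly_wire_eq_ind[OF this poly_wire_const assms] poly_wire_input[OF that]] show ?thesis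
      by simp
  qed
  then show ?thesis unfolding ranked_def
    by (intro poly_wire_mono[OF poly_wire_sum_list[of m B 33 22 "\<lambda>xs v. eq_ind (rank xs v) (real r) * v"]]) simp_all
qed

lemma poly_wire_slot:
  assumes "sign \<in> B"
  shows "poly_wire B m 60 50 (\<lambda>xs. slot xs j)"
proof (rule poly_wire_cong)
  have "poly_wire B m 49 36 (\<lambda>xs. (ranked xs (m - 2) - ranked xs (m - 1)) * (1 / 3))"
    by (rule poly_wire_mono[OF poly_wire_mult[OF poly_wire_diff[OF poly_wire_ranked[OF assms] poly_wire_ranked[OF assms]] poly_wire_const]];
        simp)
  note poly_wire_mult[OF poly_wire_const this, of "real (3 * j + 2)"]
  from poly_wire_add[OF poly_wire_mono[OF poly_wire_ranked[OF assms, of m "Suc j"]] this]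
  show "poly_wire B m 60 50 (\<lambda>xs. ranked xs (Suc j) +
      real (3 * j + 2) * ((ranked xs (m - 2) - ranked xs (m - 1)) * (1 / 3)))"
    by (rule poly_wire_mono) simp_all
qed (simp add: slot_def scale_def)

text \<open>Slots \<open>0, \<dots>, n - 1\<close> hold the inputs, the next ones the auxiliary memory, and slots \<open>K - 2\<close> and
  \<open>K - 1\<close> the number \<open>n\<close>. After \<open>t\<close> iterations slot \<open>K - 3\<close> holds \<open>n + t\<close>; initially all slots from
  \<open>n\<close> on hold \<open>n\<close>, and the auxiliary memory is then replaced
    by its initial values.\<close>

definition sim_aux :: "rec_circuit \<Rightarrow> nat \<Rightarrow> (nat \<Rightarrow> real) \<Rightarrow> nat \<Rightarrow> real" where
  "sim_aux R K s j = eq_ind (s (K - 3)) (real (n_in (base R))) * init R ! j +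
     (1 - eq_ind (s (K - 3)) (real (n_in (base R)))) * s (n_in (base R) + j)"

definition sim_val :: "rec_circuit \<Rightarrow> nat \<Rightarrow> (nat \<Rightarrow> real) \<Rightarrow> nat \<Rightarrow> real" where
  "sim_val R K s = gate_val (base R) (map s [0..<n_in (base R)])
     (map (sim_aux R K s) [0..<n_aux (base R)])"

text \<open>Slot \<open>K - 3\<close> holds \<open>n + t\<close> while iteration
  \<open>t + 1\<close> is simulated; subtracting \<open>n - 1\<close> gives the number of that
  iteration.\<close>

definition sim_halt :: "rec_circuit \<Rightarrow> nat \<Rightarrow> (nat \<Rightarrow> real) \<Rightarrow> real" where
  "sim_halt R K s = gate_val (halt_circuit R)
     (map (\<lambda>i. if i = 0 then s (K - 3) - (real (n_in (base R)) - 1)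
                else sim_val R K s (halt_gates R ! (i - 1)))
        [0..<n_in (halt_circuit R)])
     (map (\<lambda>_. 0) [0..<n_aux (halt_circuit R)]) (output_gate (halt_circuit R) 0)"

text \<open>The last branch renews \<open>n\<close> in slots \<open>K - 2\<close> and
  \<open>K - 1\<close>, whose equality reveals the scale in the next round.\<close>

definition sim_next :: "rec_circuit \<Rightarrow> nat \<Rightarrow> (nat \<Rightarrow> real) \<Rightarrow> nat \<Rightarrow> real" where
  "sim_next R K s i =
     (if i < n_in (base R) then sim_val R K s (rec_in R ! i)
      else if i < n_in (base R) + n_aux (base R) then sim_val R K s (rec_aux R ! (i - n_in (base R)))
      else if i = K - 3 then s (K - 3) + 1
      else real (n_in (base R)))"

definition sim_out :: "rec_circuit \<Rightarrow> nat \<Rightarrow> (nat \<Rightarrow> real) \<Rightarrow> nat \<Rightarrow> real" where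
  "sim_out R K s i = (if i < n_out (base R) then sim_val R K s (output_gate (base R) i) else 1)"

text \<open>Since \<open>sim_halt\<close> is 0 or 1 on the states that occur, this is a case
  distinction written with the available gates.\<close>

definition sim_step :: "rec_circuit \<Rightarrow> nat \<Rightarrow> (nat \<Rightarrow> real) \<Rightarrow> nat \<Rightarrow> real" where
  "sim_step R K s i = sim_halt R K s * sim_out R K s i +
     (1 - sim_halt R K s) * packed K (sim_next R K s) i"

text \<open>The phase is read off the multiset: only the initial labels have many coinciding values, and
  among the later rounds only the first one starts with a positive own value.\<close>

definition layer_fun :: "(nat \<Rightarrow> rec_circuit) \<Rightarrow> real list \<Rightarrow> real" where
  "layer_fun C xs =
     (if length xs = 2 then - (xs ! 1)
      else if length xs < 2 then 0
      else let K = length xs - 1;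
        own = xs ! 0;
        fresh = sign ((\<Sum>u\<leftarrow>xs. \<Sum>v\<leftarrow>xs. eq_ind u v) - (real (length xs) + 5 / 2));
        indexed = (\<Sum>v\<leftarrow>xs. v * v) + real (K * K + 2);
        joined = 0 - (ranked xs K + (real (3 * K - 1) - 3 * rank xs own) * ranked xs 0);
        stepped = (\<Sum>n<K. if length (enc_rec (C n)) = K
          then eq_ind (slot xs (K - 1)) (real n) *
            (\<Sum>i<K. eq_ind (rank xs own) (real (i + 1)) * sim_step (C n) K (slot xs) i)
          else 0)
      in fresh * indexed + (1 - fresh) * (sign own * joined + (1 - sign own) * stepped))"

section \<open>Size and depth of the simulating layer\<close>

lemma length_concat_ge: "(\<And>x. x \<in> set xs \<Longrightarrow> c \<le> length (f x)) \<Longrightarrow> c * length xs \<le> length (concat (map f xs))"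
proof (induction xs)
  case (Cons x xs)
  then have "c \<le> length (f x)" "c * length xs \<le> length (concat (map f xs))" by auto
  then show ?case by simp
qed simp

text \<open>Every gate takes at least two bits of its own and one in the unary length of the gate
  list. The factor 3 later leaves more than half of the slots free of outputs.\<close>

lemma length_enc_circuit:
  "n_in C + n_aux C + n_out C + 3 * csize C + 4 \<le> length (enc_circuit C)"
proof -
  have "2 \<le> length (enc_gate g)" for g
  proof -
    have "1 \<le> length (enc_kind k)" for k by (cases k) (auto simp: enc_nat_def)
    from this[of "fst g"] show ?thesis by (simp add: enc_gate_def enc_list_def enc_nat_def)
  qed
  then have "2 * length (gates C) \<le> length (concat (map enc_gate (gates C)))"
    by (intro length_concat_ge)
  then show ?thesis by (simp add: enc_circuit_def enc_list_def enc_nat_def csize_def)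
qed

lemma length_enc_rec:
  "n_in (base R) + n_aux (base R) + n_out (base R) + 3 * csize (base R) + 4 \<le> length (enc_rec R)"
  "n_in (halt_circuit R) + n_aux (halt_circuit R) + csize (halt_circuit R) \<le> length (enc_rec R)"
  "length (halt_gates R) < length (enc_rec R)"
  using length_enc_circuit[of "base R"] length_enc_circuit[of "halt_circuit R"]
  by (simp_all add: enc_rec_def enc_list_def enc_nat_def)

lemma numbered_le_csize:
  assumes "numbered C K n" "inj K"
  shows "n \<le> csize C"
proof -
  obtain h where h: "\<And>i. i < n \<Longrightarrow> h i < csize C \<and> kind_of C (h i) = K i"
    using assms(1) unfolding numbered_def by metis
  have "inj_on h {..<n}"
    by (rule inj_onI) (metis assms(2) h injD lessThan_iff)
  moreover have "h ` {..<n} \<subseteq> {..<csize C}" using h by auto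
  ultimately show ?thesis using card_inj_on_le[of h "{..<n}" "{..<csize C}"] by simp
qed

lemma in_out_le_csize:
  assumes "wf_circuit C"
  shows "n_in C \<le> csize C" "n_out C \<le> csize C"
  using assms numbered_le_csize[of C Input] numbered_le_csize[of C Output]
  by (auto simp: wf_circuit_def inj_def)

lemma output_gate_less:
  assumes "wf_circuit C" "j < n_out C"
  shows "output_gate C j < csize C"
proof -
  have "\<exists>!g. g < csize C \<and> kind_of C g = Output j"
    using assms by (simp add: wf_circuit_def numbered_def)
  from theI'[OF this] show ?thesis unfolding output_gate_def by blast
qed

lemma poly_wire_one_minus: "poly_wire B m k d w \<Longrightarrow> poly_wire B m (k + 6) (d + 4) (\<lambda>xs. 1 - w xs)"
  by (rule poly_wire_diff[OF poly_wire_const])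

context
  fixes R :: rec_circuit and B :: "(real \<Rightarrow> real) set" and m k d :: nat
    and s :: "real list \<Rightarrow> nat \<Rightarrow> real"
  assumes R: "wf_rec R" and m: "length (enc_rec R) \<le> m"
    and B: "set (fun_tab (base R)) \<subseteq> B" "set (fun_tab (halt_circuit R)) \<subseteq> B" "sign \<in> B"
    and s: "\<And>i. poly_wire B m k d (\<lambda>xs. s xs i)"
begin

lemma poly_wire_sim_aux: "poly_wire B m (k + 32) (d + 21) (\<lambda>xs. sim_aux R K (s xs) j)"
proof -
  let ?e = "\<lambda>xs. eq_ind (s xs (K - 3)) (real (n_in (base R)))"
  have e: "poly_wire B m (k + 20) (d + 13) ?e" by (rule poly_wire_eq_ind[OF s poly_wire_const B(3)])
  have "poly_wire B m (k + 29) (d + 19) (\<lambda>xs. (1 - ?e xs) * s xs (n_in (base R) + j))"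
    by (rule poly_wire_mono[OF poly_wire_mult[OF poly_wire_one_minus[OF e] poly_wire_mono[OF s]]]) simp_all
  note 1 = this
  have "poly_wire B m (k + 29) (d + 19) (\<lambda>xs. ?e xs * init R ! j)"
    by (rule poly_wire_mono[OF poly_wire_mult[OF e poly_wire_const]]) simp_all
  from poly_wire_add[OF this 1] show ?thesis unfolding sim_aux_def by (rule poly_wire_mono) simp_all
qed

lemma poly_wire_sim_val:
  assumes "g < csize (base R)"
  shows "poly_wire B m (k + 35) (d + 21 + 2 * depth (base R)) (\<lambda>xs. sim_val R K (s xs) g)"
proof -
  have "wf_circuit (base R)" using R by (simp add: wf_rec_def)
  then have "poly_wire B m (k + 32 + 3) (d + 21 + 2 * depth (base R)) (\<lambda>xs. sim_val R K (s xs) g)"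
    unfolding sim_val_def using length_enc_rec(1)[of R] m B(1) assms
    by (intro poly_wire_embed poly_wire_sim_aux poly_wire_mono[OF s]) auto
  then show ?thesis by (rule poly_wire_mono) simp_all
qed

lemma poly_wire_sim_halt:
  "poly_wire B m (k + 38) (d + 21 + 2 * depth (base R) + 2 * depth (halt_circuit R))
    (\<lambda>xs. sim_halt R K (s xs))"
proof -
  have wf: "wf_circuit (halt_circuit R)" "n_out (halt_circuit R) = 1"
    "n_in (halt_circuit R) = Suc (length (halt_gates R))"
    "set (halt_gates R) \<subseteq> {..< csize (base R)}"
    using R by (auto simp: wf_rec_def)
  have "poly_wire B m (k + 35) (d + 21 + 2 * depth (base R))
      (\<lambda>xs. if i = 0 then s xs (K - 3) - (real (n_in (base R)) - 1)
            else sim_val R K (s xs) (halt_gates R ! (i - 1)))" if "i < n_in (halt_circuit R)" for i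
  proof (cases "i = 0")
    case True
    have "poly_wire B m (k + 35) (d + 21 + 2 * depth (base R))
        (\<lambda>xs. s xs (K - 3) - (real (n_in (base R)) - 1))"
      by (rule poly_wire_mono[OF poly_wire_diff[OF s poly_wire_const]]) simp_all
    then show ?thesis using True by simp
  next
    case False
    then have "halt_gates R ! (i - 1) \<in> set (halt_gates R)" using that wf(3) by simp
    then have "halt_gates R ! (i - 1) < csize (base R)" using wf(4) by auto
    from poly_wire_sim_val[OF this] show ?thesis using False by simp
  qed
  then have "poly_wire B m (k + 35 + 3) (d + 21 + 2 * depth (base R) + 2 * depth (halt_circuit R))
      (\<lambda>xs. sim_halt R K (s xs))"
    unfolding sim_halt_def using length_enc_rec(2)[of R] m B(2) wf
    by (intro poly_wire_embed poly_wire_const output_gate_less) auto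
  then show ?thesis by (rule poly_wire_mono) simp_all
qed

lemma poly_wire_sim_next:
  "poly_wire B m (k + 35) (d + 21 + 2 * depth (base R)) (\<lambda>xs. sim_next R K (s xs) i)"
proof -
  have v: "rec_in R ! j < csize (base R)" if "j < n_in (base R)" for j
    using R that by (simp add: wf_rec_def subset_iff)
  have v': "rec_aux R ! j < csize (base R)" if "j < n_aux (base R)" for j
    using R that by (simp add: wf_rec_def subset_iff)
  consider (a) "i < n_in (base R)" | (b) "\<not> i < n_in (base R)" "i < n_in (base R) + n_aux (base R)" |
    (c) "\<not> i < n_in (base R)" "\<not> i < n_in (base R) + n_aux (base R)" by blast
  then show ?thesis
  proof cases
    case a
    then show ?thesis using poly_wire_sim_val[OF v[OF a]] by (simp add: sim_next_def)
  next
    case b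
    then have "i - n_in (base R) < n_aux (base R)" by simp
    from poly_wire_sim_val[OF v'[OF this]] b show ?thesis by (simp add: sim_next_def)
  next
    case c
    have "poly_wire B m (k + 35) (d + 21 + 2 * depth (base R)) (\<lambda>xs. s xs (K - 3) + 1)"
      by (rule poly_wire_mono[OF poly_wire_add[OF s poly_wire_const]]) simp_all
    then show ?thesis using c poly_wire_const by (cases "i = K - 3") (simp_all add: sim_next_def)
  qed
qed

lemma poly_wire_sim_out:
  "poly_wire B m (k + 35) (d + 21 + 2 * depth (base R)) (\<lambda>xs. sim_out R K (s xs) i)"
proof (cases "i < n_out (base R)")
  case True
  moreover have "wf_circuit (base R)" using R by (simp add: wf_rec_def)
  ultimately show ?thesis
    using poly_wire_sim_val[OF output_gate_less] by (simp add: sim_out_def)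
qed (simp add: sim_out_def poly_wire_const)

lemma poly_wire_packed:
  assumes "K \<le> m" "\<And>j. poly_wire B m k' d' (\<lambda>xs. t xs j)"
  shows "poly_wire B m (k' + 18) (d' + 12) (\<lambda>xs. packed K (t xs) i)"
proof -
  have "poly_wire B m (k' + 6) (d' + 4) (\<lambda>xs. \<Sum>j<K. t xs j * t xs j)"
    by (rule poly_wire_mono[OF poly_wire_sum[OF poly_wire_mult[OF assms(2) assms(2)]]]) (use assms(1) in simp_all)
  from poly_wire_mult[OF poly_wire_const poly_wire_add[OF poly_wire_const this]]
  have "poly_wire B m (k' + 12) (d' + 8) (\<lambda>xs. real (3 * i + 2) * (1 + (\<Sum>j<K. t xs j * t xs j)))"
    by (rule poly_wire_mono) simp_all
  from poly_wire_diff[OF poly_wire_mono[OF assms(2)] this] show ?thesis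
    unfolding packed_def by (rule poly_wire_mono) simp_all
qed

lemma poly_wire_sim_step:
  assumes "K \<le> m"
  shows "poly_wire B m (k + 68) (d + 41 + 2 * depth (base R) + 2 * depth (halt_circuit R))
    (\<lambda>xs. sim_step R K (s xs) i)"
proof -
  let ?E = "d + 33 + 2 * depth (base R) + 2 * depth (halt_circuit R)"
  have h: "poly_wire B m (k + 56) ?E (\<lambda>xs. sim_halt R K (s xs))"
    by (rule poly_wire_mono[OF poly_wire_sim_halt]) simp_all
  have o: "poly_wire B m (k + 56) ?E (\<lambda>xs. sim_out R K (s xs) i)"
    by (rule poly_wire_mono[OF poly_wire_sim_out]) simp_all
  have p: "poly_wire B m (k + 56) ?E (\<lambda>xs. packed K (sim_next R K (s xs)) i)"
    by (rule poly_wire_mono[OF poly_wire_packed[OF assms poly_wire_sim_next]]) simp_all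
  have 1: "poly_wire B m (k + 65) (?E + 6) (\<lambda>xs. (1 - sim_halt R K (s xs)) * packed K (sim_next R K (s xs)) i)"
    by (rule poly_wire_mono[OF poly_wire_mult[OF poly_wire_one_minus[OF h] poly_wire_mono[OF p]]]) simp_all
  have 2: "poly_wire B m (k + 65) (?E + 6) (\<lambda>xs. sim_halt R K (s xs) * sim_out R K (s xs) i)"
    by (rule poly_wire_mono[OF poly_wire_mult[OF h o]]) simp_all
  from poly_wire_add[OF 2 1] show ?thesis unfolding sim_step_def by (rule poly_wire_mono) simp_all
qed

end

text \<open>Views of length \<open>m\<close> concern only circuits whose code has length
  \<open>m - 1\<close>. Among the \<open>n < K\<close> there are at most \<open>K\<close> of them,
  each no larger than its code, so one layer can hold them all side by side.\<close>

lemma poly_wire_layer_fun: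
  assumes C: "\<And>n. wf_rec (C n)"
    and B: "\<And>n. set (fun_tab (base (C n))) \<subseteq> B" "\<And>n. set (fun_tab (halt_circuit (C n))) \<subseteq> B" "sign \<in> B"
    and D: "\<And>n. n < m \<Longrightarrow> length (enc_rec (C n)) \<le> m \<Longrightarrow>
      2 * depth (base (C n)) + 2 * depth (halt_circuit (C n)) \<le> D"
  shows "poly_wire B m 170 (130 + D) (layer_fun C)"
proof (cases "m \<le> 2")
  case True
  have "poly_wire B m 170 (130 + D) (\<lambda>xs. if m = 2 then - (xs ! 1) else 0)"
  proof (cases "m = 2")
    case True
    then have "poly_wire B m (0 + 6) (0 + 4) (\<lambda>xs. 0 - xs ! 1)"
      by (intro poly_wire_diff[OF poly_wire_const poly_wire_input]) simp
    then have "poly_wire B m 170 (130 + D) (\<lambda>xs. 0 - xs ! 1)" by (rule poly_wire_mono) simp_all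
    then show ?thesis using True by simp
  qed (simp add: poly_wire_const)
  then show ?thesis by (rule poly_wire_cong) (use True in \<open>auto simp: layer_fun_def\<close>)
next
  case False
  define K where "K = m - 1"
  have K: "K \<le> m" "K + 1 = m" using False by (auto simp: K_def)
  have own: "poly_wire B m k d (\<lambda>xs. xs ! 0)" for k d using False by (intro poly_wire_input) simp
  have rk: "poly_wire B m 10 7 (\<lambda>xs. rank xs (xs ! 0))"
    by (rule poly_wire_mono[OF poly_wire_rank[OF own[of 0 0] B(3)]]) simp_all
  let ?fresh = "\<lambda>xs. sign ((\<Sum>u\<leftarrow>xs. \<Sum>v\<leftarrow>xs. eq_ind u v) - (real m + 5 / 2))"
  have "poly_wire B m 20 13 (\<lambda>xs. eq_ind (xs ! i) (xs ! j))" if "i < m" "j < m" for i j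
    by (rule poly_wire_mono[OF poly_wire_eq_ind[OF poly_wire_input[OF that(1), of B 0 0] poly_wire_input[OF that(2), of B 0 0] B(3)]]) simp_all
  then have "poly_wire B m (20 + 3) (13 + 2) (\<lambda>xs. \<Sum>v\<leftarrow>xs. eq_ind (xs ! i) v)" if "i < m" for i
    using that by (intro poly_wire_sum_list[where h = "\<lambda>xs v. eq_ind (xs ! i) v"]) auto
  from poly_wire_sum_list[where h = "\<lambda>xs u. \<Sum>v\<leftarrow>xs. eq_ind u v", OF this]
  have "poly_wire B m 26 17 (\<lambda>xs. \<Sum>u\<leftarrow>xs. \<Sum>v\<leftarrow>xs. eq_ind u v)"
    by (rule poly_wire_mono) simp_all
  from poly_wire_fun[OF poly_wire_diff[OF this poly_wire_const] B(3)]
  have fresh: "poly_wire B m 33 22 ?fresh" by (rule poly_wire_mono) simp_all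
  let ?indexed = "\<lambda>xs. (\<Sum>v\<leftarrow>xs. v * v) + real (K * K + 2)"
  have "poly_wire B m 3 2 (\<lambda>xs. xs ! i * xs ! i)" if "i < m" for i
    by (rule poly_wire_mono[OF poly_wire_mult[OF poly_wire_input[OF that, of B 0 0] poly_wire_input[OF that, of B 0 0]]]) simp_all
  from poly_wire_add[OF poly_wire_sum_list[where h = "\<lambda>xs v. v * v", OF this] poly_wire_const]
  have indexed: "poly_wire B m 9 6 ?indexed" by (rule poly_wire_mono) simp_all
  let ?joined = "\<lambda>xs. 0 - (ranked xs K + (real (3 * K - 1) - 3 * rank xs (xs ! 0)) * ranked xs 0)"
  have "poly_wire B m 40 30 (\<lambda>xs. real (3 * K - 1) - 3 * rank xs (xs ! 0))"
    by (rule poly_wire_mono[OF poly_wire_diff[OF poly_wire_const poly_wire_mult[OF poly_wire_const rk]]]) simp_all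
  from poly_wire_mult[OF this poly_wire_ranked[OF B(3)]]
  have "poly_wire B m 43 32 (\<lambda>xs. (real (3 * K - 1) - 3 * rank xs (xs ! 0)) * ranked xs 0)"
    by (rule poly_wire_mono) simp_all
  from poly_wire_add[OF _ this] poly_wire_mono[OF poly_wire_ranked[OF B(3)], of 43 32]
  have "poly_wire B m (43 + 3) (32 + 2) (\<lambda>xs. ranked xs K + (real (3 * K - 1) - 3 * rank xs (xs ! 0)) * ranked xs 0)"
    by simp
  then have "poly_wire B m 46 34 (\<lambda>xs. ranked xs K + (real (3 * K - 1) - 3 * rank xs (xs ! 0)) * ranked xs 0)"
    by simp
  from poly_wire_diff[OF poly_wire_const this] have joined: "poly_wire B m 52 38 ?joined"
    by (rule poly_wire_mono) simp_all
  let ?sum = "\<lambda>n xs. \<Sum>i<K. eq_ind (rank xs (xs ! 0)) (real (i + 1)) * sim_step (C n) K (slot xs) i"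
  let ?sel = "\<lambda>n xs. if length (enc_rec (C n)) = K then eq_ind (slot xs (K - 1)) (real n) * ?sum n xs else 0"
  let ?stepped = "\<lambda>xs. \<Sum>n<K. ?sel n xs"
  \<comment> \<open>The code length of \<open>C n\<close> is fixed when the circuit for input length
    \<open>m\<close> is built: a match is embedded, any other \<open>n\<close> contributes the
    constant 0.\<close>
  have "poly_wire B m 137 (97 + D) (?sel n)" if n: "n < K" for n
  proof (cases "length (enc_rec (C n)) = K")
    case True
    then have D': "2 * depth (base (C n)) + 2 * depth (halt_circuit (C n)) \<le> D"
      using D[of n] n K by simp
    have st: "poly_wire B m 128 (91 + D) (\<lambda>xs. sim_step (C n) K (slot xs) i)" for i
      by (rule poly_wire_mono[OF poly_wire_sim_step[where s = slot, OF C _ B poly_wire_slot[OF B(3)] K(1)]])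
        (use True K D' in auto)
    have "poly_wire B m 128 (91 + D) (\<lambda>xs. eq_ind (rank xs (xs ! 0)) (real (i + 1)))" for i
      by (rule poly_wire_mono[OF poly_wire_eq_ind[OF rk poly_wire_const B(3)]]) simp_all
    from poly_wire_mult[OF this st]
    have "poly_wire B m 131 (93 + D) (\<lambda>xs. eq_ind (rank xs (xs ! 0)) (real (i + 1)) * sim_step (C n) K (slot xs) i)"
      for i by (rule poly_wire_mono) simp_all
    from poly_wire_sum[where N = K, OF this]
    have s: "poly_wire B m 134 (95 + D) (?sum n)" by (rule poly_wire_mono) (use K in simp_all)
    have "poly_wire B m 134 (95 + D) (\<lambda>xs. eq_ind (slot xs (K - 1)) (real n))"
      by (rule poly_wire_mono[OF poly_wire_eq_ind[OF poly_wire_slot[OF B(3)] poly_wire_const B(3)]]) simp_all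
    from poly_wire_mult[OF this s] show ?thesis unfolding if_P[OF True] by (rule poly_wire_mono) simp_all
  qed (simp add: poly_wire_const)
  from poly_wire_sum[where N = K, OF this]
  have stepped: "poly_wire B m 140 (99 + D) ?stepped" by (rule poly_wire_mono) (use K in simp_all)
  let ?rest = "\<lambda>xs. sign (xs ! 0) * ?joined xs + (1 - sign (xs ! 0)) * ?stepped xs"
  have sg: "poly_wire B m 1 1 (\<lambda>xs. sign (xs ! 0))"
    by (rule poly_wire_mono[OF poly_wire_fun[OF own[of 0 0] B(3)]]) simp_all
  have r1: "poly_wire B m 143 (101 + D) (\<lambda>xs. sign (xs ! 0) * ?joined xs)"
    by (rule poly_wire_mono[OF poly_wire_mult[OF poly_wire_mono[OF sg] joined]]) simp_all
  have "poly_wire B m 140 (99 + D) (\<lambda>xs. 1 - sign (xs ! 0))"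
    by (rule poly_wire_mono[OF poly_wire_one_minus[OF sg]]) simp_all
  from poly_wire_add[OF r1 poly_wire_mono[OF poly_wire_mult[OF this stepped]]]
  have rest: "poly_wire B m 146 (103 + D) ?rest" by (rule poly_wire_mono) simp_all
  have f1: "poly_wire B m 149 (105 + D) (\<lambda>xs. ?fresh xs * ?indexed xs)"
    by (rule poly_wire_mono[OF poly_wire_mult[OF fresh poly_wire_mono[OF indexed]]]) simp_all
  have "poly_wire B m 146 (103 + D) (\<lambda>xs. 1 - ?fresh xs)"
    by (rule poly_wire_mono[OF poly_wire_one_minus[OF fresh]]) simp_all
  from poly_wire_add[OF f1 poly_wire_mono[OF poly_wire_mult[OF this rest]]]
  have "poly_wire B m 170 (130 + D) (\<lambda>xs. ?fresh xs * ?indexed xs + (1 - ?fresh xs) * ?rest xs)"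
    by (rule poly_wire_mono) simp_all
  then show ?thesis
  proof (rule poly_wire_cong)
    fix xs :: "real list" assume len: "length xs = m"
    have m: "(m = 2) = False" "(m < 2) = False" "m - 1 = K" using False by (simp_all add: K_def)
    show "?fresh xs * ?indexed xs + (1 - ?fresh xs) * ?rest xs = layer_fun C xs"
      by (simp only: layer_fun_def Let_def len m if_False)
  qed
qed

section \<open>From size and depth bounds to membership in a circuit class\<close>

lemma tail_functionsI:
  assumes sym: "tail_symmetric f" and poly_wire: "\<And>m. poly_wire B m k (c + D m) f"
    and D: "(\<lambda>m. real (D m)) \<in> O(\<lambda>m. ln (real m) ^ i)"
  shows "f \<in> tail_functions (FAC i B)"
proof -
  have "\<exists>C. wf_circuit C \<and> n_in C = m \<and> n_aux C = 0 \<and> set (fun_tab C) \<subseteq> B \<and>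
      csize C \<le> m + (m + 2) ^ k + 1 \<and> depth C \<le> c + D m + 1 \<and>
      (\<forall>xs. length xs = m \<longrightarrow> circuit_fun C xs = [f xs])" for m
    using poly_wire[of m] unfolding poly_wire_def by (rule wire_circuit)
  then obtain C where C: "\<And>m. wf_circuit (C m)" "\<And>m. n_in (C m) = m" "\<And>m. n_aux (C m) = 0"
    "\<And>m. set (fun_tab (C m)) \<subseteq> B" "\<And>m. csize (C m) \<le> m + (m + 2) ^ k + 1"
    "\<And>m. depth (C m) \<le> c + D m + 1" "\<And>m xs. length xs = m \<Longrightarrow> circuit_fun (C m) xs = [f xs]"
    by metis
  have size: "(\<lambda>n. real (csize (C n))) \<in> O(\<lambda>n. real n ^ (k + 1))"
  proof (rule bigoI)
    show "\<forall>\<^sub>F n in sequentially. norm (real (csize (C n))) \<le> (2 ^ k + 2) * norm (real n ^ (k + 1))"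
      using eventually_ge_at_top[of 2]
    proof eventually_elim
      case (elim n)
      have "(n + 2) ^ k \<le> (2 * n) ^ k" by (rule power_mono) (use elim in auto)
      also have "\<dots> \<le> 2 ^ k * n ^ (k + 1)" using elim by (simp add: power_mult_distrib)
      finally have 1: "(n + 2) ^ k \<le> 2 ^ k * n ^ (k + 1)" .
      have "n \<le> n ^ (k + 1)" using elim by simp
      then have "csize (C n) \<le> (2 ^ k + 2) * n ^ (k + 1)"
        using C(5)[of n] 1 elim unfolding add_mult_distrib by linarith
      then have "real (csize (C n)) \<le> real ((2 ^ k + 2) * n ^ (k + 1))" by (rule of_nat_mono)
      then show ?case by (simp add: distrib_right)
    qed
  qed
  \<comment> \<open>Additive constants in the depth are absorbed: \<open>ln n\<close> is at least 1
    from \<open>n = 3\<close> on, as 3 is at least \<open>exp 1\<close>.\<close>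
  have one: "(\<lambda>n::nat. 1::real) \<in> O(\<lambda>n. ln (real n) ^ i)"
  proof (rule bigoI)
    show "\<forall>\<^sub>F n in sequentially. norm (1::real) \<le> 1 * norm (ln (real n) ^ i)"
      using eventually_ge_at_top[of 3]
    proof eventually_elim
      case (elim n)
      have "exp 1 \<le> real n" using exp_le elim by linarith
      then have "1 \<le> ln (real n)" using elim by (subst ln_ge_iff) auto
      then show ?case by (simp add: one_le_power)
    qed
  qed
  have dep: "(\<lambda>n. real (depth (C n))) \<in> O(\<lambda>n. ln (real n) ^ i)"
  proof -
    have "(\<lambda>n. real (depth (C n))) \<in> O(\<lambda>n. real (c + 1) * 1 + real (D n))"
    proof (rule bigoI)
      show "\<forall>\<^sub>F n in sequentially. norm (real (depth (C n))) \<le> 1 * norm (real (c + 1) * 1 + real (D n))"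
        using C(6) by (intro always_eventually allI) (simp add: add.commute flip: of_nat_add of_nat_Suc)
    qed
    also have "(\<lambda>n. real (c + 1) * 1 + real (D n)) \<in> O(\<lambda>n. ln (real n) ^ i)"
      by (intro sum_in_bigo D landau_o.big.cmult_in_iff[THEN iffD2] one) (use one in auto)
    finally show ?thesis .
  qed
  have "\<exists>k. (\<lambda>n. real (csize (C n))) \<in> O(\<lambda>n. real n ^ k)" using size
    by (rule exI)
  then have "C \<in> ext_families (FAC i B)" using C(1-4) dep by simp
  then have "C \<in> families (FAC i B)" using C(3) by (simp add: families_def)
  then have "(\<lambda>xs. [f xs]) \<in> computable (FAC i B)"
    unfolding computable_def using C(7) by (intro CollectI bexI[of _ C]) auto
  then show ?thesis using sym by (simp add: tail_functions_def)
qed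

text \<open>The layer for length \<open>m\<close> contains circuits with smaller indices, so their
  depth has to be bounded in terms of \<open>m\<close>. Indices before the asymptotic bound sets in
  are finitely many and are covered by the sum of their depths.\<close>

lemma depth_bound:
  assumes "C \<in> ext_families (FAC i B)"
  obtains c where "c \<ge> 0"
    "\<And>n m. n \<le> m \<Longrightarrow> 3 \<le> m \<Longrightarrow> real (depth (C n)) \<le> c * ln (real m) ^ i"
proof -
  have "(\<lambda>n. real (depth (C n))) \<in> O(\<lambda>n. ln (real n) ^ i)" using assms by simp
  then obtain c where "c > 0" and
      ev: "\<forall>\<^sub>F n in sequentially. norm (real (depth (C n))) \<le> c * norm (ln (real n) ^ i)"
    by (rule landau_o.bigE)
  then obtain N where N: "\<And>n. n \<ge> N \<Longrightarrow> real (depth (C n)) \<le> c * \<bar>ln (real n) ^ i\<bar>"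
    unfolding eventually_sequentially by auto
  show ?thesis
  proof (rule that)
    show "0 \<le> c + real (\<Sum>n<N. depth (C n))" using \<open>c > 0\<close>
      by (intro add_nonneg_nonneg of_nat_0_le_iff) simp
    fix n m :: nat assume nm: "n \<le> m" "3 \<le> m"
    have "exp 1 \<le> real m" using exp_le nm by linarith
    then have m: "1 \<le> ln (real m)" using nm by (subst ln_ge_iff) auto
    then have m1: "1 \<le> ln (real m) ^ i" by (rule one_le_power)
    have "real (depth (C n)) \<le> c * ln (real m) ^ i \<or> real (depth (C n)) \<le> real (\<Sum>n<N. depth (C n)) * ln (real m) ^ i"
    proof (cases "n < N")
      case True
      have "depth (C n) \<le> (\<Sum>n<N. depth (C n))" by (rule member_le_sum) (use True in auto)
      then have "real (depth (C n)) \<le> real (\<Sum>n<N. depth (C n)) * 1"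
        by (simp only: of_nat_le_iff mult_1_right)
      also have "\<dots> \<le> real (\<Sum>n<N. depth (C n)) * ln (real m) ^ i"
        by (rule mult_left_mono[OF m1 of_nat_0_le_iff])
      finally show ?thesis by simp
    next
      case False
      have "\<bar>ln (real n)\<bar> \<le> ln (real m)"
        using m nm by (cases "n = 0") (auto simp: abs_if)
      then have "\<bar>ln (real n) ^ i\<bar> \<le> ln (real m) ^ i" by (simp add: power_abs power_mono)
      then have "c * \<bar>ln (real n) ^ i\<bar> \<le> c * ln (real m) ^ i" using \<open>c > 0\<close>
        by simp
      then show ?thesis using N[of n] False by simp
    qed
    moreover have "0 \<le> c * ln (real m) ^ i" "0 \<le> real (\<Sum>n<N. depth (C n)) * ln (real m) ^ i"
      using \<open>c > 0\<close> m1 by (auto intro!: mult_nonneg_nonneg sum_nonneg)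
    ultimately show "real (depth (C n)) \<le> (c + real (\<Sum>n<N. depth (C n))) * ln (real m) ^ i"
      unfolding distrib_right by linarith
  qed
qed

text \<open>The first entry is the round number, which may itself be 1, so its contribution is
  subtracted again. The other \<open>2 * K\<close> entries are the features.\<close>

definition halt_detector :: "real list \<Rightarrow> real" where
  "halt_detector xs = (if xs = [] then 0
     else sign (4 * ((\<Sum>v\<leftarrow>xs. eq_ind v 1) - eq_ind (xs ! 0) 1) - real (length xs - 1)))"

lemma halt_detector_Cons:
  "halt_detector (x # xs) = sign (4 * (\<Sum>v\<leftarrow>xs. eq_ind v 1) - real (length xs))"
  by (simp add: halt_detector_def)

lemma sum_list_perm:
  fixes f :: "'a \<Rightarrow> 'b::comm_monoid_add"
  assumes "mset xs = mset ys"
  shows "sum_list (map f xs) = sum_list (map f ys)"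
proof -
  have "sum_mset (mset (map f xs)) = sum_mset (mset (map f ys))" using assms by simp
  then show ?thesis by (simp only: sum_mset_sum_list)
qed

lemma halt_detector_class: "halt_detector \<in> tail_functions (with_sign F)"
proof (cases F)
  case (FAC i B)
  have "tail_symmetric halt_detector"
    unfolding tail_symmetric_def halt_detector_Cons
  proof (intro allI impI)
    fix ys zs assume *: "mset ys = mset (zs :: real list)"
    show "sign (4 * (\<Sum>v\<leftarrow>ys. eq_ind v 1) - real (length ys)) =
        sign (4 * (\<Sum>v\<leftarrow>zs. eq_ind v 1) - real (length zs))"
      unfolding sum_list_perm[OF *] mset_eq_length[OF *] ..
  qed
  moreover have "poly_wire (B \<union> {sign}) m 60 (60 + 0) halt_detector" for m
  proof (cases "m = 0")
    case True
    have "poly_wire (B \<union> {sign}) m 60 (60 + 0) (\<lambda>_. 0)" by (rule poly_wire_const)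
    then show ?thesis by (rule poly_wire_cong) (use True in \<open>auto simp: halt_detector_def\<close>)
  next
    case False
    have e: "poly_wire (B \<union> {sign}) m 20 13 (\<lambda>xs. eq_ind (xs ! i) 1)" if "i < m" for i
      by (rule poly_wire_mono[OF poly_wire_eq_ind[OF poly_wire_input[OF that, of _ 0 0] poly_wire_const]]) simp_all
    from poly_wire_sum_list[where h = "\<lambda>xs v. eq_ind v 1", OF this]
    have "poly_wire (B \<union> {sign}) m 23 15 (\<lambda>xs. \<Sum>v\<leftarrow>xs. eq_ind v 1)"
      by (rule poly_wire_mono) simp_all
    note s = poly_wire_mult[OF poly_wire_const poly_wire_diff[OF this poly_wire_mono[OF e]]]
    have "poly_wire (B \<union> {sign}) m 60 60 (\<lambda>xs. sign (4 * ((\<Sum>v\<leftarrow>xs. eq_ind v 1) - eq_ind (xs ! 0) 1) - real (m - 1)))"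
      by (rule poly_wire_mono[OF poly_wire_fun[OF poly_wire_diff[OF s poly_wire_const]]]) (use False in simp_all)
    then have "poly_wire (B \<union> {sign}) m 60 60 halt_detector"
      by (rule poly_wire_cong) (use False in \<open>auto simp: halt_detector_def\<close>)
    then show ?thesis by simp
  qed
  ultimately show ?thesis
    unfolding FAC add_gates.simps by (rule tail_functionsI) simp
qed

lemma
  assumes "mset xs = mset ys"
  shows rank_perm: "rank xs = rank ys" and ranked_perm: "ranked xs = ranked ys"
    and slot_perm: "slot xs = slot ys"
proof -
  note s = sum_list_perm[OF assms]
  show r: "rank xs = rank ys" unfolding rank_def by (intro ext s)
  show r': "ranked xs = ranked ys" unfolding ranked_def r by (intro ext s)
  show "slot xs = slot ys" unfolding slot_def scale_def r' mset_eq_length[OF assms] ..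
qed

lemma tail_symmetric_layer_fun: "tail_symmetric (layer_fun C)"
  unfolding tail_symmetric_def
proof (intro allI impI)
  fix x ys zs assume "mset ys = mset (zs :: real list)"
  then have p: "mset (x # ys) = mset (x # zs)" by simp
  note eqs = mset_eq_length[OF p] rank_perm[OF p] ranked_perm[OF p] slot_perm[OF p]
  have s: "sum_list (map g (x # ys)) = sum_list (map g (x # zs))" for g :: "real \<Rightarrow> real"
    by (rule sum_list_perm[OF p])
  show "layer_fun C (x # ys) = layer_fun C (x # zs)"
  proof (cases "length (x # ys) = 2")
    case True
    then obtain y where "ys = [y]" by (auto simp: length_Suc_conv numeral_2_eq_2)
    then have "zs = [y]" using \<open>mset ys = mset zs\<close> by simp
    then show ?thesis using \<open>ys = [y]\<close> by simp
  next
    case False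
    then show ?thesis unfolding layer_fun_def eqs s by (simp only: nth_Cons_0 if_False)
  qed
qed

lemma layer_fun_class:
  assumes "C \<in> rec_families (with_sign F) (add_gates F A)"
  shows "layer_fun C \<in> tail_functions (add_gates (with_sign F) A)"
proof (cases F)
  case (FAC i B)
  let ?B = "B \<union> {sign} \<union> A"
  have wf: "\<And>n. wf_rec (C n)" and base: "(\<lambda>n. base (C n)) \<in> ext_families (FAC i (B \<union> A))"
    using assms FAC by (auto simp: rec_families_def)
  obtain H where H: "H \<in> families (FAC i (B \<union> {sign}))"
      "\<And>n. halt_circuit (C n) = H (Suc (length (halt_gates (C n))))"
    using assms FAC by (auto simp: rec_families_def)
  have H': "H \<in> ext_families (FAC i (B \<union> {sign}))" using H(1) by (simp add: families_def)
  obtain c1 where c1: "c1 \<ge> 0"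
      "\<And>n m. n \<le> m \<Longrightarrow> 3 \<le> m \<Longrightarrow> real (depth (base (C n))) \<le> c1 * ln (real m) ^ i"
    using depth_bound[OF base] by blast
  obtain c2 where c2: "c2 \<ge> 0"
      "\<And>n m. n \<le> m \<Longrightarrow> 3 \<le> m \<Longrightarrow> real (depth (H n)) \<le> c2 * ln (real m) ^ i"
    using depth_bound[OF H'] by blast
  define S where "S m = (\<lambda>n. 2 * depth (base (C n)) + 2 * depth (halt_circuit (C n))) `
      {n. n < m \<and> length (enc_rec (C n)) \<le> m}" for m
  have fin: "finite (insert 0 (S m))" for m by (simp add: S_def)
  \<comment> \<open>Inserting 0 keeps the maximum meaningful when no circuit qualifies.\<close>
  define D where "D m = Max (insert 0 (S m))" for m
  have "poly_wire ?B m 170 (130 + D m) (layer_fun C)" for m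
  proof (rule poly_wire_layer_fun[OF wf])
    show "set (fun_tab (base (C n))) \<subseteq> ?B" for n using base by auto
    show "set (fun_tab (halt_circuit (C n))) \<subseteq> ?B" for n using H' H(2) by auto
    fix n assume "n < m" "length (enc_rec (C n)) \<le> m"
    then show "2 * depth (base (C n)) + 2 * depth (halt_circuit (C n)) \<le> D m"
      unfolding D_def by (intro Max_ge fin) (auto simp: S_def)
  qed simp
  moreover have "(\<lambda>m. real (D m)) \<in> O(\<lambda>m. ln (real m) ^ i)"
  proof (rule bigoI)
    show "\<forall>\<^sub>F m in sequentially. norm (real (D m)) \<le> (2 * c1 + 2 * c2) * norm (ln (real m) ^ i)"
      using eventually_ge_at_top[of 3]
    proof eventually_elim
      case (elim m)
      have l: "0 \<le> ln (real m) ^ i" using elim by simp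
      have "D m \<in> insert 0 (S m)" unfolding D_def by (rule Max_in[OF fin]) simp
      then consider "D m = 0" | n where "n < m" "length (enc_rec (C n)) \<le> m"
          "D m = 2 * depth (base (C n)) + 2 * depth (halt_circuit (C n))"
        by (auto simp: S_def)
      then have "real (D m) \<le> (2 * c1 + 2 * c2) * ln (real m) ^ i"
      proof cases
        case 1
        then show ?thesis using c1(1) c2(1) l by simp
      next
        case 2
        have "real (depth (base (C n))) \<le> c1 * ln (real m) ^ i" using c1(2)[of n m] 2 elim by simp
        \<comment> \<open>\<open>H\<close> is indexed by the number of its inputs; every halting
          gate occurs in the code, so this number is at most \<open>m\<close>.\<close>
        moreover have "real (depth (halt_circuit (C n))) \<le> c2 * ln (real m) ^ i"
          unfolding H(2) using length_enc_rec(3)[of "C n"] 2 elim by (intro c2(2)) auto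
        ultimately show ?thesis using 2(3) by (simp add: distrib_right)
      qed
      then show ?case using l by simp
    qed
  qed
  ultimately show ?thesis
    unfolding FAC add_gates.simps by (rule tail_functionsI[OF tail_symmetric_layer_fun])
qed

section \<open>A logspace transducer for the slot graph\<close>

text \<open>Vertex \<open>2 * i + 1\<close> is the data vertex of slot \<open>i\<close>, and \<open>2 * i\<close> is its pendant vertex.\<close>

definition slot_graph :: "nat \<Rightarrow> nat \<Rightarrow> slabel lgraph" where
  "slot_graph n K = \<lparr>labels = concat (map (\<lambda>i. [Num i, if i < n then In_sym i else Num n]) [0..<K]),
     edges = {{u, v} | u v. u < v \<and> v < 2 * K \<and> odd v \<and> (odd u \<or> v = Suc u)}\<rparr>"

text \<open>The machine writes two bits per input position, then the labels, then the adjacency rows. In the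
  last two passes it visits each position \<open>i\<close>; it sweeps from there to the left end, incrementing a
  binary counter, and back again until the counter is zero. Both sweeps take \<open>i\<close> steps, in which
  the numbers and rows of length proportional to \<open>i\<close> are written. The flag of \<open>Rewind\<close>, and the first
  flag of the other binary and ternary states, tells the labels from the adjacency rows; the next one
  says whether the position lies in the leading block of ones.\<close>

datatype control = Start | Done | Count1 | Count2 | Rewind bool | Outer bool bool
  | Label1 bool | Label2 bool | Label3 bool | Sweep_Left bool bool | Sweep_Left2 bool | Increment bool bool | Return_Inc bool bool
  | Prefix bool | Prefix2 | Prefix3 | Prefix4 | Sweep_Right bool bool bool | Decrement bool bool bool | Return_Positive bool bool bool
  | Sweep_Right2 bool | Return_Zero bool bool

primrec code :: "control \<Rightarrow> nat" where
  "code Start = 0"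
| "code Done = 1"
| "code Count1 = 2"
| "code Count2 = 3"
| "code (Rewind a) = 4 + of_bool a"
| "code (Outer a b) = 6 + 2 * of_bool a + of_bool b"
| "code (Label1 a) = 10 + of_bool a"
| "code (Label2 a) = 12 + of_bool a"
| "code (Label3 a) = 14 + of_bool a"
| "code (Sweep_Left a b) = 16 + 2 * of_bool a + of_bool b"
| "code (Sweep_Left2 a) = 20 + of_bool a"
| "code (Increment a b) = 22 + 2 * of_bool a + of_bool b"
| "code (Return_Inc a b) = 26 + 2 * of_bool a + of_bool b"
| "code (Prefix a) = 30 + of_bool a"
| "code Prefix2 = 32"
| "code Prefix3 = 33"
| "code Prefix4 = 34"
| "code (Sweep_Right a b c) = 36 + 4 * of_bool a + 2 * of_bool b + of_bool c"
| "code (Decrement a b c) = 44 + 4 * of_bool a + 2 * of_bool b + of_bool c"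
| "code (Return_Positive a b c) = 52 + 4 * of_bool a + 2 * of_bool b + of_bool c"
| "code (Sweep_Right2 a) = 60 + of_bool a"
| "code (Return_Zero a b) = 62 + 2 * of_bool a + of_bool b"

text \<open>The number 35 is not the code of a state; \<open>Start\<close> fills the gap.\<close>

definition all_control :: "control list" where
  "all_control = (let bs = [False, True]; f2 = (\<lambda>c. concat (map (\<lambda>a. map (c a) bs) bs));
     f3 = (\<lambda>c. concat (map (\<lambda>a. concat (map (\<lambda>b. map (c a b) bs) bs)) bs)) in
   [Start, Done, Count1, Count2] @ map Rewind bs @ f2 Outer @ map Label1 bs @ map Label2 bs @
   map Label3 bs @ f2 Sweep_Left @ map Sweep_Left2 bs @ f2 Increment @ f2 Return_Inc @ map Prefix bs @ [Prefix2, Prefix3, Prefix4, Start] @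
   f3 Sweep_Right @ f3 Decrement @ f3 Return_Positive @ map Sweep_Right2 bs @ f2 Return_Zero)"

lemma all_control_code: "all_control ! code s = s"
  by (cases s) (auto simp: all_control_def Let_def of_bool_def)

lemma code_less: "code s < 66"
  by (cases s) (auto simp: of_bool_def)

lemma code_eq_1: "code s = Suc 0 \<longleftrightarrow> s = Done"
  by (cases s) (auto simp: of_bool_def)

fun transition :: "control \<Rightarrow> in_symbol \<Rightarrow> nat \<Rightarrow> control \<times> move \<times> nat \<times> move \<times> bool option" where
  "transition Start a w = (Count1, Go_Right, 3, Stay, None)"
| "transition Done a w = (Done, Stay, w, Stay, None)"
| "transition Count1 a w = (case a of Bit b \<Rightarrow> (Count2, Stay, w, Stay, Some True)
     | _ \<Rightarrow> (Rewind True, Stay, w, Stay, Some False))"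
| "transition Count2 a w = (Count1, Go_Right, w, Stay, Some True)"
| "transition (Rewind z) a w = (if a = Left_End then (Outer z True, Go_Right, w, Stay, None)
     else (Rewind z, Go_Left, w, Stay, None))"
| "transition (Outer z fl) a w = (case a of
       Bit b \<Rightarrow> if z then (Label1 (fl \<and> b), Stay, w, Stay, Some True)
         else (Sweep_Left False (fl \<and> b), Go_Left, w, Stay, None)
     | _ \<Rightarrow> (if z then Rewind False else Done, Stay, w, Stay, None))"
| "transition (Label1 fl) a w = (Label2 fl, Stay, w, Stay, Some True)"
| "transition (Label2 fl) a w = (Label3 fl, Stay, w, Stay, Some True)"
| "transition (Label3 fl) a w = (Sweep_Left True fl, Go_Left, w, Stay, Some False)"
| "transition (Sweep_Left z fl) a w = (if a = Left_End
     then if z then (Prefix fl, Stay, w, Stay, Some False) else (Sweep_Right False fl True, Go_Right, w, Stay, None)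
     else if z then (Increment True fl, Stay, w, Go_Right, Some True) else (Sweep_Left2 fl, Stay, w, Stay, Some False))"
| "transition (Sweep_Left2 fl) a w = (Increment False fl, Stay, w, Go_Right, Some False)"
| "transition (Increment z fl) a w = (if w = 2 then (Increment z fl, Stay, 1, Go_Right, None)
     else (Return_Inc z fl, Stay, 2, Go_Left, None))"
| "transition (Return_Inc z fl) a w = (if w = 3 then (Sweep_Left z fl, Go_Left, w, Stay, None)
     else (Return_Inc z fl, Stay, w, Go_Left, None))"
| "transition (Prefix fl) a w = (if fl then (Sweep_Right True True True, Go_Right, w, Stay, Some False)
     else (Prefix2, Stay, w, Stay, Some True))"
| "transition Prefix2 a w = (Prefix3, Stay, w, Stay, Some True)"
| "transition Prefix3 a w = (Prefix4, Stay, w, Stay, Some True)"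
| "transition Prefix4 a w = (Sweep_Right True False True, Go_Right, w, Stay, Some False)"
| "transition (Sweep_Right z fl g) a w = (Decrement z fl g, Stay, w, Go_Right, None)"
| "transition (Decrement z fl g) a w = (if w = 1 then (Decrement z fl g, Stay, 2, Go_Right, None)
     else if w = 2 then (Return_Positive z fl g, Stay, 1, Go_Left, None)
     else (Return_Zero z fl, Stay, w, Go_Left, None))"
| "transition (Return_Positive z fl g) a w = (if w \<noteq> 3 then (Return_Positive z fl g, Stay, w, Go_Left, None)
     else if z then (Sweep_Right True fl (g \<and> a = Bit True), Go_Right, w, Stay,
       if g \<and> a = Bit True then Some True else None)
     else (Sweep_Right2 fl, Stay, w, Stay, Some False))"
| "transition (Sweep_Right2 fl) a w = (Sweep_Right False fl True, Go_Right, w, Stay, Some True)"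
| "transition (Return_Zero z fl) a w = (if w = 3 then (Outer z fl, Go_Right, w, Stay, Some (\<not> z))
     else (Return_Zero z fl, Stay, 1, Go_Left, None))"

definition machine :: transducer where
  "machine = \<lparr>tapes = 1, symbols = 4, states = 66,
     trans = \<lambda>q a ws. (case transition (all_control ! q) a (hd ws) of
       (s, m, w, d, b) \<Rightarrow> (code s, m, [(w, d)], b))\<rparr>"

lemma transition_symbol: "transition s a w = (s', m, w', d, b) \<Longrightarrow> w < 4 \<Longrightarrow> w' < 4"
  by (cases s) (auto split: if_splits in_symbol.splits)

lemma wf_machine: "wf_transducer machine"
  unfolding wf_transducer_def
proof (intro conjI allI impI)
  fix q a ws assume ws: "length ws = tapes machine" "set ws \<subseteq> {..<symbols machine}"
  then obtain w where w: "ws = [w]" "w < 4" by (auto simp: machine_def length_Suc_conv)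
  obtain s m w' d b where t: "transition (all_control ! q) a w = (s, m, w', d, b)" by (metis prod_cases5)
  then have "w' < 4" using transition_symbol w(2) by blast
  then show "case trans machine q a ws of (q', m, as, b) \<Rightarrow> q' < states machine \<and>
      length as = tapes machine \<and> fst ` set as \<subseteq> {..<symbols machine}"
    using w t code_less by (simp add: machine_def)
qed (auto simp: machine_def)

text \<open>Symbol 3 marks cell 0; the bits 0 and 1 are written as 1 and 2, least significant bit first.\<close>

definition tape :: "bool list \<Rightarrow> nat \<Rightarrow> nat" where
  "tape bs i = (if i = 0 then 3 else if i \<le> length bs then if bs ! (i - 1) then 2 else 1 else 0)"

lemma tape_0 [simp]: "tape bs 0 = 3"
  by (simp add: tape_def)

lemma tape_append_Cons: "tape (pre @ b # bs) (Suc (length pre)) = (if b then 2 else 1)"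
  by (simp add: tape_def)

lemma tape_end: "tape bs (Suc (length bs)) = 0"
  by (simp add: tape_def)

lemma tape_3_iff: "tape bs i = 3 \<longleftrightarrow> i = 0"
  by (simp add: tape_def)

lemma tape_upd:
  "(tape (pre @ b # bs))(Suc (length pre) := Suc 0) = tape (pre @ False # bs)"
  "(tape (pre @ b # bs))(Suc (length pre) := 2) = tape (pre @ True # bs)"
  by (auto simp: tape_def nth_append nth_Cons' fun_eq_iff split: if_splits)

lemma tape_upd_same:
  "(tape bs)(0 := 3) = tape bs" "(tape bs)(Suc (length bs) := 0) = tape bs"
  by (auto simp: tape_def fun_eq_iff)

lemma tape_upd_end: "(tape bs)(Suc (length bs) := 2) = tape (bs @ [True])"
  by (auto simp: tape_def nth_append fun_eq_iff le_Suc_eq)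

section \<open>Symbolic execution of the machine\<close>

definition cfg :: "control \<Rightarrow> nat \<Rightarrow> (nat \<Rightarrow> nat) \<Rightarrow> nat \<Rightarrow> bool list \<Rightarrow> config" where
  "cfg s p t h out = \<lparr>state = code s, in_head = p, work = [(t, h)], written = out\<rparr>"

lemma step_cfg:
  assumes "transition s (in_symbol_at x p) (t h) = (s', m, w, d, b)" "s \<noteq> Done"
  shows "step machine x (cfg s p t h out) =
    cfg s' (min (length x + 1) (move_head m p)) (t(h := w)) (move_head d h)
      (out @ (case b of None \<Rightarrow> [] | Some y \<Rightarrow> [y]))"
  using assms by (simp add: step_def cfg_def machine_def all_control_code code_eq_1)

text \<open>The logarithmic space bound in exponential form, which keeps logarithms out of the
  execution.\<close>

definition heads_low :: "bool list \<Rightarrow> config \<Rightarrow> bool" where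
  "heads_low x c \<longleftrightarrow> (\<forall>(t, h) \<in> set (work c). 2 ^ h \<le> 4 * (length x + 1))"

definition reach :: "bool list \<Rightarrow> config \<Rightarrow> config \<Rightarrow> bool" where
  "reach x = (\<lambda>c c'. c' = step machine x c \<and> heads_low x c')\<^sup>*\<^sup>*"

lemma reach_refl: "reach x c c"
  by (simp add: reach_def)

lemma reach_trans: "reach x a b \<Longrightarrow> reach x b c \<Longrightarrow> reach x a c"
  unfolding reach_def by (rule rtranclp_trans)

text \<open>Applied backwards this executes one step: simplification computes the successor
  configuration and leaves the rest of the run as a goal.\<close>

lemma reach_step:
  assumes "s \<noteq> Done"
    "case transition s (in_symbol_at x p) (t h) of (s', m, w, d, b) \<Rightarrow>
      2 ^ move_head d h \<le> 4 * (length x + 1) \<and>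
      reach x (cfg s' (min (length x + 1) (move_head m p)) (t(h := w)) (move_head d h)
        (out @ (case b of None \<Rightarrow> [] | Some y \<Rightarrow> [y]))) c"
  shows "reach x (cfg s p t h out) c"
proof -
  obtain s' m w d b where t: "transition s (in_symbol_at x p) (t h) = (s', m, w, d, b)"
    by (metis prod_cases5)
  note step = step_cfg[where t = t and h = h, OF t assms(1)]
  have "heads_low x (step machine x (cfg s p t h out))"
    unfolding step using assms(2) t by (simp add: heads_low_def cfg_def)
  moreover have "reach x (step machine x (cfg s p t h out)) c"
    unfolding step using assms(2) t by simp
  ultimately have "(\<lambda>c c'. c' = step machine x c \<and> heads_low x c') (cfg s p t h out)
      (step machine x (cfg s p t h out))" "reach x (step machine x (cfg s p t h out)) c"
    by simp_all
  then show ?thesis unfolding reach_def by (rule converse_rtranclp_into_rtranclp)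
qed

section \<open>The binary counter on the work tape\<close>

primrec counter_value :: "bool list \<Rightarrow> nat" where
  "counter_value [] = 0"
| "counter_value (b # bs) = of_bool b + 2 * counter_value bs"

fun increment :: "bool list \<Rightarrow> bool list" where
  "increment [] = [True]"
| "increment (False # bs) = True # bs"
| "increment (True # bs) = False # increment bs"

fun decrement :: "bool list \<Rightarrow> bool list option" where
  "decrement [] = None"
| "decrement (True # bs) = Some (False # bs)"
| "decrement (False # bs) = map_option ((#) True) (decrement bs)"

lemma counter_value_increment: "counter_value (increment bs) = Suc (counter_value bs)"
  by (induction bs rule: increment.induct) auto

text \<open>The counter grows only if all digits are ones, and then the new value is a power of two.
  So \<open>2 ^ length\<close> never exceeds twice the largest value reached, up to the empty
  counter.\<close>

lemma length_increment: "length (increment bs) = length bs \<or> 2 ^ length (increment bs) = 2 * counter_value (increment bs)"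
  by (induction bs rule: increment.induct) simp_all

lemma decrement_Some: "counter_value bs = Suc v \<Longrightarrow> \<exists>bs'. decrement bs = Some bs' \<and> counter_value bs' = v \<and> length bs' = length bs"
proof (induction bs arbitrary: v rule: decrement.induct)
  case (3 bs)
  then obtain v' where v': "counter_value bs = Suc v'" by (cases "counter_value bs") auto
  then have "v = Suc (2 * v')" using 3(2) by simp
  then show ?case using 3(1)[OF v'] by auto
qed auto

lemma counter_value_replicate_False: "counter_value (replicate k False) = 0"
  by (induction k) auto

text \<open>The bound is on the number of digits, not on the value, because decrements keep leading
  zeros. \<open>heads_low\<close> allows twice as much, since the head also visits the cell after
  the last digit.\<close>

definition fits :: "bool list \<Rightarrow> bool list \<Rightarrow> bool" where
  "fits x bs \<longleftrightarrow> 2 ^ length bs \<le> 2 * (length x + 1)"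

lemma fits_heads_low:
  assumes "fits x bs" "h \<le> Suc (length bs)"
  shows "2 ^ h \<le> 4 * (length x + 1)"
proof -
  have "(2::nat) ^ h \<le> 2 ^ Suc (length bs)" by (rule power_increasing) (use assms in auto)
  then show ?thesis using assms(1) by (simp add: fits_def)
qed

lemma run_Return_Inc:
  assumes "fits x bs" "h \<le> length bs" "p \<le> Suc (length x)"
  shows "reach x (cfg (Return_Inc z fl) p (tape bs) h out) (cfg (Sweep_Left z fl) (p - 1) (tape bs) 0 out)"
  using assms(2)
proof (induction h)
  case 0
  show ?case
    by (rule reach_step)
      (use assms(1,3) reach_refl in \<open>simp_all add: fits_heads_low min_absorb2 tape_upd_same\<close>)
next
  case (Suc h)
  show ?case
    by (rule reach_step)
      (use Suc assms(3) fits_heads_low[OF assms(1)] in \<open>simp_all add: tape_3_iff min_absorb2\<close>)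
qed

lemma run_Increment:
  assumes "fits x (pre @ bs)" "fits x (pre @ increment bs)" "p \<le> Suc (length x)"
  shows "reach x (cfg (Increment z fl) p (tape (pre @ bs)) (Suc (length pre)) out)
    (cfg (Sweep_Left z fl) (p - 1) (tape (pre @ increment bs)) 0 out)"
  using assms(1,2)
proof (induction bs arbitrary: pre rule: increment.induct)
  case 1
  have "reach x (cfg (Return_Inc z fl) p (tape (pre @ [True])) (length pre) out)
      (cfg (Sweep_Left z fl) (p - 1) (tape (pre @ [True])) 0 out)"
    by (rule run_Return_Inc) (use 1 assms(3) in auto)
  then show ?case
    by (intro reach_step)
      (use 1 assms(3) fits_heads_low[OF 1(1)] in \<open>simp_all add: tape_end tape_upd_end min_absorb2\<close>)
next
  case (2 bs)
  have "reach x (cfg (Return_Inc z fl) p (tape (pre @ True # bs)) (length pre) out)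
      (cfg (Sweep_Left z fl) (p - 1) (tape (pre @ True # bs)) 0 out)"
    by (rule run_Return_Inc) (use 2 assms(3) in auto)
  then show ?case
    by (intro reach_step)
      (use 2 assms(3) fits_heads_low[OF 2(1)] in \<open>simp_all add: tape_append_Cons tape_upd min_absorb2\<close>)
next
  case (3 bs)
  have w: "fits x ((pre @ [False]) @ bs)" using 3(2) by (simp add: fits_def)
  have "reach x (cfg (Increment z fl) p (tape ((pre @ [False]) @ bs)) (Suc (length (pre @ [False]))) out)
      (cfg (Sweep_Left z fl) (p - 1) (tape ((pre @ [False]) @ increment bs)) 0 out)"
    by (rule 3(1)[OF w]) (use 3(3) in simp)
  then show ?case
    by (intro reach_step)
      (use 3 assms(3) fits_heads_low[OF 3(2), of "Suc (Suc (length pre))"] in \<open>simp_all add: tape_append_Cons tape_upd min_absorb2\<close>)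
qed

lemma run_Return_Positive:
  assumes "fits x bs" "h \<le> length bs" "p \<le> Suc (length x)"
  shows "reach x (cfg (Return_Positive z fl g) p (tape bs) h out) (cfg (Return_Positive z fl g) p (tape bs) 0 out)"
  using assms(2)
proof (induction h)
  case 0
  show ?case by (rule reach_refl)
next
  case (Suc h)
  show ?case
    by (rule reach_step)
      (use Suc assms(3) fits_heads_low[OF assms(1)] in \<open>simp_all add: tape_3_iff min_absorb2\<close>)
qed

lemma run_Decrement_Some:
  assumes "fits x (pre @ bs)" "decrement bs = Some bs'" "p \<le> Suc (length x)"
  shows "reach x (cfg (Decrement z fl g) p (tape (pre @ bs)) (Suc (length pre)) out)
    (cfg (Return_Positive z fl g) p (tape (pre @ bs')) 0 out)"
  using assms(1,2)
proof (induction bs arbitrary: pre bs' rule: decrement.induct)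
  case (2 bs)
  have "reach x (cfg (Return_Positive z fl g) p (tape (pre @ False # bs)) (length pre) out)
      (cfg (Return_Positive z fl g) p (tape (pre @ False # bs)) 0 out)"
    by (rule run_Return_Positive) (use 2 assms(3) in \<open>auto simp: fits_def\<close>)
  then show ?case
    by (intro reach_step)
      (use 2 assms(3) fits_heads_low[OF 2(1)] in \<open>simp_all add: tape_append_Cons tape_upd min_absorb2\<close>)
next
  case (3 bs)
  then obtain bs'' where b: "decrement bs = Some bs''" "bs' = True # bs''" by auto
  have w: "fits x ((pre @ [True]) @ bs)" using 3(2) by (simp add: fits_def)
  have "reach x (cfg (Decrement z fl g) p (tape ((pre @ [True]) @ bs)) (Suc (length (pre @ [True]))) out)
      (cfg (Return_Positive z fl g) p (tape ((pre @ [True]) @ bs'')) 0 out)"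
    by (rule 3(1)[OF w b(1)])
  then show ?case
    by (intro reach_step)
      (use 3 b assms(3) fits_heads_low[OF 3(2), of "Suc (Suc (length pre))"] in \<open>simp_all add: tape_append_Cons tape_upd min_absorb2\<close>)
qed auto

text \<open>Decrementing zero borrows through all digits and leaves ones behind; the way back resets
  them, so the counter is zero again for the next position.\<close>

lemma run_Return_Zero:
  assumes "fits x (replicate (h + k) False)" "p \<le> Suc (length x)"
  shows "reach x (cfg (Return_Zero z fl) p (tape (replicate h True @ replicate k False)) h out)
    (cfg (Return_Zero z fl) p (tape (replicate (h + k) False)) 0 out)"
  using assms(1)
proof (induction h arbitrary: k)
  case 0
  show ?case by (simp add: reach_refl)
next
  case (Suc h)
  have t: "tape (replicate (Suc h) True @ replicate k False) =
      tape (replicate h True @ True # replicate k False)"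
    by (simp only: replicate_Suc replicate_append_same[symmetric] append_assoc append_Cons append_Nil)
  have l: "2 ^ h \<le> 4 * (length x + 1)" by (rule fits_heads_low[OF Suc.prems]) simp
  have "reach x (cfg (Return_Zero z fl) p (tape (replicate h True @ replicate (Suc k) False)) h out)
    (cfg (Return_Zero z fl) p (tape (replicate (h + Suc k) False)) 0 out)"
    by (rule Suc.IH) (use Suc.prems in simp)
  then show ?case unfolding t
    by (intro reach_step)
      (use l assms(2) tape_append_Cons[of "replicate h True"] tape_upd[of "replicate h True"]
        in \<open>simp_all add: min_absorb2\<close>)
qed

lemma run_Decrement_None:
  assumes "fits x (replicate k True @ bs)" "counter_value bs = 0" "p \<le> Suc (length x)"
  shows "reach x (cfg (Decrement z fl g) p (tape (replicate k True @ bs)) (Suc k) out)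
    (cfg (Return_Zero z fl) p (tape (replicate (k + length bs) False)) 0 out)"
  using assms(1,2)
proof (induction bs arbitrary: k)
  case Nil
  have "reach x (cfg (Return_Zero z fl) p (tape (replicate k True @ replicate 0 False)) k out)
    (cfg (Return_Zero z fl) p (tape (replicate (k + 0) False)) 0 out)"
    by (rule run_Return_Zero) (use Nil assms(3) in \<open>auto simp: fits_def\<close>)
  then show ?case
    by (intro reach_step)
      (use assms(3) fits_heads_low[OF Nil(1)] tape_end[of "replicate k True"]
        in \<open>simp_all add: min_absorb2 tape_upd_same[of "replicate k True", simplified]\<close>)
next
  case (Cons b bs)
  have b: "\<not> b" "counter_value bs = 0" using Cons.prems by auto
  have t: "tape (replicate k True @ True # bs) = tape (replicate (Suc k) True @ bs)"
    by (simp only: replicate_Suc replicate_append_same[symmetric] append_assoc append_Cons append_Nil)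
  have "reach x (cfg (Decrement z fl g) p (tape (replicate (Suc k) True @ bs)) (Suc (Suc k)) out)
    (cfg (Return_Zero z fl) p (tape (replicate (Suc k + length bs) False)) 0 out)"
    by (rule Cons.IH) (use Cons.prems in \<open>auto simp: fits_def\<close>)
  then show ?case
    by (intro reach_step)
      (use b assms(3) fits_heads_low[OF Cons.prems(1), of "Suc (Suc k)"] tape_append_Cons[of "replicate k True"]
         tape_upd[of "replicate k True"] t in \<open>simp_all add: min_absorb2\<close>)
qed

text \<open>The digits are abstracted away. Equal values may be stored with different numbers of
  leading zeros, so only the value and \<open>fits\<close> are passed from one phase to the
  next.\<close>

definition reach_counter :: "bool list \<Rightarrow> control \<Rightarrow> nat \<Rightarrow> nat \<Rightarrow> bool list \<Rightarrow> control \<Rightarrow> nat \<Rightarrow> nat \<Rightarrow> bool list \<Rightarrow> bool" where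
  "reach_counter x s p v out s' p' v' out' \<longleftrightarrow> (\<forall>bs. counter_value bs = v \<longrightarrow> fits x bs \<longrightarrow>
     (\<exists>bs'. counter_value bs' = v' \<and> fits x bs' \<and>
        reach x (cfg s p (tape bs) 0 out) (cfg s' p' (tape bs') 0 out')))"

lemma reach_counter_refl: "out = out' \<Longrightarrow> reach_counter x s p v out s p v out'"
  unfolding reach_counter_def using reach_refl by blast

lemma reach_counter_trans:
  assumes "reach_counter x s p v out s' p' v' out'" "reach_counter x s' p' v' out' s'' p'' v'' out''"
  shows "reach_counter x s p v out s'' p'' v'' out''"
  unfolding reach_counter_def
proof (intro allI impI)
  fix bs assume "counter_value bs = v" "fits x bs"
  then obtain bs' where 1: "counter_value bs' = v'" "fits x bs'"
      "reach x (cfg s p (tape bs) 0 out) (cfg s' p' (tape bs') 0 out')"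
    using assms(1) unfolding reach_counter_def by blast
  then obtain bs'' where 2: "counter_value bs'' = v''" "fits x bs''"
      "reach x (cfg s' p' (tape bs') 0 out') (cfg s'' p'' (tape bs'') 0 out'')"
    using assms(2) unfolding reach_counter_def by blast
  show "\<exists>bs'. counter_value bs' = v'' \<and> fits x bs' \<and>
      reach x (cfg s p (tape bs) 0 out) (cfg s'' p'' (tape bs') 0 out'')"
    using 2(1,2) reach_trans[OF 1(3) 2(3)] by blast
qed

text \<open>For steps taken with the work head resting on the marker 3 of cell 0, which leave the
  counter alone.\<close>

lemma reach_counter_step:
  assumes "s \<noteq> Done"
    "case transition s (in_symbol_at x p) 3 of (s1, m, w, d, b) \<Rightarrow> w = 3 \<and> d = Stay \<and>
      reach_counter x s1 (min (length x + 1) (move_head m p)) v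
        (out @ (case b of None \<Rightarrow> [] | Some y \<Rightarrow> [y])) s' p' v' out'"
  shows "reach_counter x s p v out s' p' v' out'"
  unfolding reach_counter_def
proof (intro allI impI)
  fix bs assume bs: "counter_value bs = v" "fits x bs"
  obtain s1 m w d b where t: "transition s (in_symbol_at x p) 3 = (s1, m, w, d, b)"
    by (metis prod_cases5)
  obtain bs' where "counter_value bs' = v'" "fits x bs'"
      "reach x (cfg s1 (min (length x + 1) (move_head m p)) (tape bs) 0
        (out @ (case b of None \<Rightarrow> [] | Some y \<Rightarrow> [y]))) (cfg s' p' (tape bs') 0 out')"
    using assms(2) bs t unfolding reach_counter_def by auto
  moreover from this have "reach x (cfg s p (tape bs) 0 out) (cfg s' p' (tape bs') 0 out')"
    by (intro reach_step assms(1)) (use assms(2) t in \<open>simp add: tape_upd_same\<close>)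
  ultimately show "\<exists>bs'. counter_value bs' = v' \<and> fits x bs' \<and>
      reach x (cfg s p (tape bs) 0 out) (cfg s' p' (tape bs') 0 out')" by blast
qed

lemma in_symbol_at_simps [simp]:
  "in_symbol_at x 0 = Left_End" "i < length x \<Longrightarrow> in_symbol_at x (Suc i) = Bit (x ! i)"
  "in_symbol_at x (Suc (length x)) = Right_End"
  by (simp_all add: in_symbol_at_def)

section \<open>The sweeps and passes of the machine\<close>

lemma sweep_left_1:
  assumes "i < length x" "v < length x"
  shows "reach_counter x (Sweep_Left z fl) (Suc i) v out (Sweep_Left z fl) i (Suc v) (out @ (if z then [True] else [False, False]))"
  unfolding reach_counter_def
proof (intro allI impI)
  fix bs assume bs: "counter_value bs = v" "fits x bs"
  have w: "fits x (increment bs)"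
    using length_increment[of bs] bs assms(2) by (auto simp: fits_def counter_value_increment)
  have increment: "reach x (cfg (Increment z fl) (Suc i) (tape bs) (Suc 0) out') (cfg (Sweep_Left z fl) i (tape (increment bs)) 0 out')"
    for out' using run_Increment[of x "[]" bs "Suc i"] bs w assms by simp
  have "reach x (cfg (Sweep_Left z fl) (Suc i) (tape bs) 0 out)
      (cfg (Sweep_Left z fl) i (tape (increment bs)) 0 (out @ (if z then [True] else [False, False])))"
  proof (cases z)
    case True
    then show ?thesis
      by (intro reach_step) (use assms increment in \<open>simp_all add: tape_upd_same min_absorb2\<close>)
  next
    case False
    have "reach x (cfg (Sweep_Left2 fl) (Suc i) (tape bs) 0 (out @ [False]))
        (cfg (Sweep_Left z fl) i (tape (increment bs)) 0 (out @ [False, False]))"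
      by (intro reach_step) (use assms increment[of "out @ [False, False]"] False in \<open>simp_all add: tape_upd_same min_absorb2\<close>)
    then show ?thesis using False
      by (intro reach_step[of "Sweep_Left z fl"]) (use assms in \<open>simp_all add: tape_upd_same min_absorb2\<close>)
  qed
  then show "\<exists>bs'. counter_value bs' = Suc v \<and> fits x bs' \<and> reach x (cfg (Sweep_Left z fl) (Suc i) (tape bs) 0 out)
      (cfg (Sweep_Left z fl) i (tape bs') 0 (out @ (if z then [True] else [False, False])))"
    using w bs counter_value_increment by blast
qed

text \<open>The single input head gives up its position when it moves to the left end. Counting the
  steps saves that position, and each step also writes one piece of output.\<close>

lemma sweep_left:
  assumes "i \<le> length x" "v + i \<le> length x"
  shows "reach_counter x (Sweep_Left z fl) i v out (Sweep_Left z fl) 0 (v + i)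
    (out @ concat (replicate i (if z then [True] else [False, False])))"
  using assms
proof (induction i arbitrary: v out)
  case (Suc i)
  show ?case
    by (rule reach_counter_trans[OF sweep_left_1])
      (use Suc.prems Suc.IH[of "Suc v" "out @ (if z then [True] else [False, False])"] in auto)
qed (simp add: reach_counter_refl)

lemma run_Sweep_Right_Suc:
  assumes "i < length x"
  shows "reach_counter x (Sweep_Right z fl g) (Suc i) (Suc v) out (Sweep_Right z fl (if z then g \<and> x ! i else True)) (Suc (Suc i)) v
    (out @ (if z then if g \<and> x ! i then [True] else [] else [False, True]))"
  unfolding reach_counter_def
proof (intro allI impI)
  fix bs assume bs: "counter_value bs = Suc v" "fits x bs"
  obtain bs' where bs': "decrement bs = Some bs'" "counter_value bs' = v" "length bs' = length bs"
    using decrement_Some[OF bs(1)] by blast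
  have decrement: "reach x (cfg (Decrement z fl g) (Suc i) (tape bs) (Suc 0) out)
      (cfg (Return_Positive z fl g) (Suc i) (tape bs') 0 out)"
    using run_Decrement_Some[of x "[]" bs bs' "Suc i"] bs bs' assms by simp
  have l: "2 \<le> 4 * (length x + 1)" by simp
  let ?c = "cfg (Sweep_Right z fl (if z then g \<and> x ! i else True)) (Suc (Suc i)) (tape bs') 0
    (out @ (if z then if g \<and> x ! i then [True] else [] else [False, True]))"
  have "reach x (cfg (Sweep_Right2 fl) (Suc i) (tape bs') 0 (out @ [False]))
      (cfg (Sweep_Right False fl True) (Suc (Suc i)) (tape bs') 0 (out @ [False, True]))"
    by (intro reach_step) (use assms reach_refl in \<open>simp_all add: tape_upd_same min_absorb2\<close>)
  then have "reach x (cfg (Return_Positive z fl g) (Suc i) (tape bs') 0 out) ?c"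
    by (intro reach_step) (use assms reach_refl in \<open>auto simp: tape_upd_same min_absorb2\<close>)
  note reach_trans[OF decrement this]
  then have "reach x (cfg (Sweep_Right z fl g) (Suc i) (tape bs) 0 out) ?c"
    by (intro reach_step[of "Sweep_Right z fl g"]) (use assms l in \<open>simp_all add: tape_upd_same min_absorb2\<close>)
  moreover have "fits x bs'" using bs bs' by (simp add: fits_def)
  ultimately show "\<exists>bs'. counter_value bs' = v \<and> fits x bs' \<and> reach x (cfg (Sweep_Right z fl g) (Suc i) (tape bs) 0 out)
      (cfg (Sweep_Right z fl (if z then g \<and> x ! i else True)) (Suc (Suc i)) (tape bs') 0
        (out @ (if z then if g \<and> x ! i then [True] else [] else [False, True])))"
    using bs' by blast
qed

lemma run_Sweep_Right_0:
  assumes "p \<le> length x"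
  shows "reach_counter x (Sweep_Right z fl g) p 0 out (Outer z fl) (Suc p) 0 (out @ [\<not> z])"
  unfolding reach_counter_def
proof (intro allI impI)
  fix bs assume bs: "counter_value bs = 0" "fits x bs"
  let ?z = "replicate (length bs) False"
  have decrement: "reach x (cfg (Decrement z fl g) p (tape bs) (Suc 0) out) (cfg (Return_Zero z fl) p (tape ?z) 0 out)"
    using run_Decrement_None[of x 0 bs p] bs assms by simp
  have l: "2 \<le> 4 * (length x + 1)" by simp
  have "reach x (cfg (Return_Zero z fl) p (tape ?z) 0 out) (cfg (Outer z fl) (Suc p) (tape ?z) 0 (out @ [\<not> z]))"
    by (intro reach_step) (use assms reach_refl in \<open>simp_all add: tape_upd_same min_absorb2\<close>)
  note reach_trans[OF decrement this]
  then have "reach x (cfg (Sweep_Right z fl g) p (tape bs) 0 out) (cfg (Outer z fl) (Suc p) (tape ?z) 0 (out @ [\<not> z]))"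
    by (intro reach_step[of "Sweep_Right z fl g"]) (use assms l in \<open>simp_all add: tape_upd_same min_absorb2\<close>)
  moreover have "fits x ?z" using bs by (simp add: fits_def)
  ultimately show "\<exists>bs'. counter_value bs' = 0 \<and> fits x bs' \<and> reach x (cfg (Sweep_Right z fl g) p (tape bs) 0 out)
      (cfg (Outer z fl) (Suc p) (tape bs') 0 (out @ [\<not> z]))"
    using counter_value_replicate_False by blast
qed

definition block :: "bool list \<Rightarrow> nat" where
  "block x = length (takeWhile id x)"

lemma block_step: "i < length x \<Longrightarrow> i \<le> block x \<and> x ! i \<longleftrightarrow> Suc i \<le> block x"
  unfolding block_def
proof (induction x arbitrary: i)
  case (Cons b x)
  then show ?case by (cases i) auto
qed simp

text \<open>Over a whole sweep from the left end to position \<open>i\<close>, one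
  \<open>True\<close> is written per position inside the leading block, that is
  \<open>min n i\<close> of them. This is the right unary number in both cases: \<open>i\<close> for
  \<open>In_sym i\<close> if \<open>i < n\<close>, and \<open>n\<close> for \<open>Num n\<close>
  otherwise.\<close>

lemma sweep_right_labels:
  assumes "i + v < length x"
  shows "reach_counter x (Sweep_Right True fl (i \<le> block x)) (Suc i) v out (Outer True fl) (i + v + 2) 0
    (out @ replicate (min (block x) (i + v) - min (block x) i) True @ [False])"
  using assms
proof (induction v arbitrary: i out)
  case 0
  show ?case using run_Sweep_Right_0[of "Suc i" x True fl] 0 by simp
next
  case (Suc v)
  have "out @ (if Suc i \<le> block x then [True] else []) @
      replicate (min (block x) (Suc i + v) - min (block x) (Suc i)) True @ [False] =
      out @ replicate (min (block x) (i + Suc v) - min (block x) i) True @ [False]"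
  proof (cases "Suc i \<le> block x")
    case True
    then have "min (block x) (i + Suc v) - min (block x) i =
        Suc (min (block x) (Suc i + v) - min (block x) (Suc i))" by (auto simp: min_def)
    then show ?thesis using True by simp
  qed simp
  note eq = this
  have s1: "reach_counter x (Sweep_Right True fl (i \<le> block x)) (Suc i) (Suc v) out (Sweep_Right True fl (Suc i \<le> block x))
      (Suc (Suc i)) v (out @ (if Suc i \<le> block x then [True] else []))"
    using run_Sweep_Right_Suc[of i x True fl "i \<le> block x" v out] block_step[of i x] Suc.prems
      by simp
  have s2: "reach_counter x (Sweep_Right True fl (Suc i \<le> block x)) (Suc (Suc i)) v
      (out @ (if Suc i \<le> block x then [True] else [])) (Outer True fl) (Suc i + v + 2) 0
      (out @ (if Suc i \<le> block x then [True] else []) @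
        replicate (min (block x) (Suc i + v) - min (block x) (Suc i)) True @ [False])"
    using Suc.IH[of "Suc i" "out @ (if Suc i \<le> block x then [True] else [])"] Suc.prems by simp
  show ?case
    using reach_counter_trans[OF s1 s2] unfolding eq by simp
qed

lemma sweep_right_adj:
  assumes "i + v < length x"
  shows "reach_counter x (Sweep_Right False fl True) (Suc i) v out (Outer False fl) (i + v + 2) 0
    (out @ concat (replicate v [False, True]) @ [True])"
  using assms
proof (induction v arbitrary: i out)
  case 0
  show ?case using run_Sweep_Right_0[of "Suc i" x False fl] 0 by simp
next
  case (Suc v)
  show ?case
    by (rule reach_counter_trans[OF run_Sweep_Right_Suc])
      (use Suc.prems Suc.IH[of "Suc i" "out @ [False, True]"] in simp_all)
qed

definition slot_label :: "nat \<Rightarrow> nat \<Rightarrow> slabel" where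
  "slot_label n i = (if i < n then In_sym i else Num n)"

lemma concat_replicate_single: "concat (replicate i [a]) = replicate i a"
  by (induction i) auto

lemma outer_labels_1:
  assumes "i < length x"
  shows "reach_counter x (Outer True (i \<le> block x)) (Suc i) 0 out (Outer True (Suc i \<le> block x)) (Suc (Suc i)) 0
    (out @ enc_slabel (Num i) @ enc_slabel (slot_label (block x) i))"
proof -
  let ?f = "Suc i \<le> block x"
  \<comment> \<open>The first \<open>False\<close> ends the number of the pendant label. The tag of
    the second label follows: 0 for \<open>In_sym\<close>, 3 for \<open>Num\<close>, both in
    unary.\<close>
  have pre: "reach_counter x (Sweep_Left True ?f) 0 i out' (Sweep_Right True ?f True) 1 i
      (out' @ [False] @ (if ?f then [False] else [True, True, True, False]))" for out'
    by (cases ?f) (intro reach_counter_step; simp add: min_absorb2 reach_counter_refl; intro reach_counter_step;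
      simp add: reach_counter_refl; intro reach_counter_step; simp add: reach_counter_refl;
      intro reach_counter_step; simp add: reach_counter_refl)+
  have out: "(((((out @ [True]) @ [True]) @ [True]) @ [False]) @ concat (replicate i [True])) @ [False] @
      (if ?f then [False] else [True, True, True, False]) @ replicate (min (block x) i) True @ [False] =
      out @ enc_slabel (Num i) @ enc_slabel (slot_label (block x) i)"
    by (auto simp: slot_label_def enc_nat_def concat_replicate_single numeral_eq_Suc min_def)
  have 1: "reach_counter x (Outer True (i \<le> block x)) (Suc i) 0 out (Sweep_Left True ?f) i 0
      ((((out @ [True]) @ [True]) @ [True]) @ [False])"
    using assms block_step[OF assms]
    by (intro reach_counter_step; simp add: min_absorb2; intro reach_counter_step; simp add: min_absorb2;
      intro reach_counter_step; simp add: min_absorb2; intro reach_counter_step; simp add: min_absorb2 reach_counter_refl)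
  have 3: "reach_counter x (Sweep_Right True ?f True) 1 i out' (Outer True ?f) (Suc (Suc i)) 0
      (out' @ replicate (min (block x) i) True @ [False])" for out'
    using sweep_right_labels[of 0 i x ?f out'] assms by simp
  have sl: "reach_counter x (Sweep_Left True ?f) i 0 out' (Sweep_Left True ?f) 0 i (out' @ concat (replicate i [True]))"
    for out' using sweep_left[of i x 0 True ?f out'] assms by simp
  show ?thesis
    unfolding out[symmetric]
    using reach_counter_trans[OF 1 reach_counter_trans[OF sl reach_counter_trans[OF pre 3]]] by simp
qed

lemma outer_labels:
  "i \<le> length x \<Longrightarrow> reach_counter x (Outer True True) 1 0 out (Outer True (i \<le> block x)) (Suc i) 0
    (out @ concat (map (\<lambda>j. enc_slabel (Num j) @ enc_slabel (slot_label (block x) j)) [0..<i]))"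
proof (induction i)
  case 0
  show ?case by (simp add: reach_counter_refl)
next
  case (Suc i)
  then show ?case using reach_counter_trans[OF Suc.IH outer_labels_1[of i x]] by simp
qed

lemma outer_adj_1:
  assumes "i < length x"
  shows "reach_counter x (Outer False (i \<le> block x)) (Suc i) 0 out (Outer False (Suc i \<le> block x)) (Suc (Suc i)) 0
    (out @ concat (replicate i [False, False]) @ concat (replicate i [False, True]) @ [True])"
proof -
  let ?f = "Suc i \<le> block x"
  have 1: "reach_counter x (Outer False (i \<le> block x)) (Suc i) 0 out (Sweep_Left False ?f) i 0 out"
    using assms block_step[OF assms]
      by (intro reach_counter_step; simp add: min_absorb2 reach_counter_refl)
  have 2: "reach_counter x (Sweep_Left False ?f) 0 i out' (Sweep_Right False ?f True) 1 i out'" for out'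
    by (intro reach_counter_step; simp add: min_absorb2 reach_counter_refl)
  have 3: "reach_counter x (Sweep_Right False ?f True) 1 i out' (Outer False ?f) (Suc (Suc i)) 0
      (out' @ concat (replicate i [False, True]) @ [True])" for out'
    using sweep_right_adj[of 0 i x ?f out'] assms by simp
  have sl: "reach_counter x (Sweep_Left False ?f) i 0 out' (Sweep_Left False ?f) 0 i (out' @ concat (replicate i [False, False]))"
    for out' using sweep_left[of i x 0 False ?f out'] assms by simp
  show ?thesis
    using reach_counter_trans[OF 1 reach_counter_trans[OF sl reach_counter_trans[OF 2 3]]] by simp
qed

lemma outer_adj:
  "i \<le> length x \<Longrightarrow> reach_counter x (Outer False True) 1 0 out (Outer False (i \<le> block x)) (Suc i) 0
    (out @ concat (map (\<lambda>j. concat (replicate j [False, False]) @ concat (replicate j [False, True]) @ [True]) [0..<i]))"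
proof (induction i)
  case 0
  show ?case by (simp add: reach_counter_refl)
next
  case (Suc i)
  then show ?case using reach_counter_trans[OF Suc.IH outer_adj_1[of i x]] by simp
qed

lemma run_Rewind:
  "p \<le> Suc (length x) \<Longrightarrow> reach_counter x (Rewind z) p v out (Outer z True) 1 v out"
proof (induction p)
  case 0
  show ?case by (intro reach_counter_step) (simp_all add: min_absorb2 reach_counter_refl)
next
  case (Suc p)
  then have "in_symbol_at x (Suc p) \<noteq> Left_End" by (simp add: in_symbol_at_def)
  then show ?case using Suc by (intro reach_counter_step) (simp_all add: min_absorb2)
qed

lemma run_Count:
  "i \<le> length x \<Longrightarrow> reach_counter x Count1 1 v out Count1 (Suc i) v (out @ replicate (2 * i) True)"
proof (induction i)
  case 0
  show ?case by (simp add: reach_counter_refl)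
next
  case (Suc i)
  have "reach_counter x Count1 (Suc i) v out' Count1 (Suc (Suc i)) v ((out' @ [True]) @ [True])" for out'
    using Suc.prems
    by (intro reach_counter_step; simp add: min_absorb2; intro reach_counter_step; simp add: min_absorb2 reach_counter_refl)
  from reach_counter_trans[OF Suc.IH this] Suc.prems
  have "reach_counter x Count1 1 v out Count1 (Suc (Suc i)) v (out @ replicate (2 * i) True @ replicate 2 True)"
    by (simp add: numeral_2_eq_2)
  moreover have "replicate (2 * i) True @ replicate 2 True = replicate (2 * Suc i) True"
    by (simp only: replicate_add[symmetric]) simp
  ultimately show ?case by simp
qed

section \<open>The code of the slot graph and the space bound\<close>

lemma edge_iff:
  assumes "u < v" "v < 2 * K"
  shows "{u, v} \<in> edges (slot_graph n K) \<longleftrightarrow> odd v \<and> (odd u \<or> v = Suc u)"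
  using assms by (auto simp: slot_graph_def doubleton_eq_iff)

text \<open>With pendants and data vertices alternating, the rows have period 2: that of a pendant
  is all \<open>False\<close>, that of a data vertex alternates over the earlier slots and ends with
  \<open>True\<close> for its own pendant. Fixed two-bit pieces therefore suffice for the
  sweeps.\<close>

lemma adjacency_rows:
  assumes "\<And>u v. u < v \<Longrightarrow> v < 2 * K \<Longrightarrow> E u v \<longleftrightarrow> odd v \<and> (odd u \<or> v = Suc u)"
  shows "concat (map (\<lambda>v. map (\<lambda>u. E u v) [0..<v]) [0..<2 * K]) =
    concat (map (\<lambda>j. concat (replicate j [False, False]) @ concat (replicate j [False, True]) @ [True]) [0..<K])"
proof -
  have pairs: "map f [0..<2 * j] = concat (replicate j [a, b])"
    if "\<And>i. i < j \<Longrightarrow> f (2 * i) = a \<and> f (2 * i + 1) = b" for f :: "nat \<Rightarrow> bool" and j a b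
    using that
  proof (induction j)
    case (Suc j)
    have "concat (replicate (Suc j) [a, b]) = concat (replicate j [a, b]) @ [a, b]"
      by (simp add: replicate_append_same[symmetric])
    then show ?case using Suc by simp
  qed simp
  have "concat (map (\<lambda>v. map (\<lambda>u. E u v) [0..<v]) [0..<2 * k]) =
    concat (map (\<lambda>j. concat (replicate j [False, False]) @ concat (replicate j [False, True]) @ [True]) [0..<k])"
    if "k \<le> K" for k
    using that
  proof (induction k)
    case (Suc k)
    have 1: "map (\<lambda>u. E u (2 * k)) [0..<2 * k] = concat (replicate k [False, False])"
      by (rule pairs) (use Suc.prems in \<open>auto simp: assms\<close>)
    have 2: "map (\<lambda>u. E u (Suc (2 * k))) [0..<2 * k] = concat (replicate k [False, True])"
      by (rule pairs) (use Suc.prems in \<open>auto simp: assms\<close>)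
    have 3: "E (2 * k) (Suc (2 * k))" using Suc.prems by (simp add: assms)
    show ?case using Suc 1 2 3 by simp
  qed simp
  then show ?thesis by blast
qed

lemma enc_slot_graph:
  "enc_sgraph (slot_graph n K) = replicate (2 * K) True @ [False] @
    concat (map (\<lambda>j. enc_slabel (Num j) @ enc_slabel (slot_label n j)) [0..<K]) @
    concat (map (\<lambda>j. concat (replicate j [False, False]) @ concat (replicate j [False, True]) @ [True]) [0..<K])"
proof -
  have len: "length (labels (slot_graph n k)) = 2 * k" for k
    by (induction k) (simp_all add: slot_graph_def)
  have lab: "concat (map enc_slabel (labels (slot_graph n k))) =
      concat (map (\<lambda>j. enc_slabel (Num j) @ enc_slabel (slot_label n j)) [0..<k])" for k
    by (induction k) (simp_all add: slot_graph_def slot_label_def)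
  show ?thesis
    unfolding enc_sgraph_def enc_list_def enc_nat_def n_vertices_def len lab
    by (subst adjacency_rows) (simp_all add: edge_iff)
qed

lemma machine_reach:
  "\<exists>c. reach x (start machine) c \<and> state c = 1 \<and>
    written c = enc_sgraph (slot_graph (block x) (length x))"
proof -
  let ?K = "length x"
  let ?o1 = "replicate (2 * ?K) True @ [False]"
  let ?o2 = "?o1 @ concat (map (\<lambda>j. enc_slabel (Num j) @ enc_slabel (slot_label (block x) j)) [0..<?K])"
  let ?o3 = "?o2 @ concat (map (\<lambda>j. concat (replicate j [False, False]) @
    concat (replicate j [False, True]) @ [True]) [0..<?K])"
  have 1: "reach_counter x Count1 1 0 [] Count1 (Suc ?K) 0 (replicate (2 * ?K) True)"
    using run_Count[of ?K x 0 "[]"] by simp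
  have 2: "reach_counter x Count1 (Suc ?K) 0 (replicate (2 * ?K) True) (Rewind True) (Suc ?K) 0 ?o1"
    by (intro reach_counter_step) (simp_all add: reach_counter_refl)
  have 3: "reach_counter x (Outer True b) (Suc ?K) 0 ?o2 (Rewind False) (Suc ?K) 0 ?o2" for b
    by (intro reach_counter_step) (simp_all add: reach_counter_refl)
  have 4: "reach_counter x (Outer False b) (Suc ?K) 0 ?o3 Done (Suc ?K) 0 ?o3" for b
    by (intro reach_counter_step) (simp_all add: reach_counter_refl)
  have "reach_counter x Count1 1 0 [] Done (Suc ?K) 0 ?o3"
    by (rule reach_counter_trans[OF 1 reach_counter_trans[OF 2 reach_counter_trans[OF run_Rewind[OF order_refl]
      reach_counter_trans[OF outer_labels[OF order_refl] reach_counter_trans[OF 3 reach_counter_trans[OF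
        run_Rewind[OF order_refl] reach_counter_trans[OF outer_adj[OF order_refl] 4]]]]]]])
  moreover have "counter_value [] = 0" "fits x []" by (simp_all add: fits_def)
  ultimately obtain bs where r: "reach x (cfg Count1 1 (tape []) 0 []) (cfg Done (Suc ?K) (tape bs) 0 ?o3)"
    unfolding reach_counter_def by blast
  \<comment> \<open>The first step of the machine marks cell 0 and thereby turns the blank tape into
    an empty counter.\<close>
  have "(\<lambda>_. 0)(0 := 3) = tape []" by (auto simp: tape_def fun_eq_iff)
  then have "reach x (cfg Start 0 (\<lambda>_. 0) 0 []) (cfg Done (Suc ?K) (tape bs) 0 ?o3)"
    using r by (intro reach_step) simp_all
  moreover have "cfg Start 0 (\<lambda>_. 0) 0 [] = start machine"
    by (simp add: cfg_def start_def machine_def)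
  ultimately show ?thesis
    by (intro exI[of _ "cfg Done (Suc ?K) (tape bs) 0 ?o3"]) (simp add: cfg_def enc_slot_graph)
qed

lemma reach_steps:
  assumes "reach x c c'" "heads_low x c"
  shows "\<exists>t. (step machine x ^^ t) c = c' \<and> (\<forall>s \<le> t. heads_low x ((step machine x ^^ s) c))"
  using assms(1) unfolding reach_def
proof (induction rule: rtranclp_induct)
  case base
  then show ?case using assms(2) by (intro exI[of _ 0]) simp
next
  case (step y z)
  then obtain t where "(step machine x ^^ t) c = y" "\<forall>s \<le> t. heads_low x ((step machine x ^^ s) c)"
    by blast
  then show ?case using step(2) by (intro exI[of _ "Suc t"]) (auto simp: le_Suc_eq)
qed

lemma halted: "state c = 1 \<Longrightarrow> (step machine x ^^ t) c = c"
  by (induction t) (simp_all add: step_def)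

lemma logspace_slot_graph:
  "logspace_computable (\<lambda>x. enc_sgraph (slot_graph (block x) (length x)))"
  unfolding logspace_computable_def
proof (rule exI[of _ machine], intro conjI)
  show "wf_transducer machine" by (rule wf_machine)
next
  show "\<forall>x. \<exists>t. state (run machine x t) = 1 \<and>
      written (run machine x t) = enc_sgraph (slot_graph (block x) (length x))"
  proof
    fix x
    have "heads_low x (start machine)" by (simp add: heads_low_def start_def machine_def)
    then obtain c t where c: "state c = 1" "written c = enc_sgraph (slot_graph (block x) (length x))"
      "(step machine x ^^ t) (start machine) = c"
      using machine_reach[of x] reach_steps by blast
    then show "\<exists>t. state (run machine x t) = 1 \<and>
        written (run machine x t) = enc_sgraph (slot_graph (block x) (length x))"
      by (intro exI[of _ t]) (simp add: run_def)
  qed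
next
  show "\<exists>c. \<forall>x t. \<forall>(tp, h) \<in> set (work (run machine x t)). real h \<le> c * log 2 (real (length x) + 2)"
  \<comment> \<open>The head bound gives \<open>2 + log 2 (length x + 2)\<close>, and this logarithm
    is at least 1; hence 3.\<close>
  proof (rule exI[of _ 3], intro allI ballI)
    fix x t e assume e: "e \<in> set (work (run machine x t))"
    obtain tp h where th: "e = (tp, h)" by (cases e)
    have "heads_low x (start machine)" by (simp add: heads_low_def start_def machine_def)
    then obtain c t' where c: "state c = 1" "(step machine x ^^ t') (start machine) = c"
      "\<forall>s \<le> t'. heads_low x ((step machine x ^^ s) (start machine))"
      using machine_reach[of x] reach_steps by blast
    \<comment> \<open>A halted machine repeats its last configuration, so the bound up to time
      \<open>t'\<close> covers all times.\<close>
    have "heads_low x (run machine x t)"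
    proof (cases "t \<le> t'")
      case False
      then obtain k where "t = k + t'" by (metis add.commute le_Suc_ex nat_le_linear)
      then have "(step machine x ^^ t) (start machine) = (step machine x ^^ k) c"
        using c(2) by (simp add: funpow_add)
      moreover have "heads_low x c" using c(2,3) by auto
      ultimately show ?thesis by (simp only: run_def halted[OF c(1)])
    qed (use c in \<open>simp add: run_def\<close>)
    then have "2 ^ h \<le> 4 * (length x + 1)" using e th by (auto simp: heads_low_def)
    then have "real (2 ^ h) \<le> real (4 * (length x + 1))" by (rule of_nat_mono)
    then have "2 ^ h \<le> 4 * (real (length x) + 2)" by simp
    then have "log 2 (2 ^ h) \<le> log 2 (4 * (real (length x) + 2))" by (subst log_le_cancel_iff) auto
    also have "\<dots> = log 2 (2 ^ 2) + log 2 (real (length x) + 2)" by (subst log_mult) auto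
    also have "log 2 ((2::real) ^ 2) = 2" by (subst log_nat_power) simp_all
    also have "log 2 ((2::real) ^ h) = real h" by (subst log_nat_power) simp_all
    finally have "real h \<le> 2 + log 2 (real (length x) + 2)" .
    moreover have "1 \<le> log 2 (real (length x) + 2)" by (subst one_le_log_cancel_iff) auto
    ultimately have "real h \<le> 3 * log 2 (real (length x) + 2)" by linarith
    then show "case e of (tp, h) \<Rightarrow> real h \<le> 3 * log 2 (real (length x) + 2)"
      by (simp add: th)
  qed
qed

definition encoding :: "rec_circuit \<Rightarrow> slabel lgraph" where
  "encoding R = slot_graph (n_in (base R)) (length (enc_rec R))"

lemma block_enc_rec: "block (enc_rec R) = n_in (base R)"
proof -
  have "block (replicate n True @ False # ys) = n" for n ys
    by (induction n) (simp_all add: block_def)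
  then show ?thesis by (simp add: enc_rec_def enc_circuit_def enc_nat_def)
qed

lemma symbolic_logspace_encoding: "symbolic_logspace_encoding encoding"
  unfolding symbolic_logspace_encoding_def
proof (intro exI conjI allI impI ballI)
  fix R :: rec_circuit
  let ?K = "length (enc_rec R)"
  have n: "n_in (base R) < ?K" by (simp add: enc_rec_def enc_circuit_def enc_nat_def)
  have len: "n_vertices (slot_graph n k) = 2 * k" for n k
    by (induction k) (simp_all add: slot_graph_def n_vertices_def)
  show "wf_sgraph (encoding R)"
    unfolding wf_sgraph_def wf_lgraph_def encoding_def len
    using n by (auto simp: slot_graph_def split: if_splits)
  fix l assume "l \<in> set (labels (encoding R))"
  then show "slabel_ok R l" by (auto simp: encoding_def slot_graph_def split: if_splits)
next
  fix R
  show "enc_sgraph (slot_graph (block (enc_rec R)) (length (enc_rec R))) = enc_sgraph (encoding R)"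
    by (simp add: encoding_def block_enc_rec)
qed (rule logspace_slot_graph)

section \<open>Decoding the multiset seen by a vertex\<close>

lemma sum_list_view:
  fixes g :: "'a \<Rightarrow> real"
  assumes "mset zs = mset (map c [0..<k])"
  shows "(\<Sum>v\<leftarrow>zs. g v) = (\<Sum>j<k. g (c j))"
proof -
  have "(\<Sum>v\<leftarrow>zs. g v) = (\<Sum>v\<leftarrow>map c [0..<k]. g v)"
    by (rule sum_list_perm[OF assms])
  then show ?thesis by (simp add: comp_def interv_sum_list_conv_sum_set_nat atLeast0LessThan)
qed

context
  fixes zs :: "real list" and c :: "nat \<Rightarrow> real" and K :: nat
  assumes view: "mset zs = mset (map c [0..<Suc K])"
    and desc: "\<And>r. r < K \<Longrightarrow> c (Suc r) < c r"
begin

lemma desc_less: "r < s \<Longrightarrow> s \<le> K \<Longrightarrow> c s < c r"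
proof (induction s)
  case (Suc s)
  then show ?case using desc[of s] by (cases "r = s") auto
qed simp

lemma desc_eq_iff: "r \<le> K \<Longrightarrow> s \<le> K \<Longrightarrow> c r = c s \<longleftrightarrow> r = s"
  using desc_less[of r s] desc_less[of s r] by (cases r s rule: linorder_cases) auto

lemma rank_desc:
  assumes "r \<le> K"
  shows "rank zs (c r) = real r"
proof -
  have "rank zs (c r) = (\<Sum>s<Suc K. sign (c s - c r))"
    unfolding rank_def by (rule sum_list_view[OF view])
  also have "\<dots> = (\<Sum>s<Suc K. if s < r then 1 else 0)"
  proof (rule sum.cong)
    fix s assume "s \<in> {..<Suc K}"
    then show "sign (c s - c r) = (if s < r then 1 else 0)"
      using desc_less[of r s] desc_less[of s r] assms
      by (cases r s rule: linorder_cases) (auto simp: sign_def)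
  qed simp
  also have "\<dots> = real (card ({..<Suc K} \<inter> {s. s < r}))"
    by (simp add: sum.If_cases del: sum.lessThan_Suc)
  also have "{..<Suc K} \<inter> {s. s < r} = {..<r}" using assms by auto
  finally show ?thesis by simp
qed

lemma ranked_desc:
  assumes "r \<le> K"
  shows "ranked zs r = c r"
proof -
  have "ranked zs r = (\<Sum>s<Suc K. eq_ind (rank zs (c s)) (real r) * c s)"
    unfolding ranked_def by (rule sum_list_view[OF view])
  also have "\<dots> = (\<Sum>s<Suc K. if s = r then c s else 0)"
    by (rule sum.cong) (auto simp: rank_desc eq_ind_eq)
  also have "\<dots> = c r" using assms by simp
  finally show ?thesis .
qed

text \<open>Distinct entries match only themselves, so the number of matching pairs equals the
  length and stays below the threshold that identifies initial labels.\<close>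

lemma pairs_desc: "(\<Sum>u\<leftarrow>zs. \<Sum>v\<leftarrow>zs. eq_ind u v) = real (Suc K)"
proof -
  have "(\<Sum>u\<leftarrow>zs. \<Sum>v\<leftarrow>zs. eq_ind u v) = (\<Sum>r<Suc K. \<Sum>s<Suc K. eq_ind (c r) (c s))"
    unfolding sum_list_view[OF view] ..
  also have "\<dots> = (\<Sum>r<Suc K. \<Sum>s<Suc K. if s = r then 1 else 0)"
    by (intro sum.cong refl) (auto simp: eq_ind_eq desc_eq_iff)
  finally show ?thesis by simp
qed

lemma length_desc: "length zs = Suc K"
  using mset_eq_length[OF view] by simp

text \<open>The second round. Here \<open>c 0\<close> serves as the scale \<open>M\<close>,
  \<open>c K\<close> is the negated datum saved by the pendant, and data vertex \<open>i\<close> has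
  rank \<open>r = K - 1 - i\<close>; so the factor is \<open>3 * i + 2\<close> and the result is the
  packed value.\<close>

lemma layer_fun_joined:
  assumes "K \<ge> 2" "zs ! 0 = c r" "r < K" "c r > 0"
  shows "layer_fun C zs = - c K - (3 * (real K - 1 - real r) + 2) * c 0"
proof -
  have len: "(length zs = 2) = False" "(length zs < 2) = False" "length zs - 1 = K"
    using assms(1) length_desc by auto
  have s: "sign (zs ! 0) = 1" using assms by (simp add: sign_def)
  have f: "sign (real (Suc K) - (real (length zs) + 5 / 2)) = 0" by (simp add: sign_def length_desc)
  have "rank zs (zs ! 0) = real r" "ranked zs K = c K" "ranked zs 0 = c 0"
    using assms rank_desc ranked_desc by auto
  moreover have "real (3 * K - 1) = 3 * real K - 1" using assms(1) by (simp add: of_nat_diff)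
  ultimately show ?thesis
    unfolding layer_fun_def Let_def len pairs_desc f if_False s by (simp add: algebra_simps)
qed

text \<open>Both sums have a single nonzero term: slot \<open>K - 1\<close> selects the circuit and
  the own rank selects the slot, shifted by one since the pendant has rank 0.\<close>

lemma layer_fun_stepped:
  assumes "K \<ge> 2" "zs ! 0 = c (Suc i)" "i < K" "c (Suc i) < 0"
    and s: "slot zs (K - 1) = real n" "n < K" "length (enc_rec (C n)) = K"
  shows "layer_fun C zs = sim_step (C n) K (slot zs) i"
proof -
  have len: "(length zs = 2) = False" "(length zs < 2) = False" "length zs - 1 = K"
    using assms(1) length_desc by auto
  have sg: "sign (zs ! 0) = 0" using assms by (simp add: sign_def)
  have f: "sign (real (Suc K) - (real (length zs) + 5 / 2)) = 0" by (simp add: sign_def length_desc)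
  have rk: "rank zs (zs ! 0) = real (i + 1)" using rank_desc[of "Suc i"] assms by simp
  have "(\<Sum>j<K. eq_ind (rank zs (zs ! 0)) (real (j + 1)) * sim_step (C n) K (slot zs) j) =
      (\<Sum>j<K. if j = i then sim_step (C n) K (slot zs) j else 0)"
    unfolding rk by (rule sum.cong) (auto simp: eq_ind_eq)
  also have "\<dots> = sim_step (C n) K (slot zs) i" using assms(3) by simp
  finally have 1: "(\<Sum>j<K. eq_ind (rank zs (zs ! 0)) (real (j + 1)) * sim_step (C n) K (slot zs) j) =
      sim_step (C n) K (slot zs) i" .
  have "(\<Sum>n'<K. if length (enc_rec (C n')) = K then eq_ind (slot zs (K - 1)) (real n') *
      (\<Sum>j<K. eq_ind (rank zs (zs ! 0)) (real (j + 1)) * sim_step (C n') K (slot zs) j) else 0) =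
      (\<Sum>n'<K. if n' = n then sim_step (C n) K (slot zs) i else 0)"
    unfolding s(1) by (rule sum.cong) (use s(3) 1 in \<open>auto simp: eq_ind_eq\<close>)
  also have "\<dots> = sim_step (C n) K (slot zs) i" using s(2) by simp
  finally show ?thesis
    unfolding layer_fun_def Let_def len pairs_desc f if_False sg by simp
qed

end

lemma layer_fun_fresh:
  assumes view: "mset zs = mset (b # map a [0..<K])" and eq: "\<And>j. n \<le> j \<Longrightarrow> j < K \<Longrightarrow> a j = d"
    and K: "n + 4 \<le> K"
  shows "layer_fun C zs = b * b + (\<Sum>j<K. a j * a j) + real (K * K + 2)"
proof -
  have sum: "(\<Sum>v\<leftarrow>zs. g v) = g b + (\<Sum>j<K. g (a j))" for g :: "real \<Rightarrow> real"
    using sum_list_perm[OF view, of g]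
    by (simp add: comp_def interv_sum_list_conv_sum_set_nat atLeast0LessThan)
  have L: "length zs = Suc K" using mset_eq_length[OF view] by simp
  then have len: "(length zs = 2) = False" "(length zs < 2) = False" "length zs - 1 = K"
    using K by auto
  have nn: "0 \<le> eq_ind u v" for u v by (simp add: eq_ind_eq)
  let ?g = "\<lambda>u. eq_ind u b + (\<Sum>j<K. eq_ind u (a j))"
  have gb: "?g b \<ge> 1" using sum_nonneg[of "{..<K}" "\<lambda>j. eq_ind b (a j)"] nn
    by (simp add: eq_ind_eq)
  \<comment> \<open>At least four slots carry the common label \<open>d\<close>, so each of them
    matches four entries. The total exceeds the length by at least 12; the constant 5/2 in
    \<open>layer_fun\<close> only has to lie between 0 and this excess.\<close>
  have g1: "?g (a i) \<ge> (if i < n then 1 else 4)" if "i < K" for i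
  proof (cases "i < n")
    case True
    have "eq_ind (a i) (a i) \<le> (\<Sum>j<K. eq_ind (a i) (a j))"
      by (rule member_le_sum) (use nn that in auto)
    then show ?thesis using True nn[of "a i" b] by (simp add: eq_ind_eq)
  next
    case False
    have "(\<Sum>j\<in>{n..<K}. eq_ind (a i) (a j)) \<le> (\<Sum>j<K. eq_ind (a i) (a j))"
      by (rule sum_mono2) (use nn in auto)
    moreover have "(\<Sum>j\<in>{n..<K}. eq_ind (a i) (a j)) = (\<Sum>j\<in>{n..<K}. 1)"
      by (rule sum.cong) (use eq False that in \<open>auto simp: eq_ind_eq\<close>)
    ultimately show ?thesis using False nn[of "a i" b] K by (simp add: of_nat_diff)
  qed
  have "(\<Sum>i<K. ?g (a i)) \<ge> (\<Sum>i<K. if i < n then 1 else 4)"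
    by (rule sum_mono) (use g1 in auto)
  moreover have "(\<Sum>i<K. if i < n then 1 else 4 :: real) = real n + 4 * (real K - real n)"
  proof -
    have "{..<K} \<inter> {i. i < n} = {..<n}" "{..<K} \<inter> - {i. i < n} = {n..<K}" using K by auto
    then show ?thesis using K by (simp add: sum.If_cases of_nat_diff)
  qed
  moreover have "real n + 4 \<le> real K" using K by linarith
  ultimately have "(\<Sum>u\<leftarrow>zs. \<Sum>v\<leftarrow>zs. eq_ind u v) > real (length zs) + 5 / 2"
    unfolding sum L using gb by simp
  then have f: "sign ((\<Sum>u\<leftarrow>zs. \<Sum>v\<leftarrow>zs. eq_ind u v) - (real (length zs) + 5 / 2)) = 1"
    by (simp add: sign_def)
  show ?thesis
    unfolding layer_fun_def Let_def len f if_False sum[of "\<lambda>v. v * v"] by simp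
qed

section \<open>Message passing on the slot graph\<close>

definition interleave :: "nat \<Rightarrow> (nat \<Rightarrow> real) \<Rightarrow> (nat \<Rightarrow> real) \<Rightarrow> real list" where
  "interleave K b a = concat (map (\<lambda>i. [b i, a i]) [0..<K])"

lemma length_interleave: "length (interleave K b a) = 2 * K"
  by (induction K) (simp_all add: interleave_def)

lemma interleave_nth:
  assumes "i < K"
  shows "interleave K b a ! (2 * i) = b i" "interleave K b a ! Suc (2 * i) = a i"
proof -
  have "interleave K b a ! (2 * i) = b i \<and> interleave K b a ! Suc (2 * i) = a i"
    using assms
  proof (induction K)
    case (Suc K)
    have v: "interleave (Suc K) b a = interleave K b a @ [b K, a K]" by (simp add: interleave_def)
    show ?case
    proof (cases "i = K")
      case True
      then show ?thesis by (simp add: v nth_append length_interleave)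
    next
      case False
      then have "i < K" using Suc.prems by simp
      then show ?thesis using Suc.IH by (simp add: v nth_append length_interleave)
    qed
  qed simp
  then show "interleave K b a ! (2 * i) = b i" "interleave K b a ! Suc (2 * i) = a i" by auto
qed

lemma map_upt_double: "map f [0..<2 * K] = interleave K (\<lambda>i. f (2 * i)) (\<lambda>i. f (Suc (2 * i)))"
  by (induction K) (simp_all add: interleave_def)

lemma interleave_cong: "(\<And>i. i < K \<Longrightarrow> b i = b' i \<and> a i = a' i) \<Longrightarrow> interleave K b a = interleave K b' a'"
  by (auto simp: interleave_def intro!: arg_cong[of _ _ concat])

lemma mset_interleave: "mset (interleave K b a) = mset (map b [0..<K]) + mset (map a [0..<K])"
  by (induction K) (simp_all add: interleave_def)

lemma sum_list_interleave: "(\<Sum>v\<leftarrow>interleave K b a. g v) = (\<Sum>i<K. g (b i)) + (\<Sum>i<K. (g (a i) :: real))"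
  by (induction K) (simp_all add: interleave_def)

lemma n_vertices_slot_graph: "n_vertices (slot_graph n K) = 2 * K"
  by (induction K) (simp_all add: slot_graph_def n_vertices_def)

context
  fixes G :: "real lgraph" and n K :: nat
  assumes G: "n_vertices G = 2 * K" "edges G = edges (slot_graph n K)"
begin

lemma edge_sym_iff:
  assumes "u < 2 * K" "v < 2 * K"
  shows "{u, v} \<in> edges G \<longleftrightarrow> u < v \<and> odd v \<and> (odd u \<or> v = Suc u) \<or>
    v < u \<and> odd u \<and> (odd v \<or> u = Suc v)"
proof (cases u v rule: linorder_cases)
  case less
  then show ?thesis using edge_iff[OF less assms(2)] G by auto
next
  case greater
  then show ?thesis using edge_iff[OF greater assms(1)] G by (auto simp: insert_commute)
next
  case equal
  then show ?thesis using G(2) by (auto simp: slot_graph_def)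
qed

lemma neighbours_even:
  assumes "i < K"
  shows "neighbours G (2 * i) = [Suc (2 * i)]"
proof -
  have "neighbours G (2 * i) = filter (\<lambda>u. u = Suc (2 * i)) [0..<2 * K]"
    unfolding neighbours_def G(1)
      by (rule filter_cong) (use assms in \<open>auto simp: edge_sym_iff\<close>)
  moreover have "filter (\<lambda>u. u = k) [0..<m] = [k]" if "k < m" for k m :: nat
    using that by (induction m) (auto simp: less_Suc_eq)
  ultimately show ?thesis using assms by simp
qed

text \<open>The clique has no loops, but the own value comes first in the argument. So all data
  vertices see the same multiset up to their pendant.\<close>

lemma neighbours_odd:
  assumes "i < K"
  shows "mset (Suc (2 * i) # neighbours G (Suc (2 * i))) = mset (2 * i # map (\<lambda>j. Suc (2 * j)) [0..<K])"
proof -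
  have "set (Suc (2 * i) # neighbours G (Suc (2 * i))) = set (2 * i # map (\<lambda>j. Suc (2 * j)) [0..<K])"
    (is "?A = ?B")
  proof (rule set_eqI)
    fix u
    show "u \<in> ?A \<longleftrightarrow> u \<in> ?B"
    proof (cases "u < 2 * K")
      case True
      have o: "odd u \<longleftrightarrow> u \<in> (\<lambda>j. Suc (2 * j)) ` {0..<K}" using True
        by (auto elim!: oddE)
      have "u \<in> ?A \<longleftrightarrow> u = 2 * i \<or> odd u"
        using True assms by (auto simp: neighbours_def G(1) edge_sym_iff)
      then show ?thesis using o by auto
    next
      case False
      then show ?thesis using assms by (auto simp: neighbours_def G(1))
    qed
  qed
  moreover have "distinct (Suc (2 * i) # neighbours G (Suc (2 * i)))"
    using edge_sym_iff[of "Suc (2 * i)" "Suc (2 * i)"] assms by (simp add: neighbours_def)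
  moreover have "distinct (2 * i # map (\<lambda>j. Suc (2 * j)) [0..<K])"
  proof -
    have "2 * i \<noteq> Suc (2 * j)" for j by presburger
    then show ?thesis by (auto simp: distinct_map inj_on_def)
  qed
  ultimately show ?thesis by (simp only: set_eq_iff_mset_eq_distinct)
qed

text \<open>A pendant receives the negated old value of its data vertex. While states are packed,
  data are negative, so the pendant value is positive and ranks above all data.\<close>

lemma features_Suc_interleave:
  assumes N: "\<And>i. layer N i = (f, id)" and h: "features N G t = interleave K b a"
    and f: "\<And>i zs. i < K \<Longrightarrow> zs ! 0 = a i \<Longrightarrow> mset zs = mset (b i # map a [0..<K]) \<Longrightarrow> f zs = a' i"
    and f2: "\<And>u v. f [u, v] = - v"
  shows "features N G (Suc t) = interleave K (\<lambda>i. - a i) a'"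
proof -
  let ?h = "interleave K b a"
  have "features N G (Suc t) = map (\<lambda>w. f (?h ! w # map ((!) ?h) (neighbours G w))) [0..<2 * K]"
    using N h G(1) by (simp add: Let_def)
  also have "\<dots> = interleave K (\<lambda>i. - a i) a'"
    unfolding map_upt_double
  proof (rule interleave_cong, intro conjI)
    fix i assume i: "i < K"
    show "f (?h ! (2 * i) # map ((!) ?h) (neighbours G (2 * i))) = - a i"
      by (simp add: neighbours_even[OF i] interleave_nth[OF i] f2)
    let ?zs = "map ((!) ?h) (Suc (2 * i) # neighbours G (Suc (2 * i)))"
    have "mset ?zs = image_mset ((!) ?h) (mset (2 * i # map (\<lambda>j. Suc (2 * j)) [0..<K]))"
      unfolding neighbours_odd[OF i, symmetric] by simp
    also have "\<dots> = mset (map ((!) ?h) (2 * i # map (\<lambda>j. Suc (2 * j)) [0..<K]))"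
      by (simp only: mset_map)
    also have "map ((!) ?h) (2 * i # map (\<lambda>j. Suc (2 * j)) [0..<K]) = b i # map a [0..<K]"
      using i by (simp add: interleave_nth)
    finally have "f ?zs = a' i" by (intro f[OF i]) (simp_all add: interleave_nth[OF i])
    then show "f (?h ! Suc (2 * i) # map ((!) ?h) (neighbours G (Suc (2 * i)))) = a' i" by simp
  qed
  finally show ?thesis .
qed

end

section \<open>Simulating a recurrent circuit\<close>

definition vals :: "rec_circuit \<Rightarrow> real list \<Rightarrow> nat \<Rightarrow> nat \<Rightarrow> real" where
  "vals R xs t = case_prod (gate_val (base R)) (rec_state R xs t)"

lemma length_rec_state:
  assumes "wf_rec R" "length xs = n_in (base R)"
  shows "length (fst (rec_state R xs t)) = n_in (base R)"
    "length (snd (rec_state R xs t)) = n_aux (base R)"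
  using assms by (induction t) (auto simp: wf_rec_def Let_def)

definition tracks :: "rec_circuit \<Rightarrow> real list \<Rightarrow> nat \<Rightarrow> nat \<Rightarrow> (nat \<Rightarrow> real) \<Rightarrow> bool" where
  "tracks R xs K t s \<longleftrightarrow> (let n = n_in (base R) in
     (\<forall>i < n. s i = fst (rec_state R xs t) ! i) \<and>
     (t > 0 \<longrightarrow> (\<forall>j < n_aux (base R). s (n + j) = snd (rec_state R xs t) ! j)) \<and>
     s (K - 3) = real n + real t \<and> s (K - 2) = real n \<and> s (K - 1) = real n)"

text \<open>Decoding a view recovers the state only in the slots below \<open>K\<close>; nothing
  else is read.\<close>

lemma sim_step_cong:
  assumes R: "wf_rec R" and K: "n_in (base R) + n_aux (base R) \<le> K - 3" "3 \<le> K"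
    and s: "\<And>i. i < K \<Longrightarrow> s i = s' i"
  shows "sim_step R K s = sim_step R K s'"
proof -
  have a: "sim_aux R K s j = sim_aux R K s' j" if "j < n_aux (base R)" for j
    using K that by (simp add: sim_aux_def s)
  have v: "sim_val R K s = sim_val R K s'"
    unfolding sim_val_def using a K s
      by (intro ext arg_cong2[where f = "\<lambda>a b. gate_val _ a b _"]) auto
  have n: "sim_next R K s = sim_next R K s'"
    unfolding sim_next_def v using K s[of "K - 3"] by (intro ext) auto
  have k: "s (K - 3) = s' (K - 3)" using K s by simp
  have h: "sim_halt R K s = sim_halt R K s'"
    unfolding sim_halt_def v k ..
  have o: "sim_out R K s = sim_out R K s'" unfolding sim_out_def v ..
  show ?thesis unfolding sim_step_def n h o ..
qed

context
  fixes R :: rec_circuit and xs :: "real list" and n K :: nat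
  assumes R: "wf_rec R" and n: "n_in (base R) = n" "length xs = n"
    and K: "n + n_aux (base R) + 4 \<le> K" "4 * n \<le> K" "2 * n_out (base R) < K"
begin

lemma tracks_val:
  assumes "tracks R xs K t s"
  shows "sim_val R K s = vals R xs t"
proof -
  have "map s [0..<n] = fst (rec_state R xs t)"
    using assms length_rec_state(1)[OF R, of xs t] n
      by (intro nth_equalityI) (auto simp: tracks_def Let_def)
  moreover have "map (sim_aux R K s) [0..<n_aux (base R)] = snd (rec_state R xs t)"
  proof (rule nth_equalityI)
    show "length (map (sim_aux R K s) [0..<n_aux (base R)]) = length (snd (rec_state R xs t))"
      using length_rec_state(2)[OF R, of xs t] n by simp
    fix j assume "j < length (map (sim_aux R K s) [0..<n_aux (base R)])"
    \<comment> \<open>At \<open>t = 0\<close> slot \<open>K - 3\<close> holds \<open>n\<close>, so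
      \<open>sim_aux\<close> takes the initial values; later it holds more than \<open>n\<close> and
      the slots are read.\<close>
    then show "map (sim_aux R K s) [0..<n_aux (base R)] ! j = snd (rec_state R xs t) ! j"
      using assms by (cases "t = 0") (auto simp: sim_aux_def tracks_def Let_def eq_ind_eq)
  qed
  ultimately show ?thesis using n by (auto simp: sim_val_def vals_def case_prod_beta fun_eq_iff)
qed

lemma tracks_next:
  assumes "tracks R xs K t s"
  shows "tracks R xs K (Suc t) (sim_next R K s)"
proof -
  have l: "length (rec_in R) = n" "length (rec_aux R) = n_aux (base R)"
    using R n by (simp_all add: wf_rec_def)
  have k: "K - 3 \<ge> n + n_aux (base R)" "K - 2 \<ge> n + n_aux (base R)" "K - 1 \<ge> n + n_aux (base R)"
    "K - 2 \<noteq> K - 3" "K - 1 \<noteq> K - 3" using K by auto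
  show ?thesis
    using assms k l n tracks_val[OF assms]
    by (auto simp: tracks_def Let_def sim_next_def vals_def)
qed

lemma tracks_halt:
  assumes "tracks R xs K t s"
  shows "sim_halt R K s = (if halts_after R xs (Suc t) then 1 else 0)"
proof -
  let ?vs = "map (vals R xs t) (halt_gates R)"
  have wf: "n_in (halt_circuit R) = Suc (length (halt_gates R))" "n_aux (halt_circuit R) = 0"
    "n_out (halt_circuit R) = 1" using R by (simp_all add: wf_rec_def)
  have "map (\<lambda>i. if i = 0 then s (K - 3) - (real (n_in (base R)) - 1)
      else sim_val R K s (halt_gates R ! (i - 1))) [0..<n_in (halt_circuit R)] = real (Suc t) # ?vs"
    by (rule nth_equalityI)
      (use assms wf n tracks_val[OF assms] in \<open>auto simp: tracks_def Let_def nth_Cons' nth_append less_Suc_eq\<close>)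
  then have "sim_halt R K s = halt_fun R (Suc t) ?vs"
    using wf by (simp add: sim_halt_def halt_fun_def circuit_fun_def outputs_def)
  moreover have "halt_fun R (Suc t) ?vs \<in> {0, 1}" using R by (simp add: wf_rec_def)
  moreover have "halts_after R xs (Suc t) \<longleftrightarrow> halt_fun R (Suc t) ?vs = 1"
    by (simp add: halts_after_def vals_def)
  ultimately show ?thesis by auto
qed

end

definition circuit_gnn :: "(nat \<Rightarrow> rec_circuit) \<Rightarrow> gnn" where
  "circuit_gnn C = \<lparr>layer = \<lambda>_. (layer_fun C, id), gnn_halt = halt_detector\<rparr>"

lemma circuit_gnn_class:
  assumes "C \<in> rec_families (with_sign F) (add_gates F A)"
  shows "circuit_gnn C \<in> gnns (tail_functions (with_sign F))
    (tail_functions (add_gates (with_sign F) A)) {id}"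
  using layer_fun_class[OF assms] halt_detector_class[of F]
  by (auto simp: gnns_def circuit_gnn_def halt_detector_Cons sign_def)

lemma layer_fun_pair: "layer_fun C [u, v] = - v"
  by (simp add: layer_fun_def)

text \<open>Pendant values are pairwise distinct while the simulation runs, so they contribute at
  most one to the halting count.\<close>

lemma sum_indicator_le_1:
  assumes "inj_on b {..<K::nat}"
  shows "(\<Sum>i<K. eq_ind (b i) 1) \<le> 1"
proof -
  have "(\<Sum>i<K. eq_ind (b i) 1) = real (card {i. i < K \<and> b i = 1})"
    by (simp add: eq_ind_eq of_bool_def sum.If_cases lessThan_def Collect_conj_eq)
  moreover have "card {i. i < K \<and> b i = 1} \<le> Suc 0"
    using assms by (subst card_le_Suc0_iff_eq) (auto simp: inj_on_def)
  ultimately show ?thesis by simp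
qed

locale slot_simulation =
  fixes C :: "nat \<Rightarrow> rec_circuit" and xs :: "real list" and n K :: nat
  assumes R: "wf_rec (C n)" and n: "n_in (base (C n)) = n" "length xs = n"
    and K_eq: "length (enc_rec (C n)) = K"
begin

lemma K: "n + n_aux (base (C n)) + 4 \<le> K" "4 * n \<le> K" "2 * n_out (base (C n)) < K"
proof -
  have wf: "wf_circuit (base (C n))" using R by (simp add: wf_rec_def)
  show "n + n_aux (base (C n)) + 4 \<le> K" "4 * n \<le> K" "2 * n_out (base (C n)) < K"
    using length_enc_rec(1)[of "C n"] in_out_le_csize[OF wf] n K_eq by auto
qed

abbreviation "N \<equiv> circuit_gnn C"
abbreviation "G \<equiv> graph_encoding encoding (C n) xs"

section \<open>The two preparatory rounds and the invariant of the simulation\<close>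

definition raw :: "nat \<Rightarrow> real" where
  "raw i = (if i < n then xs ! i else real n)"

definition offset :: real where
  "offset = (\<Sum>j<K. raw j * raw j) + real (K * K + 2)"

lemma G: "n_vertices G = 2 * K" "edges G = edges (slot_graph n K)"
  using n_vertices_slot_graph[of n K] n K_eq
  by (simp_all add: graph_encoding_def encoding_def n_vertices_def)

lemma features_0: "features N G 0 = interleave K real raw"
proof -
  have "map (slabel_val (C n) xs) (labels (slot_graph n k)) = interleave k real raw" for k
    by (induction k) (auto simp: slot_graph_def interleave_def raw_def)
  then show ?thesis using n K_eq by (simp add: graph_encoding_def encoding_def)
qed

lemma features_step:
  assumes "features N G t = interleave K b a"
    "\<And>i zs. i < K \<Longrightarrow> zs ! 0 = a i \<Longrightarrow> mset zs = mset (b i # map a [0..<K]) \<Longrightarrow> layer_fun C zs = a' i"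
  shows "features N G (Suc t) = interleave K (\<lambda>i. - a i) a'"
  by (rule features_Suc_interleave[where f = "layer_fun C", OF G _ assms])
    (simp_all add: circuit_gnn_def layer_fun_pair)

lemma features_1: "features N G 1 = interleave K (\<lambda>i. - raw i) (\<lambda>i. offset + real i * real i)"
  unfolding One_nat_def
proof (rule features_step[OF features_0])
  fix i zs assume "mset zs = mset (real i # map raw [0..<K])"
  then have "layer_fun C zs = real i * real i + (\<Sum>j<K. raw j * raw j) + real (K * K + 2)"
    by (rule layer_fun_fresh[where n = n and d = "real n"]) (use K in \<open>auto simp: raw_def\<close>)
  then show "layer_fun C zs = offset + real i * real i" by (simp add: offset_def)
qed

text \<open>The spare 1 makes all data after the first round exceed 1, so that they are not counted
  as halting values.\<close>

lemma raw_bound: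
  assumes "i < K"
  shows "\<bar>raw i\<bar> < offset - 1"
proof -
  have "raw i * raw i \<le> (\<Sum>j<K. raw j * raw j)" by (rule member_le_sum) (use assms in auto)
  moreover have "\<bar>raw i\<bar> < 1 + raw i * raw i"
  proof -
    \<comment> \<open>Completing the square: \<open>|x|\<close> is at most
      \<open>x * x + 1 / 4\<close>.\<close>
    have "0 \<le> (\<bar>raw i\<bar> - 1 / 2) * (\<bar>raw i\<bar> - 1 / 2)" by simp
    then show ?thesis by (simp add: algebra_simps)
  qed
  moreover have "1 \<le> K * K" using K by (simp add: Suc_le_eq)
  then have "1 \<le> real (K * K)" by (metis of_nat_1 of_nat_mono)
  ultimately show ?thesis unfolding offset_def of_nat_add by linarith
qed

lemma offset_gt: "1 < offset"
  using raw_bound[of 0] K by linarith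

text \<open>\<open>M\<close> is a parameter because the second round uses a different bound than
  \<open>packed\<close>. Pendants have to lie above the data, hence the bound \<open>- M\<close>,
  and to be distinct, which limits their share in the halting count.\<close>

definition running :: "nat \<Rightarrow> (nat \<Rightarrow> real) \<Rightarrow> real \<Rightarrow> (nat \<Rightarrow> real) \<Rightarrow> (nat \<Rightarrow> real) \<Rightarrow> bool" where
  "running t s M b a \<longleftrightarrow> tracks (C n) xs K t s \<and> (\<forall>j < K. \<bar>s j\<bar> < M) \<and>
     (\<forall>j < K. a j = s j - real (3 * j + 2) * M) \<and> (\<forall>j < K. b j \<ge> - M) \<and> inj_on b {..<K}"

lemma features_2: "\<exists>s M b a. features N G 2 = interleave K b a \<and> running 0 s M b a"
proof -
  let ?a = "\<lambda>i. offset + real i * real i"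
  \<comment> \<open>The largest datum after the first round, read off as the entry of rank
    0.\<close>
  let ?M = "offset + real (K - 1) * real (K - 1)"
  have "features N G (Suc 1) = interleave K (\<lambda>i. - ?a i) (\<lambda>i. raw i - real (3 * i + 2) * ?M)"
  proof (rule features_step[OF features_1])
    fix i zs assume i: "i < K" and zs: "zs ! 0 = ?a i" and m: "mset zs = mset (- raw i # map ?a [0..<K])"
    \<comment> \<open>After the first round the data increase with the index, so the sorted view
      lists them backwards; the pendant entry \<open>- raw i\<close> is below \<open>offset\<close>
      and comes last.\<close>
    define c where "c r = (if r < K then ?a (K - 1 - r) else - raw i)" for r
    have "map (\<lambda>r. ?a (K - 1 - r)) [0..<K] = rev (map ?a [0..<K])"
      by (rule nth_equalityI) (auto simp: rev_nth)
    moreover have "map c [0..<K] = map (\<lambda>r. ?a (K - 1 - r)) [0..<K]" by (simp add: c_def)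
    ultimately have "mset (map c [0..<Suc K]) = mset (rev (map ?a [0..<K]) @ [c K])"
      by (simp only: upt_Suc_append[OF le0] map_append list.map)
    then have view: "mset zs = mset (map c [0..<Suc K])" using m by (simp add: c_def)
    have desc: "c (Suc r) < c r" if r: "r < K" for r
    proof (cases "Suc r < K")
      case True
      then have "real (K - 1 - Suc r) < real (K - 1 - r)" by simp
      then have "real (K - 1 - Suc r) * real (K - 1 - Suc r) < real (K - 1 - r) * real (K - 1 - r)"
        by (intro mult_strict_mono') auto
      then show ?thesis using True by (simp add: c_def)
    next
      case False
      have "- raw i < offset" using raw_bound[OF i] by linarith
      moreover have "0 \<le> real (K - 1 - r) * real (K - 1 - r)" by simp
      ultimately show ?thesis using False r unfolding c_def by (simp del: of_nat_diff)
    qed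
    have own: "c (K - 1 - i) = ?a i" using i by (simp add: c_def)
    have "?a i > 0" using offset_gt by (intro add_pos_nonneg) auto
    then have "layer_fun C zs = - c K - (3 * (real K - 1 - real (K - 1 - i)) + 2) * c 0"
      using K(1) i zs own by (intro layer_fun_joined[OF view desc]) auto
    moreover have "real (K - 1 - i) = real K - 1 - real i" using i by (simp add: of_nat_diff)
    ultimately show "layer_fun C zs = raw i - real (3 * i + 2) * ?M"
      using i by (simp add: c_def)
  qed
  moreover have "running 0 raw ?M (\<lambda>i. - ?a i) (\<lambda>i. raw i - real (3 * i + 2) * ?M)"
    unfolding running_def
  proof (intro conjI allI impI)
    show "tracks (C n) xs K 0 raw" using K n by (auto simp: tracks_def Let_def raw_def)
    show "\<bar>raw j\<bar> < ?M" if "j < K" for j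
    proof -
      have "0 \<le> real (K - 1) * real (K - 1)" by simp
      then show ?thesis using raw_bound[OF that] by linarith
    qed
    show "- ?M \<le> - ?a j" if "j < K" for j
    proof -
      have "real j * real j \<le> real (K - 1) * real (K - 1)" using that by (intro mult_mono) auto
      then show ?thesis by simp
    qed
    show "inj_on (\<lambda>i. - ?a i) {..<K}"
      by (rule inj_onI) (simp flip: of_nat_mult add: power2_eq_square[symmetric])
  qed simp
  ultimately show ?thesis unfolding Suc_1[symmetric] by blast
qed

lemma features_running:
  assumes f: "features N G l = interleave K b a" and run: "running t s M b a"
  shows "features N G (Suc l) = interleave K (\<lambda>i. - a i) (sim_step (C n) K s)"
proof (rule features_step[OF f])
  fix i zs assume i: "i < K" and zs: "zs ! 0 = a i" and m: "mset zs = mset (b i # map a [0..<K])"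
  have s: "tracks (C n) xs K t s" and sM: "\<And>j. j < K \<Longrightarrow> \<bar>s j\<bar> < M"
    and a: "\<And>j. j < K \<Longrightarrow> a j = s j - real (3 * j + 2) * M" and b: "\<And>j. j < K \<Longrightarrow> b j \<ge> - M"
    using run by (auto simp: running_def)
  have M: "M > 0" using sM[of 0] K by linarith
  define c where "c = case_nat (b i) a"
  have c: "c 0 = b i" "\<And>j. c (Suc j) = a j" by (simp_all add: c_def)
  have view: "mset zs = mset (map c [0..<Suc K])"
    using m unfolding map_upt_Suc c by simp
  \<comment> \<open>\<open>a 0\<close> is below \<open>- M\<close> and hence below the pendant;
    later neighbours differ by \<open>3 * M\<close>, of which the states can cancel less than
    \<open>2 * M\<close>.\<close>
  have desc: "c (Suc r) < c r" if r: "r < K" for r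
  proof (cases r)
    case 0
    then have "a 0 = s 0 - 2 * M" using a[of 0] r by simp
    then show ?thesis using 0 b[OF i] sM[of 0] r by (simp add: c)
  next
    case (Suc q)
    then have "a r = s r - real (3 * r + 2) * M" "a q = s q - real (3 * q + 2) * M" using a r by auto
    then have "a r - a q = s r - s q - 3 * M" using Suc by (simp add: algebra_simps)
    then show ?thesis using sM[of r] sM[of q] Suc r by (simp add: c)
  qed
  have len: "length zs = Suc K" by (rule length_desc[OF view desc])
  have rk: "ranked zs (Suc j) = a j" if "j < K" for j
    using ranked_desc[OF view desc, of "Suc j"] that by (simp add: c)
  have "K - 1 = Suc (K - 2)" "K = Suc (K - 1)" using K by auto
  then have "ranked zs (K - 1) = a (K - 2)" "ranked zs K = a (K - 1)"
    using rk[of "K - 2"] rk[of "K - 1"] K by simp_all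
  moreover have "a (K - 2) - a (K - 1) = 3 * M"
  proof -
    have "s (K - 2) = s (K - 1)" using s by (simp add: tracks_def Let_def)
    moreover have "real (3 * (K - 1) + 2) = real (3 * (K - 2) + 2) + 3" using K
      by (simp add: of_nat_diff)
    ultimately show ?thesis using a[of "K - 2"] a[of "K - 1"] K by (simp add: algebra_simps)
  qed
  ultimately have sc: "scale zs = M" by (simp add: scale_def len)
  have sl: "slot zs j = s j" if "j < K" for j
    using that by (simp add: slot_def rk a sc)
  have neg: "c (Suc i) < 0"
  proof -
    have "a i = s i - M - (3 * real i + 1) * M" using a[OF i] by (simp add: algebra_simps)
    moreover have "0 \<le> (3 * real i + 1) * M" using M by simp
    ultimately show ?thesis using sM[OF i] unfolding c by linarith
  qed
  have nu: "slot zs (K - 1) = real n" using sl[of "K - 1"] s K n by (simp add: tracks_def Let_def)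
  have "layer_fun C zs = sim_step (C n) K (slot zs) i"
    using K(1) zs c i neg nu K_eq by (intro layer_fun_stepped[OF view desc]) auto
  also have "sim_step (C n) K (slot zs) = sim_step (C n) K s"
    by (rule sim_step_cong[OF R]) (use K n sl in auto)
  finally show "layer_fun C zs = sim_step (C n) K s i" .
qed

lemma features_halting:
  assumes "features N G l = interleave K b a" "running t s M b a" "halts_after (C n) xs (Suc t)"
  shows "features N G (Suc l) = interleave K (\<lambda>i. - a i) (sim_out (C n) K s)"
proof -
  have "sim_halt (C n) K s = 1"
    using tracks_halt[OF R n K, of t s] assms(2,3) by (simp add: running_def)
  then have "sim_step (C n) K s = sim_out (C n) K s" by (simp add: sim_step_def fun_eq_iff)
  then show ?thesis using features_running[OF assms(1,2)] by simp
qed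

text \<open>These facts pass the invariant on: the next pendant values are the numbers
  \<open>- a i\<close>, again distinct, and positive. Being negative, the data themselves never
  count towards halting.\<close>

lemma running_inj:
  assumes "running t s M b a"
  shows "inj_on a {..<K}" "\<And>i. i < K \<Longrightarrow> a i < 0" "M > 0"
proof -
  have sM: "\<And>j. j < K \<Longrightarrow> \<bar>s j\<bar> < M" and a: "\<And>j. j < K \<Longrightarrow> a j = s j - real (3 * j + 2) * M"
    using assms by (auto simp: running_def)
  show M: "M > 0" using sM[of 0] K by linarith
  have less: "a j < a i" if "i < j" "j < K" for i j
  proof -
    have "3 * M \<le> (3 * (real j - real i)) * M" using M that by (intro mult_right_mono) auto
    then have "a j - a i \<le> s j - s i - 3 * M" using a[of i] a[of j] that by (simp add: algebra_simps)
    then show ?thesis using sM[of i] sM[of j] that by linarith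
  qed
  show "inj_on a {..<K}"
    by (rule inj_onI) (metis less lessThan_iff less_irrefl linorder_neqE_nat)
  show "a i < 0" if "i < K" for i
  proof -
    have "a i = s i - M - (3 * real i + 1) * M" using a[OF that] by (simp add: algebra_simps)
    moreover have "0 \<le> (3 * real i + 1) * M" using M by simp
    ultimately show ?thesis using sM[OF that] by linarith
  qed
qed

lemma features_continuing:
  assumes f: "features N G l = interleave K b a" and run: "running t s M b a"
    and h: "\<not> halts_after (C n) xs (Suc t)"
  shows "\<exists>s M b a. features N G (Suc l) = interleave K b a \<and> running (Suc t) s M b a"
proof -
  let ?s = "sim_next (C n) K s"
  let ?M = "1 + (\<Sum>j<K. ?s j * ?s j)"
  have s: "tracks (C n) xs K t s" using run by (simp add: running_def)
  have "sim_halt (C n) K s = 0" using tracks_halt[OF R n K s] h by simp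
  then have "sim_step (C n) K s = packed K ?s" by (simp add: sim_step_def fun_eq_iff)
  then have f': "features N G (Suc l) = interleave K (\<lambda>i. - a i) (packed K ?s)"
    using features_running[OF f run] by simp
  have bound: "\<bar>?s j\<bar> < ?M" if "j < K" for j
  proof -
    have "?s j * ?s j \<le> (\<Sum>j<K. ?s j * ?s j)" by (rule member_le_sum) (use that in auto)
    moreover have "0 \<le> (\<bar>?s j\<bar> - 1 / 2) * (\<bar>?s j\<bar> - 1 / 2)" by simp
    then have "\<bar>?s j\<bar> < 1 + ?s j * ?s j" by (simp add: algebra_simps)
    ultimately show ?thesis by linarith
  qed
  have "running (Suc t) ?s ?M (\<lambda>i. - a i) (packed K ?s)"
    unfolding running_def
  proof (intro conjI allI impI)
    show "tracks (C n) xs K (Suc t) ?s" by (rule tracks_next[OF R n K s])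
    show "- ?M \<le> - a j" if "j < K" for j
      using running_inj(2)[OF run that] bound[OF that] by linarith
    show "inj_on (\<lambda>i. - a i) {..<K}" using running_inj(1)[OF run] by (simp add: inj_on_def)
  qed (use bound in \<open>simp_all add: packed_def\<close>)
  then show ?thesis using f' by blast
qed

section \<open>The halting time of the network\<close>

lemma gnn_halts_iff:
  assumes "features N G l = interleave K b a" "l > 0"
  shows "gnn_halts_after N G l \<longleftrightarrow> real K < 2 * ((\<Sum>i<K. eq_ind (b i) 1) + (\<Sum>i<K. eq_ind (a i) 1))"
  using assms by (simp add: gnn_halts_after_def circuit_gnn_def halt_detector_Cons sum_list_interleave
      length_interleave sign_def)

text \<open>After the first round only pendants that saved an input can be 1, as the other saved
  labels are \<open>- n\<close>. These are at most \<open>n\<close>, and \<open>4 * n\<close> is at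
  most \<open>K\<close>.\<close>

lemma not_halts_1: "\<not> gnn_halts_after N G 1"
proof -
  have "(\<Sum>i<K. eq_ind (- raw i) 1) \<le> (\<Sum>i<K. if i < n then 1 else 0)"
    by (rule sum_mono) (auto simp: eq_ind_eq raw_def)
  also have "\<dots> \<le> real n"
  proof -
    have "{..<K} \<inter> {i. i < n} = {..<n}" using K by auto
    then show ?thesis by (simp add: sum.If_cases)
  qed
  finally have 1: "(\<Sum>i<K. eq_ind (- raw i) 1) \<le> real n" .
  have "eq_ind (offset + real i * real i) 1 = 0" for i
  proof -
    have "0 \<le> real i * real i" by simp
    then have "offset + real i * real i \<noteq> 1" using offset_gt by linarith
    then show ?thesis by (simp add: eq_ind_eq)
  qed
  then have 2: "(\<Sum>i<K. eq_ind (offset + real i * real i) 1) = 0" by simp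
  have "real (4 * n) \<le> real K" using K(2) by (rule of_nat_mono)
  then show ?thesis using gnn_halts_iff[OF features_1] 1 2 by simp
qed

lemma not_halts_running:
  assumes "features N G l = interleave K b a" "running t s M b a" "l > 0"
  shows "\<not> gnn_halts_after N G l"
proof -
  have "(\<Sum>i<K. eq_ind (b i) 1) \<le> 1"
    by (rule sum_indicator_le_1) (use assms(2) in \<open>simp add: running_def\<close>)
  moreover have "(\<Sum>i<K. eq_ind (a i) 1) = (\<Sum>i<K. 0)"
    by (rule sum.cong) (use running_inj(2)[OF assms(2)] in \<open>force simp: eq_ind_eq\<close>)+
  moreover have "real 4 \<le> real K" using K by (intro of_nat_mono) simp
  ultimately show ?thesis using gnn_halts_iff[OF assms(1,3)] by simp
qed

text \<open>The filler slots from \<open>n_out\<close> on already exceed half of \<open>K\<close>,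
  whatever the outputs and the pendants are.\<close>

lemma halts_halting:
  assumes "features N G l = interleave K b (sim_out (C n) K s)" "l > 0"
  shows "gnn_halts_after N G l"
proof -
  let ?m = "n_out (base (C n))"
  have "0 \<le> (\<Sum>i<K. eq_ind (b i) 1)" by (rule sum_nonneg) (simp add: eq_ind_eq)
  moreover have "(\<Sum>i\<in>{?m..<K}. eq_ind (sim_out (C n) K s i) 1) \<le> (\<Sum>i<K. eq_ind (sim_out (C n) K s i) 1)"
    by (rule sum_mono2) (auto simp: eq_ind_eq)
  moreover have "(\<Sum>i\<in>{?m..<K}. eq_ind (sim_out (C n) K s i) 1) = (\<Sum>i\<in>{?m..<K}. 1)"
    by (rule sum.cong) (auto simp: eq_ind_eq sim_out_def)
  moreover have "real (2 * ?m) < real K" using K(3) by (simp only: of_nat_less_iff)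
  ultimately show ?thesis using gnn_halts_iff[OF assms] K(3) by (simp add: of_nat_diff)
qed

lemma features_until_halt:
  assumes "\<And>i. i \<le> t \<Longrightarrow> \<not> halts_after (C n) xs i"
  shows "\<exists>s M b a. features N G (t + 2) = interleave K b a \<and> running t s M b a"
  using assms
proof (induction t)
  case 0
  show ?case using features_2 by (simp only: add_0)
next
  case (Suc t)
  then obtain s M b a where "features N G (t + 2) = interleave K b a" "running t s M b a" by force
  from features_continuing[OF this] Suc.prems show ?case by simp
qed

lemma not_halts_until:
  assumes "\<And>i. i \<le> t \<Longrightarrow> \<not> halts_after (C n) xs i" "l \<le> t + 2"
  shows "\<not> gnn_halts_after N G l"
proof (cases "l \<le> 1")
  case True
  then show ?thesis using not_halts_1 by (cases "l = 0") (auto simp: gnn_halts_after_def le_Suc_eq)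
next
  case False
  then obtain k where k: "l = k + 2" by (metis add.commute le_Suc_ex not_less_eq_eq Suc_1 One_nat_def)
  then obtain s M b a where "features N G l = interleave K b a" "running k s M b a"
    using features_until_halt[of k] assms by fastforce
  then show ?thesis using not_halts_running False by simp
qed

text \<open>Iteration \<open>i\<close> of the circuit takes place in round \<open>i + 2\<close> of
  the network and neither halts before the other, so the least halting times differ by exactly 2.
  The outputs then stand in the first \<open>n_out\<close> data vertices.\<close>

lemma simulates:
  "case rec_fun (C n) xs of
     None \<Rightarrow> gnn_fun N G = None
   | Some ys \<Rightarrow> \<exists>H. gnn_fun N G = Some H \<and> mset ys \<subseteq># mset (labels H)"
proof (cases "\<exists>i. halts_after (C n) xs i")
  case False
  then have "\<not> gnn_halts_after N G l" for l by (intro not_halts_until[of l]) auto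
  then show ?thesis using False by (simp add: rec_fun_def gnn_fun_def)
next
  case True
  define i where "i = (LEAST i. halts_after (C n) xs i)"
  have i: "halts_after (C n) xs i" unfolding i_def using True by (rule LeastI_ex)
  then obtain t where t: "i = Suc t" by (cases i) (auto simp: halts_after_def)
  have no: "\<not> halts_after (C n) xs j" if "j \<le> t" for j
    using that not_less_Least[of j "halts_after (C n) xs"] t i_def by simp
  obtain s M b a where f: "features N G (t + 2) = interleave K b a" and run: "running t s M b a"
    using features_until_halt[OF no] by blast
  have f': "features N G (t + 3) = interleave K (\<lambda>i. - a i) (sim_out (C n) K s)"
    using features_halting[OF f run] i t by (simp add: numeral_3_eq_3)
  have h: "gnn_halts_after N G (t + 3)" by (rule halts_halting[OF f']) simp
  have L: "(LEAST l. gnn_halts_after N G l) = t + 3"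
  proof (rule Least_equality[where P = "gnn_halts_after N G", OF h])
    fix l assume "gnn_halts_after N G l"
    then show "t + 3 \<le> l" using not_halts_until[of t l, OF no] by force
  qed
  let ?m = "n_out (base (C n))"
  have s: "tracks (C n) xs K t s" using run by (simp add: running_def)
  define ys where "ys = map (sim_out (C n) K s) [0..<?m]"
  have "rec_fun (C n) xs = Some (case_prod (outputs (base (C n))) (rec_state (C n) xs t))"
    using True t by (auto simp: rec_fun_def i_def[symmetric])
  also have "case_prod (outputs (base (C n))) (rec_state (C n) xs t) = ys"
    by (simp add: ys_def outputs_def sim_out_def tracks_val[OF R n K s] vals_def case_prod_beta)
  finally have ys: "rec_fun (C n) xs = Some ys" .
  have "map (sim_out (C n) K s) [0..<K] = ys @ map (sim_out (C n) K s) [?m..<K]"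
    using K(3) upt_add_eq_append[of 0 ?m "K - ?m"] unfolding ys_def map_append[symmetric] by simp
  then have "mset ys \<subseteq># mset (interleave K (\<lambda>i. - a i) (sim_out (C n) K s))"
    unfolding mset_interleave by simp
  moreover have "gnn_fun N G = Some (G\<lparr>labels := features N G (t + 3)\<rparr>)"
    using h L by (auto simp: gnn_fun_def)
  ultimately show ?thesis using ys f' by simp
qed

end

theorem theorem4:
  fixes F :: circuit_class and A :: "(real \<Rightarrow> real) set" and C :: "nat \<Rightarrow> rec_circuit"
  assumes "C \<in> rec_families (with_sign F) (add_gates F A)"
  shows "\<exists>N \<GG>.
    N \<in> gnns (tail_functions (with_sign F)) (tail_functions (add_gates (with_sign F) A)) {id} \<and>
    symbolic_logspace_encoding \<GG> \<and>
    (\<forall>n. \<forall>xs. length xs = n \<longrightarrow>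
       (case rec_fun (C n) xs of
          None \<Rightarrow> gnn_fun N (graph_encoding \<GG> (C n) xs) = None
        | Some ys \<Rightarrow> \<exists>H. gnn_fun N (graph_encoding \<GG> (C n) xs) = Some H \<and>
            mset ys \<subseteq># mset (labels H)))"
proof (intro exI conjI allI impI)
  show "circuit_gnn C \<in> gnns (tail_functions (with_sign F)) (tail_functions (add_gates (with_sign F) A)) {id}"
    by (rule circuit_gnn_class[OF assms])
  show "symbolic_logspace_encoding encoding" by (rule symbolic_logspace_encoding)
  fix n and xs :: "real list" assume xs: "length xs = n"
  obtain i B where "F = FAC i B" by (cases F)
  then have C: "wf_rec (C n)" "n_in (base (C n)) = n"
    using assms by (simp_all add: rec_families_def)
  interpret slot_simulation C xs n "length (enc_rec (C n))"
    by unfold_locales (use C xs in simp_all)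
  show "case rec_fun (C n) xs of
      None \<Rightarrow> gnn_fun (circuit_gnn C) (graph_encoding encoding (C n) xs) = None
    | Some ys \<Rightarrow> \<exists>H. gnn_fun (circuit_gnn C) (graph_encoding encoding (C n) xs) = Some H \<and>
        mset ys \<subseteq># mset (labels H)"
    by (rule simulates)
qed

end
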